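(* Let $(X_n)_{n\geq 1}$ be independent standard Gaussian random variables and let $F(\sigma)=\sum_{n=1}^\infty X_n n^{-\sigma}$, which almost surely converges for every real $\sigma>1/2$. For $T>1/2$ let $N(T,\infty)$ denote the number of real zeros of $F$ in the interval $[T,\infty)$, each zero counted without multiplicity. Then there exist $\delta>0$ and real constants $c_0$ and $(c_n)_{n\geq 2}$ such that for all $T\in(1/2,1/2+\delta)$, $$\mathbb{E}\, N(T,\infty)=\frac{1}{2\pi}\log\left(\frac{1}{T-1/2}\right)+c_0+\sum_{n=2}^\infty c_n(T-1/2)^{n}.$$ *)

theory Defs
  imports "HOL-Probability.Probability"
begin

text \<open>\<^term>\<open>suminf\<close> takes an unspecified value where the series diverges; for independent
  standard Gaussian coefficients and \<open>\<sigma> > 1/2\<close> this concerns a null set only.\<close>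

definition dirichlet_F :: "(nat \<Rightarrow> 'a \<Rightarrow> real) \<Rightarrow> 'a \<Rightarrow> real \<Rightarrow> real" where
  "dirichlet_F X \<omega> \<sigma> = (\<Sum>k. X (Suc k) \<omega> * real (Suc k) powr (-\<sigma>))"

text \<open>Counting measure, so that an infinite set of zeros has count \<open>\<infinity>\<close>
  (with \<^term>\<open>card\<close> it would be \<open>0\<close>).\<close>

definition num_zeros :: "(nat \<Rightarrow> 'a \<Rightarrow> real) \<Rightarrow> real \<Rightarrow> 'a \<Rightarrow> ennreal" where
  "num_zeros X T \<omega> = emeasure (count_space UNIV) {\<sigma>. T \<le> \<sigma> \<and> dirichlet_F X \<omega> \<sigma> = 0}"

text \<open>The series converges only almost surely, so \<open>num_zeros\<close> is determined only up to null sets;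
  hence the completion of \<open>M\<close>.\<close>

definition expected_zeros :: "'a measure \<Rightarrow> (nat \<Rightarrow> 'a \<Rightarrow> real) \<Rightarrow> real \<Rightarrow> ennreal" where
  "expected_zeros M X T = (\<integral>\<^sup>+\<omega>. num_zeros X T \<omega> \<partial>completion M)"

end

theory Submission
  imports Defs "HOL-Complex_Analysis.Complex_Analysis" "HOL-Real_Asymp.Real_Asymp"
begin

text \<open>As \<open>F a\<close> and \<open>F b\<close> are jointly Gaussian, they have opposite signs with
  probability \<open>arccos r / pi\<close>, where the correlation \<open>r\<close> is
  \<open>zeta (a + b) / sqrt (zeta (2 a) zeta (2 b))\<close>, so that \<open>ln r\<close> is a second difference of \<open>ln zeta\<close>.
  Almost surely \<open>F\<close> has only simple zeros, so they are counted by the sign changes along ever finer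
  grids, and the expected number of zeros in \<open>[T, \<infinity>)\<close> is the integral of
  \<open>sqrt ((ln zeta)'' (2 x)) / pi\<close>. Near the pole \<open>(ln zeta)'' (1 + 2 x) = 1 / (4 x\<^sup>2) + (analytic)\<close>, hence
  the integrand is \<open>1 / (2 pi x)\<close> plus \<open>x\<close> times an analytic function; there is no constant term, which is
  why the linear term is absent from the expansion.\<close>

section \<open>Dirichlet series\<close>

text \<open>Only the joint law of \<open>F\<close> at two points enters; the sign-change probability
  stands in for the joint density of \<open>F\<close> and its derivative used in the classical
  Kac-Rice argument. That probability is known exactly at an intermediate point of each grid cell
  (two mean value theorems), and those points become the tags of a Riemann sum. Two matters remain.
  To interchange limit and expectation, Fatou's lemma gives one inequality; the other follows
  because sign changes never exceed zeros, on any grid. Simplicity of the zeros is a matter of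
  scales: with mesh \<open>h\<close>, the part of the right value that is independent of the left
  one has size at least of order h, so two neighbouring values are both O(h^2) with probability
  O(h^3), while there are O(1/h) cells. The random series, like the alternating one used at the
  pole, need not converge absolutely where it is needed. Both are therefore handled through growth
  of the partial sums of their coefficients. The Gaussian law of a pair of infinite sums comes from
  characteristic functions.\<close>

lemma norm_powr_minus_diff_le:
  fixes s :: complex and a :: real
  assumes a: "0 < a" and s: "0 \<le> Re s"
  shows "norm (of_real a powr (-s) - of_real (a + 1) powr (-s)) \<le> norm s * a powr (- Re s - 1)"
proof -
  let ?S = "closed_segment (of_real a) (of_real (a + 1)) :: complex set"
  have mem: "z \<in> \<real>" "a \<le> Re z" if "z \<in> ?S" for z
  proof -
    from that obtain u where u: "0 \<le> u" "z = (1 - u) *\<^sub>R of_real a + u *\<^sub>R of_real (a + 1)"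
      unfolding closed_segment_def by blast
    then have "z = of_real (a + u)" by (simp add: scaleR_conv_of_real algebra_simps)
    then show "z \<in> \<real>" "a \<le> Re z" using u(1) by auto
  qed
  have "norm (of_real a powr (-s) - of_real (a + 1) powr (-s))
      \<le> (norm s * a powr (- Re s - 1)) * norm (of_real a - of_real (a + 1) :: complex)"
  proof (rule field_differentiable_bound[where S = ?S and f' = "\<lambda>z. (-s) * z powr (-s - 1)"])
    show "convex ?S" by simp
  next
    fix z assume z: "z \<in> ?S"
    have "z \<notin> \<real>\<^sub>\<le>\<^sub>0" using mem[OF z] a by (auto simp: complex_nonpos_Reals_iff)
    then show "((\<lambda>z. z powr (-s)) has_field_derivative (-s) * z powr (-s - 1)) (at z within ?S)"
      by (auto intro!: derivative_eq_intros)
  next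
    fix z assume z: "z \<in> ?S"
    have "norm ((-s) * z powr (-s - 1)) = norm s * Re z powr (- Re s - 1)"
      using mem[OF z] a by (simp add: norm_mult norm_powr_real_powr)
    also have "\<dots> \<le> norm s * a powr (- Re s - 1)"
      using mem[OF z] a s by (intro mult_left_mono powr_mono2') auto
    finally show "norm ((-s) * z powr (-s - 1)) \<le> norm s * a powr (- Re s - 1)" .
  qed auto
  also have "norm (of_real a - of_real (a + 1) :: complex) = 1"
    by simp
  finally show ?thesis by simp
qed

lemma summable_Suc_powr_minus: "1 < p \<Longrightarrow> summable (\<lambda>k. real (Suc k) powr (-p))"
  using summable_real_powr_iff[of "-p"] summable_Suc_iff[of "\<lambda>k. real k powr (-p)"] by simp

text \<open>Abel summation. The boundary term is O(N powr (\<kappa> - Re s)) and vanishes;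
  consecutive powers differ by O(n powr (- Re s - 1)), one order better than the powers themselves,
  so the rearranged series converges absolutely even if the original one does not.\<close>

lemma dirichlet_series_by_parts:
  fixes x :: "nat \<Rightarrow> complex" and C \<kappa> :: real
  assumes bnd: "\<And>n. norm (\<Sum>k<n. x k) \<le> C * real n powr \<kappa>" and \<kappa>: "0 \<le> \<kappa>" and s: "\<kappa> < Re s"
  shows "(\<lambda>k. x k * of_real (real (Suc k)) powr (-s)) sums
    (\<Sum>n. (\<Sum>k<Suc n. x k) * (of_real (real (Suc n)) powr (-s) - of_real (real (Suc (Suc n))) powr (-s)))"
proof -
  define f where "f k = (of_real (real (Suc k)) powr (-s) :: complex)" for k
  define S where "S n = (\<Sum>k<n. x k)" for n
  have C: "0 \<le> C" using order_trans[OF norm_ge_zero bnd[of 1]] by simp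
  have parts: "(\<Sum>k<N. x k * f k) = S N * f N + (\<Sum>k<N. S (Suc k) * (f k - f (Suc k)))" for N
    by (induction N) (auto simp: S_def algebra_simps)
  have bd: "norm (S (Suc n) * (f n - f (Suc n))) \<le> C * norm s * real (Suc n) powr (-(Re s - \<kappa> + 1))" for n
  proof -
    have "norm (f n - f (Suc n)) \<le> norm s * real (Suc n) powr (- Re s - 1)"
      using norm_powr_minus_diff_le[of "real (Suc n)" s] s \<kappa> by (simp add: f_def add_ac)
    then have "norm (S (Suc n)) * norm (f n - f (Suc n)) \<le> (C * real (Suc n) powr \<kappa>) * (norm s * real (Suc n) powr (- Re s - 1))"
      using bnd[of "Suc n"] C unfolding S_def by (intro mult_mono) auto
    also have "\<dots> = C * norm s * (real (Suc n) powr \<kappa> * real (Suc n) powr (- Re s - 1))"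
      by simp
    also have "real (Suc n) powr \<kappa> * real (Suc n) powr (- Re s - 1) = real (Suc n) powr (-(Re s - \<kappa> + 1))"
      by (simp only: powr_add[symmetric]) (simp add: algebra_simps)
    finally show ?thesis by (simp add: norm_mult)
  qed
  have sm: "summable (\<lambda>n. S (Suc n) * (f n - f (Suc n)))"
    by (rule summable_comparison_test'[OF _ bd]) (intro summable_mult summable_Suc_powr_minus, use s in simp)
  have "(\<lambda>N. S N * f N) \<longlonglongrightarrow> 0"
  proof (rule Lim_null_comparison)
    show "\<forall>\<^sub>F n in sequentially. norm (S n * f n) \<le> C * real (Suc n) powr (\<kappa> - Re s)"
    proof (rule always_eventually, intro allI)
      fix n
      have "norm (S n * f n) \<le> (C * real n powr \<kappa>) * real (Suc n) powr (- Re s)"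
        unfolding norm_mult f_def using bnd[of n] by (intro mult_mono) (auto simp: S_def norm_powr_real_powr C simp del: of_nat_Suc)
      also have "\<dots> \<le> (C * real (Suc n) powr \<kappa>) * real (Suc n) powr (- Re s)"
        using C \<kappa> by (intro mult_right_mono mult_left_mono powr_mono2) auto
      also have "\<dots> = C * real (Suc n) powr (\<kappa> - Re s)"
        by (simp only: mult.assoc powr_add[symmetric]) simp
      finally show "norm (S n * f n) \<le> C * real (Suc n) powr (\<kappa> - Re s)" .
    qed
    have "(\<lambda>n. real (Suc n) powr (\<kappa> - Re s)) \<longlonglongrightarrow> 0"
      by (rule tendsto_neg_powr) (use s filterlim_compose[OF filterlim_real_sequentially filterlim_Suc] in auto)
    then show "(\<lambda>n. C * real (Suc n) powr (\<kappa> - Re s)) \<longlonglongrightarrow> 0"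
      using tendsto_mult_left[of _ 0 _ C] by simp
  qed
  from tendsto_add[OF this summable_LIMSEQ[OF sm]]
  have "(\<lambda>k. x k * f k) sums (\<Sum>n. S (Suc n) * (f n - f (Suc n)))"
    unfolding sums_def parts by simp
  then show ?thesis by (simp add: f_def S_def del: sum.lessThan_Suc of_nat_Suc)
qed

text \<open>The Weierstrass test is applied to the series rearranged by parts, since the original
  terms may have no summable majorant.\<close>

lemma dirichlet_series_holomorphic:
  fixes x :: "nat \<Rightarrow> complex" and C \<kappa> :: real
  assumes bnd: "\<And>n. norm (\<Sum>k<n. x k) \<le> C * real n powr \<kappa>" and \<kappa>: "0 \<le> \<kappa>"
  shows "(\<lambda>s. \<Sum>k. x k * of_real (real (Suc k)) powr (-s)) holomorphic_on {s. \<kappa> < Re s}"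
proof -
  define S where "S n = (\<Sum>k<n. x k)" for n
  define g where "g n s = S (Suc n) * (of_real (real (Suc n)) powr (-s) - of_real (real (Suc (Suc n))) powr (-s))"
    for n and s :: complex
  have C: "0 \<le> C" using order_trans[OF norm_ge_zero bnd[of 1]] by simp
  have op: "open {s. \<kappa> < Re s}" by (simp add: open_halfspace_Re_gt)
  have "(\<lambda>s. \<Sum>n. g n s) holomorphic_on {s. \<kappa> < Re s}"
  proof (rule holomorphic_uniform_sequence[OF op, of "\<lambda>N s. \<Sum>n<N. g n s"])
    show "(\<lambda>s. \<Sum>n<N. g n s) holomorphic_on {s. \<kappa> < Re s}" for N
      unfolding g_def by (intro holomorphic_intros)
  next
    fix z assume "z \<in> {s. \<kappa> < Re s}"
    \<comment> \<open>Half the distance from \<open>z\<close> to the line Re s = \<kappa>; the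
      closed disc then stays in Re s \<ge> \<kappa> + d.\<close>
    define d where "d = (Re z - \<kappa>) / 2"
    have d: "0 < d" "Re z = \<kappa> + 2 * d" using \<open>z \<in> _\<close> by (auto simp: d_def field_simps)
    have re: "\<kappa> + d \<le> Re s" "norm s \<le> norm z + d" if "s \<in> cball z d" for s
    proof -
      have "norm (z - s) \<le> d" using that by (simp add: dist_norm)
      then show "\<kappa> + d \<le> Re s" "norm s \<le> norm z + d" 
        using complex_Re_le_cmod[of "z - s"] d(2) norm_triangle_ineq4[of z "z - s"] by simp_all
    qed
    have "uniform_limit (cball z d) (\<lambda>N s. \<Sum>n<N. g n s) (\<lambda>s. \<Sum>n. g n s) sequentially"
    proof (rule Weierstrass_m_test[where M = "\<lambda>n. C * (norm z + d) * real (Suc n) powr (-(d + 1))"])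
      fix n s assume s: "s \<in> cball z d"
      have Res: "0 \<le> Re s" using re[OF s] d \<kappa> by linarith
      have "norm (g n s) \<le> (C * real (Suc n) powr \<kappa>) * (norm s * real (Suc n) powr (- Re s - 1))"
        unfolding g_def norm_mult
      proof (intro mult_mono)
        show "cmod (complex_of_real (real (Suc n)) powr - s - complex_of_real (real (Suc (Suc n))) powr - s)
          \<le> cmod s * real (Suc n) powr (- Re s - 1)"
          using norm_powr_minus_diff_le[of "real (Suc n)" s] Res by (simp add: add_ac)
      qed (use bnd[of "Suc n"] C in \<open>auto simp: S_def\<close>)
      also have "\<dots> \<le> (C * real (Suc n) powr \<kappa>) * ((norm z + d) * real (Suc n) powr (- (\<kappa> + d) - 1))"
        using re[OF s] C d by (intro mult_left_mono mult_mono powr_mono) auto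
      also have "\<dots> = C * (norm z + d) * (real (Suc n) powr \<kappa> * real (Suc n) powr (- (\<kappa> + d) - 1))"
        by simp
      also have "real (Suc n) powr \<kappa> * real (Suc n) powr (- (\<kappa> + d) - 1) = real (Suc n) powr (-(d + 1))"
        by (simp only: powr_add[symmetric]) (simp add: algebra_simps)
      finally show "norm (g n s) \<le> C * (norm z + d) * real (Suc n) powr (-(d + 1))" .
    qed (intro summable_mult summable_Suc_powr_minus, use d in simp)
    moreover have "cball z d \<subseteq> {s. \<kappa> < Re s}"
      using re d(1) by force
    ultimately show "\<exists>d>0. cball z d \<subseteq> {s. \<kappa> < Re s} \<and>
        uniform_limit (cball z d) (\<lambda>N s. \<Sum>n<N. g n s) (\<lambda>s. \<Sum>n. g n s) sequentially"
      using d(1) by blast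
  qed
  then show ?thesis
  proof (rule holomorphic_transform)
    fix s assume "s \<in> {s. \<kappa> < Re s}"
    then show "(\<Sum>n. g n s) = (\<Sum>k. x k * of_real (real (Suc k)) powr (-s))"
      unfolding g_def S_def using sums_unique[OF dirichlet_series_by_parts[of x C \<kappa> s]] bnd \<kappa>
      by simp
  qed
qed

section \<open>The zeta function on the real line\<close>

text \<open>For s > 1 this is (-1)^j times the j-th derivative of zeta; dropping the sign makes all
  terms nonnegative. As 0 ^ 0 = 1, the term n = 1 is present exactly for j = 0, where the function
  is zeta itself.\<close>

definition zeta_log :: "nat \<Rightarrow> real \<Rightarrow> real" where
  "zeta_log j s = (\<Sum>k. ln (real (Suc k)) ^ j * real (Suc k) powr (-s))"

lemma summable_zeta_log:
  assumes "1 < s"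
  shows "summable (\<lambda>k. ln (real (Suc k)) ^ j * real (Suc k) powr (-s))"
proof (rule summable_comparison_test')
  \<comment> \<open>Chosen so that ln n \<le> n powr a / a costs at most half of the excess s - 1
    after taking the j-th power; \<open>Suc j\<close> avoids division by zero for j = 0.\<close>
  define a where "a = (s - 1) / (2 * real (Suc j))"
  have a: "0 < a" "a * real j \<le> (s - 1) / 2"
    using assms by (auto simp: a_def field_simps)
  show "summable (\<lambda>k. (1 / a ^ j) * real (Suc k) powr (- ((s + 1) / 2)))"
    using assms by (intro summable_mult summable_Suc_powr_minus) simp
  fix k :: nat
  let ?n = "real (Suc k)"
  have "ln ?n ^ j \<le> (?n powr a / a) ^ j"
    using a(1) by (intro power_mono ln_powr_bound) auto
  also have "\<dots> = ?n powr (a * real j) / a ^ j"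
    by (simp add: power_divide powr_powr[symmetric] powr_realpow)
  also have "\<dots> \<le> ?n powr ((s - 1) / 2) / a ^ j"
    using a by (intro divide_right_mono powr_mono) auto
  finally have "ln ?n ^ j * ?n powr (-s) \<le> ?n powr ((s - 1) / 2) / a ^ j * ?n powr (-s)"
    by (intro mult_right_mono) auto
  also have "\<dots> = (1 / a ^ j) * (?n powr ((s - 1) / 2) * ?n powr (-s))" by simp
  also have "?n powr ((s - 1) / 2) * ?n powr (-s) = ?n powr (- ((s + 1) / 2))"
  proof -
    have "(s - 1) / 2 + - s = - ((s + 1) / 2)" by (simp add: field_simps)
    then show ?thesis by (simp only: powr_add[symmetric])
  qed
  finally show "norm (ln ?n ^ j * ?n powr (-s)) \<le> (1 / a ^ j) * ?n powr (- ((s + 1) / 2))"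
    by simp
qed

text \<open>Termwise differentiation, with uniform convergence of the derivatives on
  \<open>{c..}\<close> for a point \<open>c\<close> halfway between 1 and \<open>s\<close>.\<close>

lemma zeta_log_has_derivative:
  assumes s: "1 < s"
  shows "(zeta_log j has_real_derivative - zeta_log (Suc j) s) (at s)"
proof -
  define c where "c = (1 + s) / 2"
  have c: "1 < c" "c < s" using s by (auto simp: c_def)
  have "((\<lambda>x. \<Sum>k. ln (real (Suc k)) ^ j * real (Suc k) powr (-x)) has_real_derivative
      (\<Sum>k. - (ln (real (Suc k)) ^ Suc j * real (Suc k) powr (-s)))) (at s)"
  proof (rule has_field_derivative_series'(2)[where S = "{c..}" and ?x0.0 = s])
    show "((\<lambda>x. ln (real (Suc k)) ^ j * real (Suc k) powr (-x)) has_real_derivative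
        - (ln (real (Suc k)) ^ Suc j * real (Suc k) powr (-x))) (at x within {c..})" for k x
    proof -
      have "((\<lambda>x. l ^ j * exp (- x * l)) has_real_derivative - (l ^ Suc j * exp (- x * l))) (at x within {c..})" for l :: real
        by (auto intro!: derivative_eq_intros)
      from this[of "ln (real (Suc k))"] show ?thesis by (simp add: powr_def)
    qed
    show "uniformly_convergent_on {c..} (\<lambda>n x. \<Sum>k<n. - (ln (real (Suc k)) ^ Suc j * real (Suc k) powr (-x)))"
    proof (rule Weierstrass_m_test')
      show "norm (- (ln (real (Suc k)) ^ Suc j * real (Suc k) powr (-x))) \<le> ln (real (Suc k)) ^ Suc j * real (Suc k) powr (-c)"
        if "x \<in> {c..}" for k x
        using that by (auto simp: abs_mult power_abs intro!: mult_left_mono powr_mono)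
    qed (rule summable_zeta_log[OF c(1)])
    show "summable (\<lambda>k. ln (real (Suc k)) ^ j * real (Suc k) powr (-s))"
      by (rule summable_zeta_log[OF s])
  qed (use c in \<open>auto simp: interior_real_atLeast\<close>)
  moreover have "(\<Sum>k. - (ln (real (Suc k)) ^ Suc j * real (Suc k) powr (-s))) = - zeta_log (Suc j) s"
    unfolding zeta_log_def by (rule suminf_minus[OF summable_zeta_log[OF s]])
  ultimately show ?thesis by (simp add: zeta_log_def[abs_def])
qed

lemma zeta_log_0_ge_1: "1 < s \<Longrightarrow> 1 \<le> zeta_log 0 s"
  using sum_le_suminf[OF summable_zeta_log[of s 0], of "{0}"] by (simp add: zeta_log_def)

lemma zeta_log_nonneg: "1 < s \<Longrightarrow> 0 \<le> zeta_log j s"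
  unfolding zeta_log_def by (intro suminf_nonneg summable_zeta_log) auto

definition ln_zeta_deriv2 :: "real \<Rightarrow> real" where
  "ln_zeta_deriv2 s = zeta_log 2 s / zeta_log 0 s - (zeta_log 1 s / zeta_log 0 s)\<^sup>2"

lemma ln_zeta_derivs:
  assumes s: "1 < s"
  shows "((\<lambda>x. ln (zeta_log 0 x)) has_real_derivative - zeta_log 1 s / zeta_log 0 s) (at s)"
    and "((\<lambda>x. - zeta_log 1 x / zeta_log 0 x) has_real_derivative ln_zeta_deriv2 s) (at s)"
proof -
  note [derivative_intros] = DERIV_chain2[OF zeta_log_has_derivative]
  have p: "0 < zeta_log 0 s" using zeta_log_0_ge_1[OF s] by simp
  show "((\<lambda>x. ln (zeta_log 0 x)) has_real_derivative - zeta_log 1 s / zeta_log 0 s) (at s)"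
    using p s by (auto intro!: derivative_eq_intros simp: field_simps)
  show "((\<lambda>x. - zeta_log 1 x / zeta_log 0 x) has_real_derivative ln_zeta_deriv2 s) (at s)"
    using p s by (auto intro!: derivative_eq_intros simp: ln_zeta_deriv2_def field_simps power2_eq_square numeral_2_eq_2)
qed

text \<open>\<open>ln_zeta_deriv2 s\<close> is the variance of \<open>ln n\<close> under the weights \<open>n powr -s / zeta_log 0 s\<close>.\<close>

lemma ln_zeta_deriv2_pos:
  assumes s: "1 < s"
  shows "0 < ln_zeta_deriv2 s"
proof -
  have p: "0 < zeta_log 0 s" using zeta_log_0_ge_1[OF s] by simp
  define t where "t = zeta_log 1 s / zeta_log 0 s"
  let ?f = "\<lambda>j k. ln (real (Suc k)) ^ j * real (Suc k) powr (-s)"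
  have sums: "?f j sums zeta_log j s" for j
    unfolding zeta_log_def by (rule summable_sums[OF summable_zeta_log[OF s]])
  have "(\<lambda>k. ?f 2 k + (- 2 * t) * ?f 1 k + t\<^sup>2 * ?f 0 k) sums (zeta_log 2 s + (- 2 * t) * zeta_log 1 s + t\<^sup>2 * zeta_log 0 s)"
    by (intro sums_add sums_mult sums)
  also have "(\<lambda>k. ?f 2 k + (- 2 * t) * ?f 1 k + t\<^sup>2 * ?f 0 k) = (\<lambda>k. (ln (real (Suc k)) - t)\<^sup>2 * real (Suc k) powr (-s))"
    by (intro ext) (simp add: power2_eq_square algebra_simps)
  finally have S: "(\<lambda>k. (ln (real (Suc k)) - t)\<^sup>2 * real (Suc k) powr (-s)) sums (zeta_log 2 s + (- 2 * t) * zeta_log 1 s + t\<^sup>2 * zeta_log 0 s)" .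
  have "\<exists>k. t \<noteq> ln (real (Suc k))"
  proof (cases "t = 0")
    case True
    then show ?thesis by (intro exI[of _ 1]) auto
  next
    case False
    then show ?thesis by (intro exI[of _ 0]) auto
  qed
  then obtain k where k: "t \<noteq> ln (real (Suc k))" by blast
  have "0 < (\<Sum>k. (ln (real (Suc k)) - t)\<^sup>2 * real (Suc k) powr (-s))"
  proof (rule suminf_pos2[of _ k])
    have "0 < (ln (real (Suc k)) - t)\<^sup>2" using k by simp
    then show "0 < (ln (real (Suc k)) - t)\<^sup>2 * real (Suc k) powr (-s)" by (intro mult_pos_pos) auto
  qed (use S in \<open>auto simp: sums_iff\<close>)
  then have "0 < zeta_log 2 s + (- 2 * t) * zeta_log 1 s + t\<^sup>2 * zeta_log 0 s"
    using S by (simp add: sums_iff)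
  also have "\<dots> = zeta_log 0 s * ln_zeta_deriv2 s"
    using p by (simp add: t_def ln_zeta_deriv2_def field_simps power2_eq_square)
  finally show ?thesis using p by (simp add: zero_less_mult_iff)
qed

lemma continuous_on_ln_zeta_deriv2: "continuous_on {1<..} ln_zeta_deriv2"
proof -
  have c: "continuous_on {1<..} (zeta_log j)" for j
    by (intro continuous_at_imp_continuous_on ballI DERIV_isCont[OF zeta_log_has_derivative]) auto
  show ?thesis
    unfolding ln_zeta_deriv2_def[abs_def]
  proof (intro continuous_intros c ballI)
    show "zeta_log 0 x \<noteq> 0" if "x \<in> {1<..}" for x using zeta_log_0_ge_1[of x] that by auto
    show "zeta_log 0 x \<noteq> 0" if "x \<in> {1<..}" for x using zeta_log_0_ge_1[of x] that by auto
  qed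
qed

text \<open>A variance is at most the second moment. In that moment the term n = 1 drops out because
  ln 1 = 0, and for n \<ge> 2 the factor n powr (3 - s) is at most 2 powr (3 - s). This decay makes
  the zero density integrable at infinity.\<close>

lemma ln_zeta_deriv2_le:
  assumes s: "3 \<le> s"
  shows "ln_zeta_deriv2 s \<le> 8 * zeta_log 2 3 * 2 powr (-s)"
proof -
  have p: "1 \<le> zeta_log 0 s" using zeta_log_0_ge_1[of s] s by simp
  have "ln_zeta_deriv2 s \<le> zeta_log 2 s / zeta_log 0 s" by (simp add: ln_zeta_deriv2_def)
  also have "\<dots> \<le> zeta_log 2 s" using divide_left_mono[of 1 "zeta_log 0 s" "zeta_log 2 s"] p zeta_log_nonneg[of s 2] s by simp
  also have "\<dots> \<le> (\<Sum>k. 2 powr (3 - s) * (ln (real (Suc k)) ^ 2 * real (Suc k) powr (-3)))"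
    unfolding zeta_log_def
  proof (intro suminf_le summable_mult summable_zeta_log)
    fix k
    show "ln (real (Suc k)) ^ 2 * real (Suc k) powr (-s) \<le> 2 powr (3 - s) * (ln (real (Suc k)) ^ 2 * real (Suc k) powr (-3))"
    proof (cases "k = 0")
      case False
      then have "real (Suc k) powr (3 - s) \<le> 2 powr (3 - s)"
        using s by (intro powr_mono2') auto
      then have "real (Suc k) powr (3 - s) * (ln (real (Suc k)) ^ 2 * real (Suc k) powr (-3))
          \<le> 2 powr (3 - s) * (ln (real (Suc k)) ^ 2 * real (Suc k) powr (-3))"
        by (intro mult_right_mono) auto
      moreover have "real (Suc k) powr (-s) = real (Suc k) powr (3 - s) * real (Suc k) powr (-3)"
        by (simp add: powr_add[symmetric])
      ultimately show ?thesis by (simp only: mult_ac)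
    qed simp
  qed (use s in auto)
  also have "\<dots> = 2 powr (3 - s) * zeta_log 2 3"
    unfolding zeta_log_def by (rule suminf_mult) (rule summable_zeta_log, simp)
  also have "2 powr (3 - s) = 8 * 2 powr (-s)" by (simp add: powr_diff powr_minus field_simps)
  finally show ?thesis by (simp add: mult_ac)
qed

text \<open>Mean value theorem for L (x + h) - L x, then for L'. An exact value at an intermediate
  point is kept instead of an error term.\<close>

lemma ln_zeta_second_difference:
  assumes s: "1 < s" and h: "0 < h"
  shows "\<exists>\<xi>. s < \<xi> \<and> \<xi> < s + 2 * h \<and>
    ln (zeta_log 0 s) + ln (zeta_log 0 (s + 2 * h)) - 2 * ln (zeta_log 0 (s + h)) = h\<^sup>2 * ln_zeta_deriv2 \<xi>"
proof -
  define L where "L x = ln (zeta_log 0 x)" for x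
  define L1 where "L1 x = - zeta_log 1 x / zeta_log 0 x" for x
  have D: "(L has_real_derivative L1 x) (at x)" "(L1 has_real_derivative ln_zeta_deriv2 x) (at x)" if "1 < x" for x
    using ln_zeta_derivs[OF that] by (simp_all add: L_def[abs_def] L1_def[abs_def])
  note [derivative_intros] = DERIV_chain2[OF D(1)]
  have "\<exists>x1. s < x1 \<and> x1 < s + h \<and> (L (s + h + h) - L (s + h)) - (L (s + h) - L s) = (s + h - s) * (L1 (x1 + h) - L1 x1)"
    by (rule MVT2[where f = "\<lambda>x. L (x + h) - L x"]) (use s h in \<open>auto intro!: derivative_eq_intros\<close>)
  then obtain x1 where x1: "s < x1" "x1 < s + h" "L (s + h + h) - L (s + h) - (L (s + h) - L s) = h * (L1 (x1 + h) - L1 x1)"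
    by auto
  have "\<exists>\<xi>. x1 < \<xi> \<and> \<xi> < x1 + h \<and> L1 (x1 + h) - L1 x1 = (x1 + h - x1) * ln_zeta_deriv2 \<xi>"
    by (rule MVT2) (use s h x1 D in auto)
  then obtain \<xi> where \<xi>: "x1 < \<xi>" "\<xi> < x1 + h" "L1 (x1 + h) - L1 x1 = h * ln_zeta_deriv2 \<xi>" by auto
  show ?thesis
    using x1 \<xi> by (intro exI[of _ \<xi>]) (auto simp: L_def power2_eq_square algebra_simps)
qed

section \<open>Expansion of the density at the pole of zeta\<close>

text \<open>Along the real axis the complex derivative is the derivative of the restriction. This
  carries real derivatives of ln zeta over to a function holomorphic on a full disc.\<close>

lemma deriv_of_real_eq:
  fixes g :: "real \<Rightarrow> real"
  assumes f: "f holomorphic_on S" "open S" "complex_of_real x \<in> S"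
    and I: "open I" "x \<in> I" "\<And>y. y \<in> I \<Longrightarrow> f (of_real y) = of_real (g y)"
    and g: "(g has_real_derivative D) (at x)"
  shows "deriv f (of_real x) = of_real D"
proof (rule vector_derivative_unique_at)
  show "((\<lambda>y. f (of_real y)) has_vector_derivative deriv f (of_real x)) (at x)"
    by (intro has_vector_derivative_real_field holomorphic_derivI[OF f])
  have "(g has_vector_derivative D) (at x)"
    using g by (simp add: has_real_derivative_iff_has_vector_derivative)
  then have "((\<lambda>y. complex_of_real (g y)) has_vector_derivative of_real D) (at x)"
    by (rule bounded_linear.has_vector_derivative[OF bounded_linear_of_real])
  then show "((\<lambda>y. f (of_real y)) has_vector_derivative of_real D) (at x)"
    by (rule has_vector_derivative_transform_within_open[OF _ I(1,2)]) (simp add: I(3))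
qed

text \<open>The Dirichlet eta function, the alternating zeta series. Its coefficients have bounded
  partial sums, so it is holomorphic across the line Re s = 1.\<close>

definition eta :: "complex \<Rightarrow> complex" where
  "eta s = (\<Sum>k. (- 1) ^ k * of_real (real (Suc k)) powr (-s))"

lemma eta_holomorphic: "eta holomorphic_on {s. 0 < Re s}"
  unfolding eta_def[abs_def]
proof (rule dirichlet_series_holomorphic)
  fix n
  have s: "(\<Sum>k<n. (- 1 :: complex) ^ k) = (if even n then 0 else 1)"
    by (induction n) auto
  \<comment> \<open>In HOL \<open>0 powr 0\<close> is 0, so the case n = 0 holds only because the
    empty sum vanishes.\<close>
  show "norm (\<Sum>k<n. (- 1 :: complex) ^ k) \<le> 1 * real n powr 0"
    unfolding s by (cases n) auto
qed simp

lemma eta_of_real: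
  assumes "(\<lambda>k. (- 1) ^ k * real (Suc k) powr (-x)) sums v"
  shows "eta (of_real x) = of_real v"
proof -
  have "complex_of_real ((- 1) ^ k * real (Suc k) powr (-x)) = (- 1) ^ k * of_real (real (Suc k)) powr (- of_real x)" for k
    using powr_of_real[of "real (Suc k)" "-x"] by (simp del: of_nat_Suc)
  with sums_of_real[OF assms, where 'a = complex] show ?thesis
    unfolding eta_def by (simp add: sums_iff del: of_nat_Suc)
qed

lemma eta_1: "eta 1 = of_real (ln 2)"
  using eta_of_real[of 1 "ln 2"] alternating_harmonic_series_sums
  by (simp add: powr_minus divide_inverse)

text \<open>zeta - eta is twice the sum over even n, which is 2 * 2 powr (-s) times zeta again. In
  \<open>f\<close> the index is shifted: odd \<open>k\<close> stands for even n = k + 1, and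
  grouping in pairs leaves one nonzero term per pair.\<close>

lemma eta_eq_zeta:
  assumes s: "1 < s"
  shows "eta (of_real s) = of_real ((1 - 2 powr (1 - s)) * zeta_log 0 s)"
proof (rule eta_of_real)
  let ?z = "zeta_log 0 s"
  define f where "f k = (1 - (- 1) ^ k) * real (Suc k) powr (-s)" for k
  have z: "(\<lambda>k. real (Suc k) powr (-s)) sums ?z"
    using summable_sums[OF summable_zeta_log[OF s, of 0]] by (simp add: zeta_log_def)
  have "summable f"
  proof (rule summable_comparison_test')
    show "summable (\<lambda>k. 2 * real (Suc k) powr (-s))" using z by (auto simp: sums_iff)
    show "norm (f k) \<le> 2 * real (Suc k) powr (-s)" for k
      by (cases "even k") (auto simp: f_def)
  qed
  then have fs: "f sums suminf f" by (rule summable_sums)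
  have "(\<lambda>j. sum f {j * 2..<j * 2 + 2}) sums suminf f"
    using fs by (rule sums_group) simp
  moreover have "sum f {j * 2..<j * 2 + 2} = 2 powr (1 - s) * real (Suc j) powr (-s)" for j
  proof -
    have "{j * 2..<j * 2 + 2} = {2 * j, Suc (2 * j)}" by auto
    then have "sum f {j * 2..<j * 2 + 2} = 2 * real (2 * Suc j) powr (-s)" by (simp add: f_def)
    also have "real (2 * Suc j) powr (-s) = 2 powr (-s) * real (Suc j) powr (-s)"
      by (subst powr_mult[symmetric]) simp_all
    also have "2 * (2 powr (-s) * real (Suc j) powr (-s)) = 2 powr (1 - s) * real (Suc j) powr (-s)"
      by (simp add: powr_diff powr_minus field_simps)
    finally show ?thesis .
  qed
  ultimately have "(\<lambda>j. 2 powr (1 - s) * real (Suc j) powr (-s)) sums suminf f" by simp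
  with sums_mult[OF z, of "2 powr (1 - s)"] have "suminf f = 2 powr (1 - s) * ?z"
    using sums_unique2 by blast
  with fs have "(\<lambda>k. real (Suc k) powr (-s) - f k) sums (?z - 2 powr (1 - s) * ?z)"
    by (intro sums_diff z) simp
  moreover have "real (Suc k) powr (-s) - f k = (- 1) ^ k * real (Suc k) powr (-s)" for k
    by (simp add: f_def algebra_simps)
  moreover have "?z - 2 powr (1 - s) * ?z = (1 - 2 powr (1 - s)) * ?z" by (simp add: algebra_simps)
  ultimately show "(\<lambda>k. (- 1) ^ k * real (Suc k) powr (-s)) sums ((1 - 2 powr (1 - s)) * ?z)"
    by (simp only:)
qed

text \<open>Positive real part keeps the values off the branch cut of \<open>Ln\<close> and
  \<open>csqrt\<close>, so that both may be composed with \<open>f\<close> holomorphically.\<close>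

lemma Re_pos_near:
  fixes f :: "complex \<Rightarrow> complex"
  assumes f: "f holomorphic_on ball 0 r" "0 < r" and pos: "0 < Re (f 0)"
  shows "\<exists>d>0. d \<le> r \<and> (\<forall>z\<in>ball 0 d. 0 < Re (f z))"
proof -
  have "continuous_on (ball 0 r) f" using f(1) by (rule holomorphic_on_imp_continuous_on)
  then have "isCont f 0" using f(2) by (simp add: continuous_on_eq_continuous_at)
  then have "((\<lambda>z. Re (f z)) \<longlongrightarrow> Re (f 0)) (at 0)"
    by (intro tendsto_Re) (simp add: isCont_def)
  then have "\<forall>\<^sub>F z in at 0. 0 < Re (f z)" using pos by (rule order_tendstoD(1))
  then obtain d where d: "0 < d" "\<And>z. z \<noteq> 0 \<Longrightarrow> dist z 0 < d \<Longrightarrow> 0 < Re (f z)"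
    unfolding eventually_at by auto
  show ?thesis
  proof (intro exI[of _ "min d r"] conjI ballI)
    show "0 < Re (f z)" if "z \<in> ball 0 (min d r)" for z
      using d(2)[of z] pos that by (cases "z = 0") (auto simp: dist_commute)
  qed (use d f(2) in auto)
qed

text \<open>Near \<open>s = 1\<close> the pole of zeta is read off \<open>(1 - 2 powr (1 - s)) zeta(s) = eta(s)\<close>,
  as \<open>eta 1 = ln 2\<close> does not vanish.\<close>

lemma ln_zeta_near_1:
  "\<exists>\<rho>>0. \<exists>h. h holomorphic_on ball 0 \<rho> \<and>
    (\<forall>x. 0 < x \<longrightarrow> x < \<rho> \<longrightarrow> h (of_real x) = of_real (ln (zeta_log 0 (1 + 2 * x)) + ln x))"
proof -
  \<comment> \<open>With s = 1 + 2 z, the factor 2 powr (1 - s) is exp (- 2 z ln 2).\<close>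
  define c :: real where "c = 2 * ln 2"
  have c: "0 < c" by (simp add: c_def)
  define f where "f z = 1 - exp (- of_real c * z)" for z :: complex
  have df: "(f has_field_derivative of_real c * exp (- of_real c * z)) (at z)" for z
    unfolding f_def by (auto intro!: derivative_eq_intros)
  have hf: "f holomorphic_on UNIV"
    unfolding f_def[abs_def] by (intro holomorphic_intros)
  \<comment> \<open>The quotient f z / z with its singularity at 0 removed (f 0 = 0). Hence e x = x
    * m x * zeta (1 + 2 x) for small x > 0, and \<open>Ln e - Ln m\<close> is ln zeta + ln x, free
    of the pole.\<close>
  define m where "m z = (if z = 0 then deriv f 0 else (f z - f 0) / (z - 0))" for z
  have hm: "m holomorphic_on UNIV"
    unfolding m_def[abs_def] by (rule pole_lemma[OF hf]) simp
  have m0: "m 0 = of_real c" using DERIV_imp_deriv[OF df[of 0]] by (simp add: m_def)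
  define e where "e z = eta (1 + 2 * z)" for z
  have he: "e holomorphic_on ball 0 (1 / 2)"
  proof -
    have "0 < Re (1 + 2 * z)" if "z \<in> ball 0 (1 / 2)" for z
      using that abs_Re_le_cmod[of z] by (auto simp: abs_le_iff)
    then have "(eta \<circ> (\<lambda>z. 1 + 2 * z)) holomorphic_on ball 0 (1 / 2)"
      by (intro holomorphic_on_compose_gen[OF _ eta_holomorphic] holomorphic_intros) auto
    then show ?thesis by (simp add: e_def[abs_def] o_def)
  qed
  have "0 < Re (e 0)" by (simp add: e_def eta_1)
  then obtain d1 where d1: "0 < d1" "d1 \<le> 1 / 2" "\<forall>z\<in>ball 0 d1. 0 < Re (e z)"
    using Re_pos_near[OF he] by auto
  have "m holomorphic_on ball 0 1" by (rule holomorphic_on_subset[OF hm]) simp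
  then obtain d2 where d2: "0 < d2" "d2 \<le> 1" "\<forall>z\<in>ball 0 d2. 0 < Re (m z)"
    using Re_pos_near[of m 1] m0 c by auto
  define \<rho> where "\<rho> = min d1 d2"
  have sub: "ball 0 \<rho> \<subseteq> ball 0 d1" "ball 0 \<rho> \<subseteq> ball 0 d2" by (auto simp: \<rho>_def)
  define h where "h z = Ln (e z) - Ln (m z)" for z
  show ?thesis
  proof (intro exI[of _ \<rho>] exI[of _ h] conjI allI impI)
    show "0 < \<rho>" using d1 d2 by (simp add: \<rho>_def)
    have "e z \<notin> \<real>\<^sub>\<le>\<^sub>0" "m z \<notin> \<real>\<^sub>\<le>\<^sub>0" if "z \<in> ball 0 \<rho>" for z
    proof -
      have "0 < Re (e z)" "0 < Re (m z)" using d1(3) d2(3) sub that by blast+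
      then show "e z \<notin> \<real>\<^sub>\<le>\<^sub>0" "m z \<notin> \<real>\<^sub>\<le>\<^sub>0" by (auto simp: complex_nonpos_Reals_iff)
    qed
    moreover have "e holomorphic_on ball 0 \<rho>"
      by (rule holomorphic_on_subset[OF he]) (use d1(2) in \<open>auto simp: \<rho>_def\<close>)
    moreover have "m holomorphic_on ball 0 \<rho>"
      by (rule holomorphic_on_subset[OF hm]) simp
    ultimately show "h holomorphic_on ball 0 \<rho>"
      unfolding h_def[abs_def] by (intro holomorphic_intros) auto
  next
    fix x :: real assume x: "0 < x" "x < \<rho>"
    have z: "0 < zeta_log 0 (1 + 2 * x)" using zeta_log_0_ge_1[of "1 + 2 * x"] x by simp
    define t where "t = 1 - 2 powr (- 2 * x)"
    have t: "0 < t" using x by (simp add: t_def powr_less_one)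
    have "1 - (1 + 2 * x) = - 2 * x" by simp
    then have ex: "e (of_real x) = of_real (t * zeta_log 0 (1 + 2 * x))"
      using eta_eq_zeta[of "1 + 2 * x"] x by (simp add: e_def t_def)
    have "exp (- of_real c * complex_of_real x) = of_real (2 powr (- 2 * x))"
      by (simp add: powr_def c_def exp_of_real[symmetric] algebra_simps)
    then have mx: "m (of_real x) = of_real (t / x)" using x by (simp add: m_def f_def t_def)
    have "h (of_real x) = of_real (ln (t * zeta_log 0 (1 + 2 * x)) - ln (t / x))"
      unfolding h_def ex mx using t z x by (simp add: Ln_of_real del: of_real_mult of_real_divide)
    also have "ln (t * zeta_log 0 (1 + 2 * x)) - ln (t / x) = ln (zeta_log 0 (1 + 2 * x)) + ln x"
      using t z x by (simp add: ln_mult ln_div)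
    finally show "h (of_real x) = of_real (ln (zeta_log 0 (1 + 2 * x)) + ln x)" .
  qed
qed

text \<open>Differentiating the regularised logarithm twice: the inner factor 2 contributes the 4,
  and ln x contributes -1 / x^2. So \<open>H\<close> is the regular part of the double pole.\<close>

lemma ln_zeta_deriv2_near_1:
  "\<exists>\<rho>>0. \<exists>H. H holomorphic_on ball 0 \<rho> \<and>
    (\<forall>x. 0 < x \<longrightarrow> x < \<rho> \<longrightarrow> H (of_real x) = of_real (4 * ln_zeta_deriv2 (1 + 2 * x) - 1 / x\<^sup>2))"
proof -
  obtain \<rho> h where h: "0 < \<rho>" "h holomorphic_on ball 0 \<rho>"
    "\<forall>x. 0 < x \<longrightarrow> x < \<rho> \<longrightarrow> h (of_real x) = of_real (ln (zeta_log 0 (1 + 2 * x)) + ln x)"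
    using ln_zeta_near_1 by blast
  note [derivative_intros] = DERIV_chain2[OF ln_zeta_derivs(1)]
  have L: "((\<lambda>x. ln (zeta_log 0 (1 + 2 * x)) + ln x) has_real_derivative
      2 * (- zeta_log 1 (1 + 2 * x) / zeta_log 0 (1 + 2 * x)) + 1 / x) (at x)" if "0 < x" for x
    using that by (auto intro!: derivative_eq_intros simp: mult.commute)
  have L': "((\<lambda>x. 2 * (- zeta_log 1 (1 + 2 * x) / zeta_log 0 (1 + 2 * x)) + 1 / x) has_real_derivative
      4 * ln_zeta_deriv2 (1 + 2 * x) - 1 / x\<^sup>2) (at x)" if "0 < x" for x
  proof -
    have "((\<lambda>x. - zeta_log 1 (1 + 2 * x) / zeta_log 0 (1 + 2 * x)) has_real_derivative ln_zeta_deriv2 (1 + 2 * x) * 2) (at x)"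
      using that by (intro DERIV_chain2[OF ln_zeta_derivs(2)]) (auto intro!: derivative_eq_intros)
    from DERIV_add[OF DERIV_cmult[OF this, of 2] DERIV_inverse[of x]] that
    show ?thesis by (simp add: inverse_eq_divide power2_eq_square)
  qed
  have h1: "deriv h (of_real x) = of_real (2 * (- zeta_log 1 (1 + 2 * x) / zeta_log 0 (1 + 2 * x)) + 1 / x)"
    if "0 < x" "x < \<rho>" for x
    by (rule deriv_of_real_eq[OF h(2), of x "{0<..<\<rho>}"]) (use that h(3) L in auto)
  have hd: "deriv h holomorphic_on ball 0 \<rho>" by (intro holomorphic_deriv h) simp
  have h2: "deriv (deriv h) (of_real x) = of_real (4 * ln_zeta_deriv2 (1 + 2 * x) - 1 / x\<^sup>2)"
    if "0 < x" "x < \<rho>" for x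
    by (rule deriv_of_real_eq[OF hd, of x "{0<..<\<rho>}"]) (use that h1 L' in auto)
  show ?thesis
    by (intro exI[of _ \<rho>] exI[of _ "deriv (deriv h)"]) (use h(1) hd h2 in \<open>auto intro: holomorphic_deriv\<close>)
qed

text \<open>With W = 1 + z^2 H one has csqrt W - 1 = z^2 H / (csqrt W + 1). The denominator never
  vanishes because \<open>csqrt\<close> has nonnegative real part, so the quotient is holomorphic
  and the factor z^2 is explicit.\<close>

lemma sqrt_ln_zeta_deriv2_expansion:
  "\<exists>\<rho>>0. \<exists>r :: nat \<Rightarrow> real. (\<forall>x. \<bar>x\<bar> < \<rho> \<longrightarrow> summable (\<lambda>n. r n * x ^ n)) \<and>
    (\<forall>x. 0 < x \<longrightarrow> x < \<rho> \<longrightarrow> 2 * x * sqrt (ln_zeta_deriv2 (1 + 2 * x)) = 1 + x\<^sup>2 * (\<Sum>n. r n * x ^ n))"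
proof -
  obtain \<rho> H where H: "0 < \<rho>" "H holomorphic_on ball 0 \<rho>"
    "\<forall>x. 0 < x \<longrightarrow> x < \<rho> \<longrightarrow> H (of_real x) = of_real (4 * ln_zeta_deriv2 (1 + 2 * x) - 1 / x\<^sup>2)"
    using ln_zeta_deriv2_near_1 by blast
  define W where "W z = 1 + z\<^sup>2 * H z" for z
  have hW: "W holomorphic_on ball 0 \<rho>" unfolding W_def[abs_def] by (intro holomorphic_intros H)
  have "0 < Re (W 0)" by (simp add: W_def)
  then obtain d where d: "0 < d" "d \<le> \<rho>" "\<forall>z\<in>ball 0 d. 0 < Re (W z)"
    using Re_pos_near[OF hW H(1)] by auto
  define R where "R z = H z / (csqrt (W z) + 1)" for z
  have sub: "ball 0 d \<subseteq> ball 0 \<rho>" using d(2) by auto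
  have nz: "csqrt w + 1 \<noteq> 0" for w
  proof
    assume "csqrt w + 1 = 0"
    then have "Re (csqrt w) + 1 = 0" by (metis one_complex.sel(1) plus_complex.sel(1) zero_complex.sel(1))
    then show False using csqrt_principal[of w] by linarith
  qed
  have "W z \<notin> \<real>\<^sub>\<le>\<^sub>0" if "z \<in> ball 0 d" for z
  proof -
    have "0 < Re (W z)" using d(3) that by blast
    then show ?thesis by (auto simp: complex_nonpos_Reals_iff)
  qed
  then have cs: "(\<lambda>z. csqrt (W z)) holomorphic_on ball 0 d"
    by (intro holomorphic_on_csqrt' holomorphic_on_subset[OF hW sub])
  have hR: "R holomorphic_on ball 0 d"
    unfolding R_def[abs_def]
    by (intro holomorphic_on_divide holomorphic_on_add holomorphic_on_const holomorphic_on_subset[OF H(2) sub] cs nz)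
  \<comment> \<open>For real \<open>x\<close> the real parts of the Taylor terms sum to Re (R x),
    which is the quantity compared below.\<close>
  define r where "r n = Re ((deriv ^^ n) R 0 / fact n)" for n
  have ps: "(\<lambda>n. r n * x ^ n) sums Re (R (of_real x))" if "\<bar>x\<bar> < d" for x
  proof -
    have P: "(\<lambda>n. (deriv ^^ n) R 0 / fact n * (of_real x - 0) ^ n) sums R (of_real x)"
      using that by (intro holomorphic_power_series[OF hR]) simp
    have eq: "Re ((deriv ^^ n) R 0 / fact n * (of_real x - 0) ^ n) = r n * x ^ n" for n
    proof -
      have "Re (c * of_real t) = Re c * t" for c t by simp
      then show ?thesis unfolding r_def diff_0_right of_real_power[symmetric] by blast
    qed
    from sums_Re[OF P] show ?thesis unfolding eq .
  qed
  show ?thesis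
  proof (intro exI[of _ d] exI[of _ r] conjI allI impI d(1))
    show "summable (\<lambda>n. r n * x ^ n)" if "\<bar>x\<bar> < d" for x using ps[OF that] by (simp add: sums_iff)
  next
    fix x :: real assume x: "0 < x" "x < d"
    define q where "q = ln_zeta_deriv2 (1 + 2 * x)"
    have q: "0 < q" using x by (simp add: q_def ln_zeta_deriv2_pos)
    have "W (of_real x) = of_real (1 + x\<^sup>2 * (4 * q - 1 / x\<^sup>2))"
      using H(3) x d(2) by (simp add: W_def q_def)
    also have "1 + x\<^sup>2 * (4 * q - 1 / x\<^sup>2) = (2 * x)\<^sup>2 * q" using x by (simp add: field_simps)
    finally have W: "W (of_real x) = of_real ((2 * x)\<^sup>2 * q)" .
    then have cs: "csqrt (W (of_real x)) = of_real (2 * x * sqrt q)"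
      using q x by (simp add: of_real_sqrt[symmetric] real_sqrt_mult del: of_real_mult)
    have "(csqrt (W (of_real x)) - 1) * (csqrt (W (of_real x)) + 1) = (csqrt (W (of_real x)))\<^sup>2 - 1"
      by (simp add: power2_eq_square algebra_simps)
    also have "\<dots> = of_real (x\<^sup>2) * H (of_real x)" by (simp add: W_def)
    finally have "csqrt (W (of_real x)) - 1 = of_real (x\<^sup>2) * R (of_real x)"
      using nz[of "W (of_real x)"] by (simp add: R_def field_simps)
    then have "Re (csqrt (W (of_real x)) - 1) = x\<^sup>2 * Re (R (of_real x))"
      by (simp add: Re_complex_of_real flip: of_real_power)
    then have "2 * x * sqrt q = 1 + x\<^sup>2 * Re (R (of_real x))"
      unfolding cs by simp
    also have "Re (R (of_real x)) = (\<Sum>n. r n * x ^ n)" using ps[of x] x by (simp add: sums_iff)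
    finally show "2 * x * sqrt (ln_zeta_deriv2 (1 + 2 * x)) = 1 + x\<^sup>2 * (\<Sum>n. r n * x ^ n)"
      by (simp add: q_def)
  qed
qed


text \<open>By the expansion, the derivative to be matched is 1 / (2 pi x) + x / (2 pi) times the
  power series \<open>r\<close>, which forces n c_n = - r_(n-2) / (2 pi). The series is subtracted
  here because the expected count is a constant minus this antiderivative.\<close>

lemma sqrt_ln_zeta_deriv2_antiderivative:
  "\<exists>\<rho>>0. \<exists>c :: nat \<Rightarrow> real. (\<forall>x. \<bar>x\<bar> < \<rho> \<longrightarrow> summable (\<lambda>k. c (k + 2) * x ^ (k + 2))) \<and>
    (\<forall>x. 0 < x \<longrightarrow> x < \<rho> \<longrightarrow> ((\<lambda>x. ln x / (2 * pi) - (\<Sum>k. c (k + 2) * x ^ (k + 2))) has_real_derivative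
      sqrt (ln_zeta_deriv2 (1 + 2 * x)) / pi) (at x))"
proof -
  obtain \<rho> r where r: "0 < \<rho>" "\<forall>x. \<bar>x\<bar> < \<rho> \<longrightarrow> summable (\<lambda>n. r n * x ^ n)"
    "\<forall>x. 0 < x \<longrightarrow> x < \<rho> \<longrightarrow> 2 * x * sqrt (ln_zeta_deriv2 (1 + 2 * x)) = 1 + x\<^sup>2 * (\<Sum>n. r n * x ^ n)"
    using sqrt_ln_zeta_deriv2_expansion by blast
  define c where "c n = - (r (n - 2) / (2 * pi * real n))" for n
  \<comment> \<open>Shift to the form f n x^(n+1) that termwise differentiation expects; the padding
    f 0 = 0 is the missing linear coefficient.\<close>
  define f where "f n = (if n = 0 then 0 else c (Suc n))" for n
  have f_Suc: "f (Suc n) = c (n + 2)" for n by (simp add: f_def)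
  have df: "f (Suc n) * real (Suc (Suc n)) * x ^ Suc n = (- x / (2 * pi)) * (r n * x ^ n)" for n x
    by (simp add: f_def c_def del: of_nat_Suc)
  have summ_d: "summable (\<lambda>n. f n * real (Suc n) * x ^ n)" if "\<bar>x\<bar> < \<rho>" for x
    using r(2) that by (subst summable_Suc_iff[symmetric]) (simp only: df summable_mult)
  have D: "((\<lambda>x. \<Sum>n. f n * x ^ Suc n) has_real_derivative (\<Sum>n. f n * real (Suc n) * x ^ n)) (at x)"
    if "\<bar>x\<bar> < \<rho>" for x
    by (rule DERIV_power_series'[of \<rho>]) (use that summ_d r(1) in auto)
  have summ: "summable (\<lambda>n. f n * x ^ Suc n)" if x: "\<bar>x\<bar> < \<rho>" for x
  proof (rule summable_comparison_test')
    \<comment> \<open>Convergence of the differentiated series at the larger radius \<open>y\<close>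
      gives absolute convergence at \<open>x\<close>, hence a majorant.\<close>
    obtain y where y: "\<bar>x\<bar> < y" "y < \<rho>" using dense[OF x] by blast
    show "summable (\<lambda>n. \<bar>x\<bar> * norm (f n * real (Suc n) * x ^ n))"
    proof (intro summable_mult powser_insidea[where x = y])
      show "summable (\<lambda>n. f n * real (Suc n) * y ^ n)" using summ_d[of y] y by simp
    qed (use y in simp)
    show "norm (f n * x ^ Suc n) \<le> \<bar>x\<bar> * norm (f n * real (Suc n) * x ^ n)" for n
    proof -
      have "(\<bar>f n\<bar> * \<bar>x\<bar> ^ Suc n) * 1 \<le> (\<bar>f n\<bar> * \<bar>x\<bar> ^ Suc n) * real (Suc n)"
        by (intro mult_left_mono) auto
      then show ?thesis by (simp add: abs_mult power_abs mult_ac)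
    qed
  qed
  have summ_c: "summable (\<lambda>k. c (k + 2) * x ^ (k + 2))" if "\<bar>x\<bar> < \<rho>" for x
    using summ[OF that] by (subst (asm) summable_Suc_iff[symmetric]) (simp add: f_Suc)
  have eq: "(\<Sum>n. f n * x ^ Suc n) = (\<Sum>k. c (k + 2) * x ^ (k + 2))" if "\<bar>x\<bar> < \<rho>" for x
    using suminf_split_head[OF summ[OF that]] by (simp add: f_Suc) (simp add: f_def)
  have "((\<lambda>x. ln x / (2 * pi) - (\<Sum>k. c (k + 2) * x ^ (k + 2))) has_real_derivative
      sqrt (ln_zeta_deriv2 (1 + 2 * x)) / pi) (at x)" if x: "0 < x" "x < \<rho>" for x
  proof -
    have x': "\<bar>x\<bar> < \<rho>" using x by simp
    have "(\<Sum>n. f n * real (Suc n) * x ^ n) = (\<Sum>n. f (Suc n) * real (Suc (Suc n)) * x ^ Suc n)"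
      using suminf_split_head[OF summ_d[OF x']] by (simp add: f_def)
    also have "\<dots> = (- x / (2 * pi)) * (\<Sum>n. r n * x ^ n)"
      unfolding df by (rule suminf_mult) (use r(2) x' in blast)
    finally have S: "(\<Sum>n. f n * real (Suc n) * x ^ n) = (- x / (2 * pi)) * (\<Sum>n. r n * x ^ n)" .
    have "((\<lambda>x. \<Sum>k. c (k + 2) * x ^ (k + 2)) has_real_derivative (- x / (2 * pi)) * (\<Sum>n. r n * x ^ n)) (at x)"
      using D[OF x'] unfolding S
      by (rule has_field_derivative_transform_within_open[where S = "{-\<rho><..<\<rho>}"]) (use x eq in auto)
    moreover have "((\<lambda>x. ln x / (2 * pi)) has_real_derivative (1 / x) / (2 * pi)) (at x)"
      using x by (auto intro!: derivative_eq_intros)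
    ultimately have "((\<lambda>x. ln x / (2 * pi) - (\<Sum>k. c (k + 2) * x ^ (k + 2))) has_real_derivative
        (1 / x) / (2 * pi) - (- x / (2 * pi)) * (\<Sum>n. r n * x ^ n)) (at x)"
      by (intro DERIV_diff)
    moreover have "(1 / x) / (2 * pi) - (- x / (2 * pi)) * (\<Sum>n. r n * x ^ n) = sqrt (ln_zeta_deriv2 (1 + 2 * x)) / pi"
    proof -
      have "sqrt (ln_zeta_deriv2 (1 + 2 * x)) = (1 + x\<^sup>2 * (\<Sum>n. r n * x ^ n)) / (2 * x)"
        using r(3) x by (simp add: field_simps)
      then show ?thesis using x(1) by (simp add: field_simps power2_eq_square)
    qed
    ultimately show ?thesis by simp
  qed
  with summ_c r(1) show ?thesis by blast
qed

section \<open>Counting zeros by sign changes\<close>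

definition grid :: "real \<Rightarrow> real \<Rightarrow> nat \<Rightarrow> nat \<Rightarrow> real" where
  "grid a b n k = a + real k * ((b - a) / real n)"

text \<open>The strict inequality ignores cells with a zero at an endpoint; almost surely no grid
  point is a zero of \<open>F\<close>.\<close>

definition sign_changes :: "(real \<Rightarrow> real) \<Rightarrow> real \<Rightarrow> real \<Rightarrow> nat \<Rightarrow> nat" where
  "sign_changes f a b n = card {k. k < n \<and> f (grid a b n k) * f (grid a b n (Suc k)) < 0}"

lemma grid_Suc: "grid a b n (Suc k) = grid a b n k + (b - a) / real n"
  by (simp only: grid_def of_nat_Suc distrib_right mult_1_left add_ac)

lemma grid_0 [simp]: "grid a b n 0 = a"
  by (simp add: grid_def)

lemma grid_self [simp]: "n > 0 \<Longrightarrow> grid a b n n = b"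
  by (simp add: grid_def)

lemma grid_mono: "a \<le> b \<Longrightarrow> j \<le> k \<Longrightarrow> grid a b n j \<le> grid a b n k"
  unfolding grid_def by (intro add_left_mono mult_right_mono) auto

lemma grid_bounds: "a \<le> b \<Longrightarrow> k \<le> n \<Longrightarrow> n > 0 \<Longrightarrow> a \<le> grid a b n k \<and> grid a b n k \<le> b"
  using grid_mono[of a b 0 k n] grid_mono[of a b k n n] by simp

lemma IVT_product_neg:
  fixes f :: "real \<Rightarrow> real"
  assumes "f a * f b < 0" "a < b" "continuous_on {a..b} f"
  shows "\<exists>x. a < x \<and> x < b \<and> f x = 0"
proof -
  have "\<exists>x. a \<le> x \<and> x \<le> b \<and> f x = 0"
  proof (cases "f a < 0")
    case True
    with assms(1) have "0 < f b" by (simp add: mult_less_0_iff)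
    with True show ?thesis using IVT'[of f a 0 b] assms(2,3) by auto
  next
    case False
    with assms(1) have "0 < f a" "f b < 0" by (auto simp: mult_less_0_iff)
    then show ?thesis using IVT2'[of f b 0 a] assms(2,3) by auto
  qed
  then obtain x where "a \<le> x" "x \<le> b" "f x = 0" by blast
  moreover have "x \<noteq> a" "x \<noteq> b" using assms(1) \<open>f x = 0\<close> by auto
  ultimately show ?thesis by (intro exI[of _ x]) auto
qed

text \<open>Each counted cell has a zero in its interior by the intermediate value theorem, and
  interiors of distinct cells are disjoint. The bound holds for every single grid, which later
  supplies the upper half of the passage to the limit under the expectation.\<close>

lemma sign_changes_le_zeros:
  fixes f :: "real \<Rightarrow> real"
  assumes ab: "a < b" and cont: "continuous_on {a..b} f"
  shows "of_nat (sign_changes f a b n) \<le> emeasure (count_space UNIV) {x. a \<le> x \<and> x \<le> b \<and> f x = 0}"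
proof (cases "finite {x. a \<le> x \<and> x \<le> b \<and> f x = 0}")
  case True
  let ?K = "{k. k < n \<and> f (grid a b n k) * f (grid a b n (Suc k)) < 0}"
  have "\<exists>x. grid a b n k < x \<and> x < grid a b n (Suc k) \<and> f x = 0" if "k \<in> ?K" for k
  proof (rule IVT_product_neg)
    have "{grid a b n k..grid a b n (Suc k)} \<subseteq> {a..b}"
      using grid_bounds[of a b k n] grid_bounds[of a b "Suc k" n] that ab by auto
    then show "continuous_on {grid a b n k..grid a b n (Suc k)} f"
      using cont continuous_on_subset by blast
    show "grid a b n k < grid a b n (Suc k)" using that ab by (auto simp: grid_Suc)
  qed (use that in auto)
  then have "\<forall>k\<in>?K. \<exists>x. grid a b n k < x \<and> x < grid a b n (Suc k) \<and> f x = 0" by blast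
  from bchoice[OF this] obtain z
    where z: "\<And>k. k \<in> ?K \<Longrightarrow> grid a b n k < z k \<and> z k < grid a b n (Suc k) \<and> f (z k) = 0"
    by blast
  have lt: "z j < z k" if "j \<in> ?K" "k \<in> ?K" "j < k" for j k
  proof -
    have "grid a b n (Suc j) \<le> grid a b n k" using grid_mono[of a b "Suc j" k n] ab that(3) by simp
    then show ?thesis using z[OF that(1)] z[OF that(2)] by linarith
  qed
  have "inj_on z ?K"
  proof (rule inj_onI)
    fix j k assume "j \<in> ?K" "k \<in> ?K" "z j = z k"
    then show "j = k" using lt[of j k] lt[of k j] by (cases j k rule: linorder_cases) auto
  qed
  moreover have "z ` ?K \<subseteq> {x. a \<le> x \<and> x \<le> b \<and> f x = 0}"
  proof
    fix x assume "x \<in> z ` ?K"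
    then obtain k where k: "k \<in> ?K" "x = z k" by blast
    then show "x \<in> {x. a \<le> x \<and> x \<le> b \<and> f x = 0}"
      using z[OF k(1)] grid_bounds[of a b k n] grid_bounds[of a b "Suc k" n] ab by auto
  qed
  ultimately have "card ?K \<le> card {x. a \<le> x \<and> x \<le> b \<and> f x = 0}"
    using True by (rule card_inj_on_le)
  then show ?thesis using True by (simp add: sign_changes_def)
next
  case False
  then show ?thesis by simp
qed

text \<open>The derivative test gives the sign on each side; a negative derivative is reduced to a
  positive one by passing to -f. The two points vary independently, so they can be the ends of
  whichever cell contains the zero.\<close>

lemma simple_zero_sign_change:
  fixes f :: "real \<Rightarrow> real"
  assumes "(f has_real_derivative D) (at z)" "f z = 0" "D \<noteq> 0"
  shows "\<exists>d>0. \<forall>x y. z - d < x \<longrightarrow> x < z \<longrightarrow> z < y \<longrightarrow> y < z + d \<longrightarrow> f x * f y < 0"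
proof -
  have pos: "\<exists>d>0. \<forall>x y. z - d < x \<longrightarrow> x < z \<longrightarrow> z < y \<longrightarrow> y < z + d \<longrightarrow> g x < 0 \<and> 0 < g y"
    if g: "(g has_real_derivative E) (at z)" "g z = 0" "0 < E" for g :: "real \<Rightarrow> real" and E
  proof -
    obtain d1 where d1: "d1 > 0" "\<And>h. 0 < h \<Longrightarrow> h < d1 \<Longrightarrow> g z < g (z + h)"
      using DERIV_pos_inc_right[OF g(1,3)] by auto
    obtain d2 where d2: "d2 > 0" "\<And>h. 0 < h \<Longrightarrow> h < d2 \<Longrightarrow> g (z - h) < g z"
      using DERIV_pos_inc_left[OF g(1,3)] by auto
    show ?thesis
    proof (intro exI[of _ "min d1 d2"] conjI allI impI)
      fix x y assume "z - min d1 d2 < x" "x < z" "z < y" "y < z + min d1 d2"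
      then show "g x < 0" "0 < g y" using d1(2)[of "y - z"] d2(2)[of "z - x"] g(2) by auto
    qed (use d1 d2 in auto)
  qed
  show ?thesis
  proof (cases "0 < D")
    case True
    then show ?thesis using pos[OF assms(1,2)] by (meson mult_neg_pos)
  next
    case False
    then have "0 < - D" using assms(3) by simp
    then obtain d where "d > 0" "\<And>x y. z - d < x \<Longrightarrow> x < z \<Longrightarrow> z < y \<Longrightarrow> y < z + d \<Longrightarrow> - f x < 0 \<and> 0 < - f y"
      using pos[OF DERIV_minus[OF assms(1)]] assms(2) by auto
    then show ?thesis by (intro exI[of _ d]) (auto intro!: mult_pos_neg)
  qed
qed

text \<open>Once the mesh is below \<open>e\<close>, each point of \<open>Z\<close> has a cell of
  its own, and both ends of that cell lie where the sign on either side of the zero is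
  known.\<close>

lemma sign_changes_eventually_ge:
  fixes f :: "real \<Rightarrow> real"
  assumes ab: "a < b" and Z: "finite Z" "Z \<subseteq> {x. a \<le> x \<and> x \<le> b \<and> f x = 0}"
    and simple: "\<And>z. z \<in> Z \<Longrightarrow> \<exists>D. (f has_real_derivative D) (at z) \<and> D \<noteq> 0"
    and grid: "\<And>n k. k \<le> n \<Longrightarrow> 0 < n \<Longrightarrow> f (grid a b n k) \<noteq> 0"
  shows "\<forall>\<^sub>F n in sequentially. card Z \<le> sign_changes f a b n"
proof -
  have "\<forall>z\<in>Z. \<exists>d>0. \<forall>x y. z - d < x \<longrightarrow> x < z \<longrightarrow> z < y \<longrightarrow> y < z + d \<longrightarrow> f x * f y < 0"
    using simple simple_zero_sign_change Z(2) by blast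
  then obtain d where d: "\<And>z. z \<in> Z \<Longrightarrow> d z > 0"
    "\<And>z x y. \<lbrakk>z \<in> Z; z - d z < x; x < z; z < y; y < z + d z\<rbrakk> \<Longrightarrow> f x * f y < 0"
    by metis
  have "\<exists>e>0. (\<forall>z\<in>Z. e \<le> d z) \<and> (\<forall>z\<in>Z. \<forall>w\<in>Z. z \<noteq> w \<longrightarrow> e \<le> \<bar>z - w\<bar>)"
  proof -
    \<comment> \<open>The extra element 1 keeps the set nonempty, so that \<open>Min\<close> makes
      sense even for empty \<open>Z\<close>.\<close>
    let ?E = "d ` Z \<union> (\<lambda>(z,w). \<bar>z - w\<bar>) ` ((Z \<times> Z) - {(z,w). z = w}) \<union> {1}"
    have fin: "finite ?E" using Z(1) by auto
    have "Min ?E > 0" using fin d(1) by (subst Min_gr_iff) auto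
    moreover have "Min ?E \<le> d z" if "z \<in> Z" for z using fin that by (intro Min_le) auto
    moreover have "Min ?E \<le> \<bar>z - w\<bar>" if "z \<in> Z" "w \<in> Z" "z \<noteq> w" for z w
      using fin that by (intro Min_le) force+
    ultimately show ?thesis by blast
  qed
  then obtain e where e: "e > 0" "\<And>z. z \<in> Z \<Longrightarrow> e \<le> d z"
    "\<And>z w. z \<in> Z \<Longrightarrow> w \<in> Z \<Longrightarrow> z \<noteq> w \<Longrightarrow> e \<le> \<bar>z - w\<bar>" by blast
  have "(\<lambda>n. (b - a) / real n) \<longlonglongrightarrow> 0" by real_asymp
  then have "\<forall>\<^sub>F n in sequentially. (b - a) / real n < e"
    using e(1) by (rule order_tendstoD(2))
  then show ?thesis
    using eventually_gt_at_top[of "0::nat"]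
  proof eventually_elim
    case (elim n)
    define h where "h = (b - a) / real n"
    have h: "0 < h" "h < e" using elim ab by (auto simp: h_def)
    \<comment> \<open>Index of the cell containing \<open>z\<close>; since grid points are not
      zeros, \<open>z\<close> lies strictly inside it.\<close>
    define k where "k z = nat \<lfloor>(z - a) / h\<rfloor>" for z
    have kz: "k z < n" "grid a b n (k z) < z" "z < grid a b n (Suc (k z))" if "z \<in> Z" for z
    proof -
      have z: "a \<le> z" "z \<le> b" "f z = 0" using that Z(2) by auto
      have "z \<noteq> b" using grid[of n n] elim z(3) by auto
      then have zb: "z < b" using z by auto
      have q: "0 \<le> (z - a) / h" using z h by simp
      have fl: "real (k z) \<le> (z - a) / h" "(z - a) / h < real (k z) + 1"
        unfolding k_def using q by (auto simp: of_nat_nat intro: floor_correct)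
      have "(z - a) / h < real n" using zb elim ab by (simp add: h_def field_simps)
      then show kn: "k z < n" using fl(1) by linarith
      have "grid a b n (k z) \<le> z" using fl(1) h by (simp add: grid_def h_def[symmetric] field_simps)
      moreover have "grid a b n (k z) \<noteq> z" using grid[of "k z" n] kn z(3) by auto
      ultimately show "grid a b n (k z) < z" by simp
      show "z < grid a b n (Suc (k z))" using fl(2) h by (simp add: grid_def h_def[symmetric] field_simps)
    qed
    have step: "grid a b n (Suc j) = grid a b n j + h" for j by (simp add: grid_Suc h_def)
    have "inj_on k Z"
    proof (rule inj_onI, rule ccontr)
      fix z w assume zw: "z \<in> Z" "w \<in> Z" "k z = k w" "z \<noteq> w"
      then show False
        using kz(2,3)[OF zw(1)] kz(2,3)[OF zw(2)] step[of "k w"] e(3)[OF zw(1,2,4)] h by auto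
    qed
    moreover have "k ` Z \<subseteq> {k. k < n \<and> f (grid a b n k) * f (grid a b n (Suc k)) < 0}"
    proof
      fix j assume "j \<in> k ` Z"
      then obtain z where z: "z \<in> Z" "j = k z" by blast
      have "f (grid a b n j) * f (grid a b n (Suc j)) < 0"
        using kz[OF z(1)] step[of j] h e(2)[OF z(1)] z(2)
        by (intro d(2)[OF z(1)]) auto
      then show "j \<in> {k. k < n \<and> f (grid a b n k) * f (grid a b n (Suc k)) < 0}"
        using kz(1)[OF z(1)] z(2) by auto
    qed
    ultimately show "card Z \<le> sign_changes f a b n"
      unfolding sign_changes_def by (rule card_inj_on_le) simp
  qed
qed

text \<open>The upper bound holds for every n. For the lower bound any c below the count is beaten
  by some finite set of zeros, which also covers an infinite zero set with count
  \<infinity>.\<close>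

lemma sign_changes_tendsto_zeros:
  fixes f :: "real \<Rightarrow> real"
  assumes ab: "a < b" and cont: "continuous_on {a..b} f"
    and simple: "\<And>z. \<lbrakk>a \<le> z; z \<le> b; f z = 0\<rbrakk> \<Longrightarrow> \<exists>D. (f has_real_derivative D) (at z) \<and> D \<noteq> 0"
    and grid: "\<And>n k. k \<le> n \<Longrightarrow> 0 < n \<Longrightarrow> f (grid a b n k) \<noteq> 0"
  shows "(\<lambda>n. of_nat (sign_changes f a b n)) \<longlonglongrightarrow>
    emeasure (count_space UNIV) {x. a \<le> x \<and> x \<le> b \<and> f x = 0}"
proof (rule order_tendstoI)
  let ?Z = "{x. a \<le> x \<and> x \<le> b \<and> f x = 0}"
  fix c :: ennreal assume c: "c < emeasure (count_space UNIV) ?Z"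
  have "\<exists>Z\<subseteq>?Z. finite Z \<and> c < of_nat (card Z)"
  proof (cases "finite ?Z")
    case True
    then show ?thesis using c by (intro exI[of _ ?Z]) auto
  next
    case False
    have "c < top" using c by (rule order_less_le_trans) simp
    then obtain m where "c < of_nat m" using ennreal_Ex_less_of_nat by (auto simp: less_top)
    moreover obtain Z where "Z \<subseteq> ?Z" "finite Z" "card Z = m"
      using infinite_arbitrarily_large[OF False, of m] by blast
    ultimately show ?thesis by blast
  qed
  then obtain Z where Z: "Z \<subseteq> ?Z" "finite Z" "c < of_nat (card Z)" by blast
  have "\<forall>\<^sub>F n in sequentially. card Z \<le> sign_changes f a b n"
    by (rule sign_changes_eventually_ge) (use Z ab simple grid in auto)
  then show "\<forall>\<^sub>F n in sequentially. c < of_nat (sign_changes f a b n)"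
  proof eventually_elim
    case (elim n)
    then have "(of_nat (card Z) :: ennreal) \<le> of_nat (sign_changes f a b n)" by (simp only: of_nat_le_iff)
    with Z(3) show ?case by (rule order_less_le_trans)
  qed
next
  fix c :: ennreal assume "emeasure (count_space UNIV) {x. a \<le> x \<and> x \<le> b \<and> f x = 0} < c"
  then show "\<forall>\<^sub>F n in sequentially. of_nat (sign_changes f a b n) < c"
    using sign_changes_le_zeros[OF ab cont] by (auto intro!: always_eventually intro: order_le_less_trans)
qed

section \<open>Grids, Riemann sums and elementary estimates\<close>

lemma grid_covers:
  assumes "a \<le> z" "z \<le> grid a b n m" "0 < m"
  shows "\<exists>k<m. grid a b n k \<le> z \<and> z \<le> grid a b n (Suc k)"
  using assms
proof (induction m)
  case (Suc m)
  show ?case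
  proof (cases "grid a b n m \<le> z")
    case True
    then show ?thesis using Suc.prems by auto
  next
    case False
    then have "0 < m" using Suc.prems by (cases m) auto
    then show ?thesis using Suc.IH Suc.prems False by (meson less_Suc_eq linear)
  qed
qed simp

lemma integral_grid:
  fixes g :: "real \<Rightarrow> real"
  assumes ab: "a \<le> b" and g: "g integrable_on {a..b}" and n: "0 < n"
  shows "integral {a..b} g = (\<Sum>k<n. integral {grid a b n k..grid a b n (Suc k)} g)"
proof -
  have "m \<le> n \<Longrightarrow> integral {a..grid a b n m} g = (\<Sum>k<m. integral {grid a b n k..grid a b n (Suc k)} g)" for m
  proof (induction m)
    case (Suc m)
    have "g integrable_on {a..grid a b n (Suc m)}"
      using g by (rule integrable_on_subinterval) (use grid_bounds[of a b "Suc m" n] ab n Suc in auto)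
    then have "integral {a..grid a b n m} g + integral {grid a b n m..grid a b n (Suc m)} g = integral {a..grid a b n (Suc m)} g"
      using grid_bounds[of a b m n] grid_mono[of a b m "Suc m" n] ab n Suc.prems
      by (intro Henstock_Kurzweil_Integration.integral_combine) auto
    with Suc show ?case by simp
  qed simp
  from this[of n] show ?thesis using n by simp
qed

text \<open>Arbitrary tags are allowed because the intermediate points from the mean value theorem
  are only known to exist; uniform continuity on the compact interval takes care of them.\<close>

lemma Riemann_sum_tendsto:
  fixes g :: "real \<Rightarrow> real" and \<eta> :: "nat \<Rightarrow> nat \<Rightarrow> real"
  assumes ab: "a < b" and g: "continuous_on {a..b} g"
    and \<eta>: "\<And>n k. k < n \<Longrightarrow> grid a b n k \<le> \<eta> n k \<and> \<eta> n k \<le> grid a b n (Suc k)"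
  shows "(\<lambda>n. \<Sum>k<n. (b - a) / real n * g (\<eta> n k)) \<longlonglongrightarrow> integral {a..b} g"
proof (rule metric_LIMSEQ_I)
  fix e :: real assume e: "0 < e"
  define e' where "e' = e / (2 * (b - a))"
  have "e' * (b - a) = e / 2" using ab by (simp add: e'_def field_simps)
  then have e': "0 < e'" "e' * (b - a) < e" using e ab by (simp add: e'_def) (use \<open>e' * (b - a) = e / 2\<close> e in linarith)
  have "uniformly_continuous_on {a..b} g"
    using g by (rule compact_uniformly_continuous) auto
  then obtain d where d: "0 < d" "\<And>x y. x \<in> {a..b} \<Longrightarrow> y \<in> {a..b} \<Longrightarrow> dist y x < d \<Longrightarrow> dist (g y) (g x) < e'"
    using e'(1) unfolding uniformly_continuous_on_def by metis
  have "(\<lambda>n. (b - a) / real n) \<longlonglongrightarrow> 0" by real_asymp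
  then have "\<forall>\<^sub>F n in sequentially. (b - a) / real n < d"
    using d(1) by (rule order_tendstoD(2))
  then obtain N where N: "\<And>n. N \<le> n \<Longrightarrow> (b - a) / real n < d" unfolding eventually_sequentially by blast
  show "\<exists>N. \<forall>n\<ge>N. dist (\<Sum>k<n. (b - a) / real n * g (\<eta> n k)) (integral {a..b} g) < e"
  proof (intro exI[of _ "Suc N"] allI impI)
    fix n assume n: "Suc N \<le> n"
    define h where "h = (b - a) / real n"
    have h: "0 < h" "h < d" "0 < n" "real n * h = b - a" using N[of n] n ab by (auto simp: h_def)
    have piece: "\<bar>h * g (\<eta> n k) - integral {grid a b n k..grid a b n (Suc k)} g\<bar> \<le> e' * h" if k: "k < n" for k
    proof -
      let ?I = "{grid a b n k..grid a b n (Suc k)}"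
      have sub: "?I \<subseteq> {a..b}" using grid_bounds[of a b k n] grid_bounds[of a b "Suc k" n] k ab by auto
      have st: "grid a b n (Suc k) - grid a b n k = h" by (simp add: grid_Suc h_def)
      have cg: "continuous_on ?I g" using g sub by (rule continuous_on_subset)
      have "norm (integral ?I (\<lambda>x. g x - g (\<eta> n k))) \<le> e' * (grid a b n (Suc k) - grid a b n k)"
      proof (rule integral_bound)
        fix x assume x: "x \<in> ?I"
        have "\<eta> n k \<in> ?I" using \<eta>[OF k] by auto
        then have "dist x (\<eta> n k) < d" using x st h(2) by (auto simp: dist_real_def abs_if)
        then show "norm (g x - g (\<eta> n k)) \<le> e'"
          using d(2)[of "\<eta> n k" x] x \<open>\<eta> n k \<in> ?I\<close> sub by (auto simp: dist_real_def less_imp_le subset_iff)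
      qed (use st h cg in \<open>auto intro!: continuous_intros\<close>)
      moreover have "integral ?I (\<lambda>x. g x - g (\<eta> n k)) = integral ?I g - h * g (\<eta> n k)"
        using st h(1) by (subst Henstock_Kurzweil_Integration.integral_diff) (auto intro!: integrable_continuous_real cg)
      ultimately show ?thesis using st by (simp add: abs_minus_commute)
    qed
    have "integral {a..b} g = (\<Sum>k<n. integral {grid a b n k..grid a b n (Suc k)} g)"
      using ab g h(3) by (intro integral_grid integrable_continuous_real) auto
    then have "\<bar>(\<Sum>k<n. h * g (\<eta> n k)) - integral {a..b} g\<bar> \<le> (\<Sum>k<n. \<bar>h * g (\<eta> n k) - integral {grid a b n k..grid a b n (Suc k)} g\<bar>)"
      by (simp add: sum_subtractf[symmetric] sum_abs)
    also have "\<dots> \<le> (\<Sum>k<n. e' * h)" by (intro sum_mono piece) auto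
    also have "\<dots> = e' * (b - a)" by (simp add: h(4)[symmetric])
    also have "\<dots> < e" by (rule e'(2))
    finally show "dist (\<Sum>k<n. (b - a) / real n * g (\<eta> n k)) (integral {a..b} g) < e"
      by (simp add: dist_real_def h_def)
  qed
qed

lemma arctan_le_self:
  fixes y :: real
  assumes "0 \<le> y"
  shows "arctan y \<le> y"
proof (cases "y = 0")
  case False
  with assms have y: "0 < y" by simp
  have "\<exists>z>0. z < y \<and> arctan y - arctan 0 = (y - 0) * inverse (1 + z\<^sup>2)"
    by (rule MVT2[OF y]) (auto intro: DERIV_arctan)
  then obtain z where z: "arctan y = y * inverse (1 + z\<^sup>2)" by auto
  have "inverse (1 + z\<^sup>2) \<le> 1" by (simp add: inverse_le_1_iff)
  then show ?thesis using z y by (simp add: mult_left_le)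
qed simp

lemma arctan_ge:
  fixes y :: real
  assumes "0 \<le> y"
  shows "y / (1 + y\<^sup>2) \<le> arctan y"
proof (cases "y = 0")
  case False
  with assms have y: "0 < y" by simp
  have "\<exists>z>0. z < y \<and> arctan y - arctan 0 = (y - 0) * inverse (1 + z\<^sup>2)"
    by (rule MVT2[OF y]) (auto intro: DERIV_arctan)
  then obtain z where z: "0 < z" "z < y" "arctan y = y * inverse (1 + z\<^sup>2)" by auto
  have "y * inverse (1 + y\<^sup>2) \<le> y * inverse (1 + z\<^sup>2)"
    using z y by (intro mult_left_mono le_imp_inverse_le add_left_mono power_mono) (auto simp: add_pos_nonneg)
  then show ?thesis using z(3) by (simp add: divide_inverse)
qed simp

text \<open>For one cell of mesh \<open>h\<close> the sign-change probability is the arctan term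
  divided by pi, with x of order h^2. The error is thus O(h^3) per cell and O(h^2) in total. Both
  directions use y / (1 + y^2) \<le> arctan y \<le> y at y = sqrt (exp x - 1), where 1 + y^2 = exp
  x.\<close>

lemma arctan_sqrt_exp_bound:
  fixes x :: real
  assumes x: "0 \<le> x" "x \<le> 1"
  shows "\<bar>arctan (sqrt (exp x - 1)) - sqrt x\<bar> \<le> x * sqrt x"
proof -
  define y where "y = sqrt (exp x - 1)"
  have y2: "y\<^sup>2 = exp x - 1" using x by (simp add: y_def)
  have y0: "0 \<le> y" using x by (simp add: y_def)
  have e1: "x \<le> exp x - 1" using exp_ge_add_one_self[of x] by linarith
  have e2: "exp x - 1 \<le> x * (1 + x)" using exp_bound[of x] x by (simp add: power2_eq_square algebra_simps)
  have "arctan y \<le> y" using y0 by (rule arctan_le_self)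
  also have "y \<le> sqrt (x * (1 + x)\<^sup>2)"
  proof -
    have "x * (1 + x) \<le> x * (1 + x)\<^sup>2" using x by (intro mult_left_mono) (auto simp: power2_eq_square algebra_simps)
    then show ?thesis unfolding y_def using e2 by (intro real_sqrt_le_mono) linarith
  qed
  also have "\<dots> = (1 + x) * sqrt x" using x by (simp add: real_sqrt_mult)
  finally have up: "arctan y - sqrt x \<le> x * sqrt x" by (simp add: algebra_simps)
  have "(1 - x) * sqrt x \<le> exp (-x) * y"
    using x e1 exp_ge_add_one_self[of "-x"] by (intro mult_mono) (auto simp: y_def)
  also have "\<dots> = y / (1 + y\<^sup>2)" unfolding y2 by (simp add: exp_minus field_simps)
  also have "\<dots> \<le> arctan y" by (rule arctan_ge[OF y0])
  finally have "sqrt x - arctan y \<le> x * sqrt x" by (simp add: algebra_simps)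
  with up show ?thesis by (simp add: y_def abs_le_iff)
qed

lemma nn_integral_eq_integral_continuous:
  fixes g :: "real \<Rightarrow> real"
  assumes [measurable]: "g \<in> borel_measurable borel"
    and g: "continuous_on {a..b} g" "\<And>x. x \<in> {a..b} \<Longrightarrow> 0 \<le> g x"
  shows "(\<integral>\<^sup>+x. ennreal (g x) * indicator {a..b} x \<partial>lborel) = ennreal (integral {a..b} g)"
proof -
  have "((\<lambda>x. if x \<in> {a..b} then g x else 0) has_integral integral {a..b} g) UNIV"
    unfolding has_integral_restrict_UNIV by (intro integrable_integral integrable_continuous_real g)
  then have "(\<integral>\<^sup>+x. ennreal (if x \<in> {a..b} then g x else 0) \<partial>lborel) = ennreal (integral {a..b} g)"
    by (intro nn_integral_has_integral_lborel) (auto intro: g(2))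
  moreover have "ennreal (if x \<in> {a..b} then g x else 0) = ennreal (g x) * indicator {a..b} x" for x
    by (auto split: split_indicator)
  ultimately show ?thesis by simp
qed

text \<open>Zero counts are only almost surely equal to a limit of measurable functions; on the
  completion this is enough for measurability.\<close>

lemma borel_measurable_completion_AE:
  fixes f g :: "'a \<Rightarrow> 'b::topological_space"
  assumes g: "g \<in> borel_measurable M" and ae: "AE x in M. f x = g x"
  shows "f \<in> borel_measurable (completion M)"
proof (rule measurableI)
  fix S :: "'b set" assume S: "S \<in> sets borel"
  show "f -` S \<inter> space (completion M) \<in> sets (completion M)"
  proof (rule completion.in_sets_AE)
    show "g -` S \<inter> space (completion M) \<in> sets (completion M)"
      using measurable_completion[OF g] S by (rule measurable_sets)
    show "AE x in completion M. (x \<in> g -` S \<inter> space (completion M)) = (x \<in> f -` S \<inter> space (completion M))"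
      using AE_completion[OF ae] by eventually_elim auto
  qed auto
qed simp

section \<open>Gaussian pairs\<close>

text \<open>After division by its mean, \<open>g\<close> is the density of a probability measure
  under which \<open>U\<close> has the same characteristic function as under \<open>M\<close>, hence
  the same law. If the mean is 0, then \<open>g\<close> vanishes almost everywhere and both sides
  are 0.\<close>

lemma (in prob_space) weighted_Levy_uniqueness:
  fixes U g :: "'a \<Rightarrow> real"
  assumes [measurable]: "random_variable borel U" "random_variable borel g"
    and g: "\<And>\<omega>. 0 \<le> g \<omega>" "\<And>\<omega>. g \<omega> \<le> K"
    and eq: "\<And>s. (CLINT \<omega>|M. g \<omega> * iexp (s * U \<omega>)) = (LINT \<omega>|M. g \<omega>) * char (distr M borel U) s"
    and A: "A \<in> sets borel"
  shows "(LINT \<omega>|M. g \<omega> * indicator A (U \<omega>)) = (LINT \<omega>|M. g \<omega>) * (LINT \<omega>|M. indicator A (U \<omega>))"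
proof -
  note A[measurable]
  have intg: "integrable M g" by (rule integrable_const_bound[of _ K]) (use g in auto)
  have intgA: "integrable M (\<lambda>\<omega>. g \<omega> * indicator A (U \<omega>))"
    by (rule integrable_const_bound[of _ K]) (use g in \<open>auto split: split_indicator intro: order_trans\<close>)
  define m where "m = (LINT \<omega>|M. g \<omega>)"
  have m0: "0 \<le> m" unfolding m_def by (intro integral_nonneg_AE) (use g in auto)
  show ?thesis
  proof (cases "m = 0")
    case True
    then have "AE \<omega> in M. g \<omega> = 0"
      using integral_nonneg_eq_0_iff_AE[OF intg] g(1) by (simp add: m_def)
    then have "(LINT \<omega>|M. g \<omega> * indicator A (U \<omega>)) = (LINT \<omega>|M. 0)"
      by (intro integral_cong_AE) auto
    with True show ?thesis by (simp add: m_def)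
  next
    case False
    with m0 have m: "0 < m" by simp
    define N where "N = density M (\<lambda>\<omega>. ennreal (g \<omega> / m))"
    have [measurable_cong, simp]: "sets N = sets M" by (simp add: N_def)
    have "emeasure N (space N) = (\<integral>\<^sup>+\<omega>. ennreal (g \<omega> / m) \<partial>M)"
      unfolding N_def by (subst emeasure_density) (auto intro!: nn_integral_cong)
    also have "\<dots> = ennreal (LINT \<omega>|M. g \<omega> / m)"
      by (rule nn_integral_eq_integral) (use intg g m in auto)
    also have "(LINT \<omega>|M. g \<omega> / m) = 1" using m by (simp add: m_def)
    finally interpret N: prob_space N by (intro prob_spaceI) simp
    have ch: "char (distr N borel U) = char (distr M borel U)"
    proof
      fix s
      have "char (distr N borel U) s = (CLINT \<omega>|N. iexp (s * U \<omega>))"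
        unfolding char_def by (rule integral_distr) auto
      also have "\<dots> = (CLINT \<omega>|M. (g \<omega> / m) *\<^sub>R iexp (s * U \<omega>))"
        unfolding N_def by (rule integral_density) (use g m in auto)
      also have "\<dots> = (CLINT \<omega>|M. (1 / m) * (g \<omega> * iexp (s * U \<omega>)))"
        by (intro Bochner_Integration.integral_cong) (auto simp: scaleR_conv_of_real)
      also have "\<dots> = (1 / m) * (CLINT \<omega>|M. g \<omega> * iexp (s * U \<omega>))"
        by (rule integral_mult_right_zero)
      also have "\<dots> = char (distr M borel U) s" unfolding eq using m by (simp add: m_def)
      finally show "char (distr N borel U) s = char (distr M borel U) s" .
    qed
    have "distr N borel U = distr M borel U"
      by (rule Levy_uniqueness[OF _ _ ch]) auto
    then have "(LINT x|distr N borel U. indicator A x :: real) = (LINT x|distr M borel U. indicator A x)"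
      by simp
    moreover have "(LINT x|distr N borel U. indicator A x :: real) = (LINT \<omega>|N. indicator A (U \<omega>))"
      by (rule integral_distr) auto
    moreover have "(LINT x|distr M borel U. indicator A x :: real) = (LINT \<omega>|M. indicator A (U \<omega>))"
      by (rule integral_distr) auto
    ultimately have "(LINT \<omega>|N. indicator A (U \<omega>) :: real) = (LINT \<omega>|M. indicator A (U \<omega>))"
      by simp
    moreover have "(LINT \<omega>|N. indicator A (U \<omega>) :: real) = (LINT \<omega>|M. (g \<omega> / m) *\<^sub>R indicator A (U \<omega>))"
      unfolding N_def by (rule integral_density) (use g m in auto)
    moreover have "\<dots> = (LINT \<omega>|M. g \<omega> * indicator A (U \<omega>)) / m" by simp
    ultimately show ?thesis using m by (simp add: m_def field_simps)
  qed
qed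

text \<open>The law of \<open>U\<close> under the weight \<open>1 + cos (t W)\<close> has the characteristic function of \<open>U\<close>,
  so the one-dimensional uniqueness theorem applies; then exchange the roles of \<open>U\<close> and \<open>W\<close>,
  with an indicator function of \<open>U\<close> as the weight.\<close>

lemma (in prob_space) indep_var_char:
  fixes U W :: "'a \<Rightarrow> real"
  assumes rv[measurable]: "random_variable borel U" "random_variable borel W"
    and eq: "\<And>s t. (CLINT \<omega>|M. iexp (s * U \<omega> + t * W \<omega>)) = char (distr M borel U) s * char (distr M borel W) t"
  shows "indep_var borel U borel W"
proof -
  have charU: "char (distr M borel U) s = (CLINT \<omega>|M. iexp (s * U \<omega>))" for s
    unfolding char_def by (rule integral_distr) auto
  have charW: "char (distr M borel W) s = (CLINT \<omega>|M. iexp (s * W \<omega>))" for s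
    unfolding char_def by (rule integral_distr) auto
  have int1: "integrable M (\<lambda>\<omega>. iexp (f \<omega>))" if [measurable]: "f \<in> borel_measurable M" for f :: "'a \<Rightarrow> real"
    by (rule integrable_const_bound[of _ 1]) auto
  have intc: "integrable M (\<lambda>\<omega>. cos (f \<omega>))" "integrable M (\<lambda>\<omega>. sin (f \<omega>))"
    if [measurable]: "f \<in> borel_measurable M" for f :: "'a \<Rightarrow> real"
    by (rule integrable_const_bound[of _ 1]; auto)+
  have cosc: "complex_of_real (cos y) = (iexp y + iexp (-y)) / 2"
    and sinc: "complex_of_real (sin y) = (iexp y - iexp (-y)) / (2 * \<i>)" for y :: real
    by (simp_all add: cos_exp_eq[symmetric] sin_exp_eq[symmetric] cos_of_real sin_of_real flip: of_real_minus)
       (auto simp: sin_exp_eq cos_exp_eq sin_of_real[symmetric] cos_of_real[symmetric])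
  have charW_cos: "(char (distr M borel W) t + char (distr M borel W) (-t)) / 2 = of_real (LINT \<omega>|M. cos (t * W \<omega>))" for t
  proof -
    have "of_real (LINT \<omega>|M. cos (t * W \<omega>)) = (CLINT \<omega>|M. (iexp (t * W \<omega>) + iexp (-t * W \<omega>)) / 2)"
      unfolding integral_complex_of_real[symmetric] cosc by simp
    also have "\<dots> = (char (distr M borel W) t + char (distr M borel W) (-t)) / 2"
      unfolding charW using int1[of "\<lambda>\<omega>. t * W \<omega>"] int1[of "\<lambda>\<omega>. -t * W \<omega>"] by simp
    finally show ?thesis by simp
  qed
  have charW_sin: "(char (distr M borel W) t - char (distr M borel W) (-t)) / (2 * \<i>) = of_real (LINT \<omega>|M. sin (t * W \<omega>))" for t
  proof -
    have "of_real (LINT \<omega>|M. sin (t * W \<omega>)) = (CLINT \<omega>|M. (iexp (t * W \<omega>) - iexp (-t * W \<omega>)) / (2 * \<i>))"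
      unfolding integral_complex_of_real[symmetric] sinc by simp
    also have "\<dots> = (char (distr M borel W) t - char (distr M borel W) (-t)) / (2 * \<i>)"
      unfolding charW using int1[of "\<lambda>\<omega>. t * W \<omega>"] int1[of "\<lambda>\<omega>. -t * W \<omega>"] by simp
    finally show ?thesis by simp
  qed
  have prodc: "(CLINT \<omega>|M. cos (t * W \<omega>) * iexp (s * U \<omega>)) = (LINT \<omega>|M. cos (t * W \<omega>)) * char (distr M borel U) s"
    for s t
  proof -
    have "(CLINT \<omega>|M. cos (t * W \<omega>) * iexp (s * U \<omega>)) =
        (CLINT \<omega>|M. (iexp (s * U \<omega> + t * W \<omega>) + iexp (s * U \<omega> + (-t) * W \<omega>)) / 2)"
      unfolding cosc by (intro Bochner_Integration.integral_cong) (auto simp: field_simps simp flip: exp_add)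
    also have "\<dots> = (char (distr M borel U) s * char (distr M borel W) t + char (distr M borel U) s * char (distr M borel W) (-t)) / 2"
      unfolding eq[symmetric]
      using int1[of "\<lambda>\<omega>. s * U \<omega> + t * W \<omega>"] int1[of "\<lambda>\<omega>. s * U \<omega> + (-t) * W \<omega>"] by simp
    also have "\<dots> = char (distr M borel U) s * ((char (distr M borel W) t + char (distr M borel W) (-t)) / 2)"
      by (simp add: field_simps)
    finally show ?thesis unfolding charW_cos by simp
  qed
  have prods: "(CLINT \<omega>|M. sin (t * W \<omega>) * iexp (s * U \<omega>)) = (LINT \<omega>|M. sin (t * W \<omega>)) * char (distr M borel U) s"
    for s t
  proof -
    have "(CLINT \<omega>|M. sin (t * W \<omega>) * iexp (s * U \<omega>)) =
        (CLINT \<omega>|M. (iexp (s * U \<omega> + t * W \<omega>) - iexp (s * U \<omega> + (-t) * W \<omega>)) / (2 * \<i>))"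
      unfolding sinc by (intro Bochner_Integration.integral_cong) (auto simp: field_simps simp flip: exp_add)
    also have "\<dots> = (char (distr M borel U) s * char (distr M borel W) t - char (distr M borel U) s * char (distr M borel W) (-t)) / (2 * \<i>)"
      unfolding eq[symmetric]
      using int1[of "\<lambda>\<omega>. s * U \<omega> + t * W \<omega>"] int1[of "\<lambda>\<omega>. s * U \<omega> + (-t) * W \<omega>"] by simp
    also have "\<dots> = char (distr M borel U) s * ((char (distr M borel W) t - char (distr M borel W) (-t)) / (2 * \<i>))"
      by (simp add: field_simps)
    finally show ?thesis unfolding charW_sin by simp
  qed
  have step: "(LINT \<omega>|M. f (t * W \<omega>) * indicator A (U \<omega>)) = (LINT \<omega>|M. f (t * W \<omega>)) * (LINT \<omega>|M. indicator A (U \<omega>))"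
    if f: "f = cos \<or> f = sin" and A[measurable]: "A \<in> sets borel" for f t A
  proof -
    have [measurable]: "f \<in> borel_measurable borel" using f by auto
    have fb: "- 1 \<le> f x" "f x \<le> 1" for x using f by auto
    have intf: "integrable M (\<lambda>\<omega>. f (t * W \<omega>))" using f intc by auto
    have intfA: "integrable M (\<lambda>\<omega>. f (t * W \<omega>) * indicator A (U \<omega>))"
      by (rule integrable_const_bound[of _ 1]) (use f in \<open>auto split: split_indicator\<close>)
    have intA: "integrable M (\<lambda>\<omega>. indicator A (U \<omega>) :: real)"
      by (rule integrable_const_bound[of _ 1]) (auto split: split_indicator)
    have pr: "(CLINT \<omega>|M. f (t * W \<omega>) * iexp (s * U \<omega>)) = (LINT \<omega>|M. f (t * W \<omega>)) * char (distr M borel U) s" for s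
      using f prodc prods by auto
    have intfe: "complex_integrable M (\<lambda>\<omega>. f (t * W \<omega>) * iexp (s * U \<omega>))" for s
      by (rule integrable_const_bound[of _ 1]) (use f in \<open>auto simp: norm_mult\<close>)
    \<comment> \<open>The summand 1 makes the weight nonnegative; its contribution cancels
      afterwards.\<close>
    have "(LINT \<omega>|M. (1 + f (t * W \<omega>)) * indicator A (U \<omega>)) = (LINT \<omega>|M. 1 + f (t * W \<omega>)) * (LINT \<omega>|M. indicator A (U \<omega>))"
    proof (rule weighted_Levy_uniqueness[where K = 2])
      fix s
      have "(CLINT \<omega>|M. (1 + f (t * W \<omega>)) * iexp (s * U \<omega>)) = (CLINT \<omega>|M. iexp (s * U \<omega>) + f (t * W \<omega>) * iexp (s * U \<omega>))"
        by (intro Bochner_Integration.integral_cong) (auto simp: algebra_simps)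
      also have "\<dots> = char (distr M borel U) s + (LINT \<omega>|M. f (t * W \<omega>)) * char (distr M borel U) s"
        using int1[of "\<lambda>\<omega>. s * U \<omega>"] intfe[of s] pr[of s] by (simp add: charU)
      also have "\<dots> = (LINT \<omega>|M. 1 + f (t * W \<omega>)) * char (distr M borel U) s"
        using intf by (simp add: prob_space algebra_simps)
      finally show "(CLINT \<omega>|M. complex_of_real (1 + f (t * W \<omega>)) * iexp (s * U \<omega>)) = (LINT \<omega>|M. 1 + f (t * W \<omega>)) * char (distr M borel U) s"
        by simp
    next
      show "0 \<le> 1 + f (t * W \<omega>)" "1 + f (t * W \<omega>) \<le> 2" for \<omega>
        using fb[of "t * W \<omega>"] by auto
    qed auto
    moreover have "(LINT \<omega>|M. (1 + f (t * W \<omega>)) * indicator A (U \<omega>)) = (LINT \<omega>|M. indicator A (U \<omega>)) + (LINT \<omega>|M. f (t * W \<omega>) * indicator A (U \<omega>))"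
      using intA intfA by (simp add: algebra_simps del: integral_indicator)
    moreover have "(LINT \<omega>|M. 1 + f (t * W \<omega>)) = 1 + (LINT \<omega>|M. f (t * W \<omega>))"
      using intf by (simp add: prob_space)
    ultimately show ?thesis by (simp add: algebra_simps)
  qed
  have main: "(LINT \<omega>|M. indicator A (U \<omega>) * indicator B (W \<omega>)) = (LINT \<omega>|M. indicator A (U \<omega>)) * (LINT \<omega>|M. indicator B (W \<omega>) :: real)"
    if A[measurable]: "A \<in> sets borel" and B[measurable]: "B \<in> sets borel" for A B
  proof (rule weighted_Levy_uniqueness[where K = 1])
    fix t
    have ir: "integrable M (\<lambda>\<omega>. f (t * W \<omega>) * indicator A (U \<omega>))" if "f = cos \<or> f = sin" for f :: "real \<Rightarrow> real"
    proof -
      have [measurable]: "f \<in> borel_measurable borel" using that by auto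
      show ?thesis by (rule integrable_const_bound[of _ 1]) (use that in \<open>auto split: split_indicator\<close>)
    qed
    have ie: "iexp y = of_real (cos y) + \<i> * of_real (sin y)" for y :: real
      by (simp add: exp_Euler cos_of_real sin_of_real)
    have "(CLINT \<omega>|M. complex_of_real (indicator A (U \<omega>)) * iexp (t * W \<omega>)) =
       (CLINT \<omega>|M. complex_of_real (cos (t * W \<omega>) * indicator A (U \<omega>)) + \<i> * complex_of_real (sin (t * W \<omega>) * indicator A (U \<omega>)))"
      unfolding ie by (intro Bochner_Integration.integral_cong) (auto simp: algebra_simps)
    also have "\<dots> = complex_of_real (LINT \<omega>|M. cos (t * W \<omega>) * indicator A (U \<omega>)) + \<i> * complex_of_real (LINT \<omega>|M. sin (t * W \<omega>) * indicator A (U \<omega>))"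
      using ir[of cos] ir[of sin] by (simp del: of_real_mult)
    also have "\<dots> = complex_of_real (LINT \<omega>|M. indicator A (U \<omega>)) * (complex_of_real (LINT \<omega>|M. cos (t * W \<omega>)) + \<i> * complex_of_real (LINT \<omega>|M. sin (t * W \<omega>)))"
      using step[OF _ A, of cos t] step[OF _ A, of sin t]
      by (simp only: simp_thms of_real_mult) (simp add: algebra_simps)
    also have "complex_of_real (LINT \<omega>|M. cos (t * W \<omega>)) + \<i> * complex_of_real (LINT \<omega>|M. sin (t * W \<omega>)) = char (distr M borel W) t"
      unfolding charW_cos[symmetric] charW_sin[symmetric] by (simp add: field_simps)
    finally show "(CLINT \<omega>|M. complex_of_real (indicator A (U \<omega>)) * iexp (t * W \<omega>)) = complex_of_real (LINT \<omega>|M. indicator A (U \<omega>)) * char (distr M borel W) t"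
      by simp
  qed (auto split: split_indicator)
  show ?thesis
    unfolding indep_var_eq
  proof (intro conjI indep_set_sigma_sets Int_stableI)
    show "indep_set {U -` A \<inter> space M |A. A \<in> sets borel} {W -` B \<inter> space M |B. B \<in> sets borel}"
    proof (safe intro!: indep_setI)
      fix A B :: "real set" assume [measurable]: "A \<in> sets borel" "B \<in> sets borel"
      have p: "prob (V -` C \<inter> space M) = (LINT \<omega>|M. indicator C (V \<omega>))"
        if [measurable]: "C \<in> sets borel" "V \<in> borel_measurable M" for V :: "'a \<Rightarrow> real" and C
      proof -
        have "(LINT \<omega>|M. indicator C (V \<omega>)) = (LINT \<omega>|M. indicator (V -` C \<inter> space M) \<omega> :: real)"
          by (intro Bochner_Integration.integral_cong) (auto split: split_indicator)
        then show ?thesis by simp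
      qed
      have "(LINT \<omega>|M. indicator A (U \<omega>) * indicator B (W \<omega>)) =
          (LINT \<omega>|M. indicator ((U -` A \<inter> space M) \<inter> (W -` B \<inter> space M)) \<omega> :: real)"
        by (intro Bochner_Integration.integral_cong) (auto split: split_indicator)
      then have "prob ((U -` A \<inter> space M) \<inter> (W -` B \<inter> space M)) = (LINT \<omega>|M. indicator A (U \<omega>) * indicator B (W \<omega>))"
        by simp
      then show "prob ((U -` A \<inter> space M) \<inter> (W -` B \<inter> space M)) = prob (U -` A \<inter> space M) * prob (W -` B \<inter> space M)"
        by (simp add: main p)
    qed auto
  next
    fix a b assume "a \<in> {U -` A \<inter> space M |A. A \<in> sets borel}" "b \<in> {U -` A \<inter> space M |A. A \<in> sets borel}"
    then obtain A B where "A \<in> sets borel" "B \<in> sets borel" "a \<inter> b = U -` (A \<inter> B) \<inter> space M" by blast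
    then show "a \<inter> b \<in> {U -` A \<inter> space M |A. A \<in> sets borel}" by blast
  next
    fix a b assume "a \<in> {W -` A \<inter> space M |A. A \<in> sets borel}" "b \<in> {W -` A \<inter> space M |A. A \<in> sets borel}"
    then obtain A B where "A \<in> sets borel" "B \<in> sets borel" "a \<inter> b = W -` (A \<inter> B) \<inter> space M" by blast
    then show "a \<inter> b \<in> {W -` A \<inter> space M |A. A \<in> sets borel}" by blast
  qed (use rv in auto)
qed

section \<open>The standard normal measure of parallelograms and sectors in the plane\<close>

lemma std_normal_pair_emeasure:
  assumes [measurable]: "A \<in> sets (borel \<Otimes>\<^sub>M borel)"
  shows "emeasure (std_normal_distribution \<Otimes>\<^sub>M std_normal_distribution) A =
    (\<integral>\<^sup>+u. \<integral>\<^sup>+w. ennreal (std_normal_density u * std_normal_density w) * indicator A (u, w) \<partial>lborel \<partial>lborel)"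
proof -
  interpret prob_space std_normal_distribution
    by (rule prob_space_normal_density) simp
  have "emeasure (std_normal_distribution \<Otimes>\<^sub>M std_normal_distribution) A =
    (\<integral>\<^sup>+u. \<integral>\<^sup>+w. indicator A (u, w) \<partial>std_normal_distribution \<partial>std_normal_distribution)"
    by (rule emeasure_pair_measure) auto
  also have "\<dots> = (\<integral>\<^sup>+u. ennreal (std_normal_density u) * (\<integral>\<^sup>+w. ennreal (std_normal_density w) * indicator A (u, w) \<partial>lborel) \<partial>lborel)"
    by (simp add: nn_integral_density)
  also have "\<dots> = (\<integral>\<^sup>+u. \<integral>\<^sup>+w. ennreal (std_normal_density u * std_normal_density w) * indicator A (u, w) \<partial>lborel \<partial>lborel)"
    by (simp add: nn_integral_cmult[symmetric] ennreal_mult mult.assoc)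
  finally show ?thesis .
qed

lemma std_normal_density_le_1: "std_normal_density x \<le> 1"
proof -
  have "1 \<le> sqrt (2 * pi)" using pi_gt3 by (simp add: real_le_rsqrt)
  then have "1 / sqrt (2 * pi) \<le> 1" by simp
  moreover have "exp (- x\<^sup>2 / 2) \<le> 1" by simp
  ultimately show ?thesis
    unfolding std_normal_density_def using mult_le_one[of "1 / sqrt (2*pi)" "exp (- x\<^sup>2 / 2)"] by simp
qed

text \<open>The joint density is at most 1, so the area of the parallelogram, 2 d times 2 e / b, is
  a bound. For d = 0 it is 0.\<close>

lemma std_normal_pair_small:
  fixes a b e d :: real
  assumes b: "0 < b" and e: "0 \<le> e" and d: "0 \<le> d"
  shows "emeasure (std_normal_distribution \<Otimes>\<^sub>M std_normal_distribution)
      {p. \<bar>fst p\<bar> \<le> d \<and> \<bar>a * fst p + b * snd p\<bar> \<le> e} \<le> ennreal (4 * d * e / b)"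
proof -
  let ?A = "{p::real \<times> real. \<bar>fst p\<bar> \<le> d \<and> \<bar>a * fst p + b * snd p\<bar> \<le> e}"
  have "{p \<in> space (borel \<Otimes>\<^sub>M borel). \<bar>fst p\<bar> \<le> d \<and> \<bar>a * fst p + b * snd p\<bar> \<le> e} \<in> sets (borel \<Otimes>\<^sub>M borel)"
    by measurable
  then have [measurable]: "?A \<in> sets (borel \<Otimes>\<^sub>M borel)" by (simp add: space_pair_measure)
  have "emeasure (std_normal_distribution \<Otimes>\<^sub>M std_normal_distribution) ?A \<le>
    (\<integral>\<^sup>+u. \<integral>\<^sup>+w. indicator {-d..d} u * indicator {(-e - a * u) / b..(e - a * u) / b} w \<partial>lborel \<partial>lborel)"
    unfolding std_normal_pair_emeasure[OF \<open>?A \<in> _\<close>]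
  proof (intro nn_integral_mono)
    fix u w :: real
    have "ennreal (std_normal_density u * std_normal_density w) \<le> 1"
      using mult_le_one[OF std_normal_density_le_1 _ std_normal_density_le_1, of w u] by (simp add: ennreal_le_1)
    moreover have "(indicator ?A (u, w) :: ennreal) \<le> indicator {-d..d} u * indicator {(-e - a * u) / b..(e - a * u) / b} w"
      using b by (auto split: split_indicator simp: field_simps abs_le_iff)
    ultimately show "ennreal (std_normal_density u * std_normal_density w) * indicator ?A (u, w) \<le>
       indicator {-d..d} u * indicator {(-e - a * u) / b..(e - a * u) / b} w"
      using mult_mono[of "ennreal (std_normal_density u * std_normal_density w)" 1 "indicator ?A (u, w)" "indicator {-d..d} u * indicator {(-e - a * u) / b..(e - a * u) / b} w"]
      by auto
  qed
  also have "\<dots> = (\<integral>\<^sup>+u. indicator {-d..d} u * ennreal (2 * e / b) \<partial>lborel)"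
  proof (intro nn_integral_cong)
    fix u :: real
    have "(e - a * u) / b - (-e - a * u) / b = 2 * e / b" by (simp add: diff_divide_distrib[symmetric])
    moreover have "(-e - a * u) / b \<le> (e - a * u) / b" using b e by (intro divide_right_mono) auto
    ultimately show "(\<integral>\<^sup>+w. indicator {-d..d} u * indicator {(-e - a * u) / b..(e - a * u) / b} w \<partial>lborel) = indicator {-d..d} u * ennreal (2 * e / b)"
      by (simp add: nn_integral_cmult)
  qed
  also have "\<dots> = ennreal (2 * d) * ennreal (2 * e / b)"
    using d by (simp add: nn_integral_multc)
  also have "\<dots> = ennreal (4 * d * e / b)"
    using d e b by (simp add: ennreal_mult[symmetric])
  finally show ?thesis .
qed

lemma nn_integral_Cauchy_tail:
  "(\<integral>\<^sup>+t. ennreal (1 / (pi * (1 + t\<^sup>2))) * indicator {c<..} t \<partial>lborel) = ennreal (1 / 2 - arctan c / pi)"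
proof -
  have "(\<integral>\<^sup>+t. ennreal (1 / (pi * (1 + t\<^sup>2))) * indicator {c<..} t \<partial>lborel) =
      (\<integral>\<^sup>+t. ennreal (1 / (pi * (1 + t\<^sup>2))) * indicator {c..} t \<partial>lborel)"
    by (intro nn_integral_cong_AE) (use AE_lborel_singleton[of c] in \<open>eventually_elim, auto split: split_indicator\<close>)
  also have "\<dots> = ennreal (1 / 2 - arctan c / pi)"
  proof (rule nn_integral_FTC_atLeast)
    show "((\<lambda>x. arctan x / pi) has_real_derivative 1 / (pi * (1 + x\<^sup>2))) (at x)" for x
      by (auto intro!: derivative_eq_intros simp: divide_inverse)
    have "((\<lambda>x. arctan x / pi) \<longlongrightarrow> (pi / 2) / pi) at_top"
      by (intro tendsto_intros tendsto_arctan_at_top) auto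
    then show "((\<lambda>x. arctan x / pi) \<longlongrightarrow> 1 / 2) at_top" by simp
  qed (auto intro!: divide_nonneg_pos mult_pos_pos add_pos_nonneg)
  finally show ?thesis .
qed

text \<open>The ratio of two independent standard normals has the Cauchy density. The product of the
  two densities is, up to a constant, a normal density in \<open>u\<close> with variance 1 / (1 +
  t^2), and the integral is its first absolute moment.\<close>

lemma nn_integral_std_normal_ratio:
  "(\<integral>\<^sup>+u. ennreal (\<bar>u\<bar> * std_normal_density u * std_normal_density (t * u)) \<partial>lborel) = ennreal (1 / (pi * (1 + t\<^sup>2)))"
proof -
  define \<sigma> where "\<sigma> = 1 / sqrt (1 + t\<^sup>2)"
  have \<sigma>: "0 < \<sigma>" "\<sigma>\<^sup>2 = 1 / (1 + t\<^sup>2)" by (auto simp: \<sigma>_def power_divide add_pos_nonneg)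
  have sp: "0 < sqrt (2 * pi)" "sqrt (2 * pi) * sqrt (2 * pi) = 2 * pi" by simp_all
  have eq: "\<bar>u\<bar> * std_normal_density u * std_normal_density (t * u) = (\<sigma> / sqrt (2 * pi)) * (normal_density 0 \<sigma> u * \<bar>u\<bar>)" for u
  proof -
    have "exp (- u\<^sup>2 / 2) * exp (- (t * u)\<^sup>2 / 2) = exp (- u\<^sup>2 / (2 * \<sigma>\<^sup>2))"
      unfolding \<sigma>(2) by (simp add: exp_add[symmetric] power_mult_distrib add_divide_distrib[symmetric] algebra_simps)
    moreover have "normal_density 0 \<sigma> u = 1 / (sqrt (2 * pi) * \<sigma>) * exp (- u\<^sup>2 / (2 * \<sigma>\<^sup>2))"
      using \<sigma>(1) by (simp add: normal_density_def real_sqrt_mult)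
    ultimately have nd: "exp (- u\<^sup>2 / 2) * exp (- (t * u)\<^sup>2 / 2) = exp (- u\<^sup>2 / (2 * \<sigma>\<^sup>2))"
      "normal_density 0 \<sigma> u = 1 / (sqrt (2 * pi) * \<sigma>) * exp (- u\<^sup>2 / (2 * \<sigma>\<^sup>2))" .
    have "\<bar>u\<bar> * (1 / r * e1) * (1 / r * e2) = \<sigma> / r * (1 / (r * \<sigma>) * (e1 * e2) * \<bar>u\<bar>)"
      if "0 < r" for r e1 e2 :: real
      using that \<sigma>(1) by (simp add: field_simps)
    from this[OF sp(1)] show ?thesis
      using nd by (simp only: std_normal_density_def)
  qed
  have "has_bochner_integral lborel (\<lambda>u. (\<sigma> / sqrt (2 * pi)) * (normal_density 0 \<sigma> u * \<bar>u\<bar>)) ((\<sigma> / sqrt (2 * pi)) * (\<sigma> * sqrt (2 / pi)))"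
    using normal_moment_abs_odd[OF \<sigma>(1), of 0 0] by (intro has_bochner_integral_mult_right) simp
  then have "(\<integral>\<^sup>+u. ennreal ((\<sigma> / sqrt (2 * pi)) * (normal_density 0 \<sigma> u * \<bar>u\<bar>)) \<partial>lborel) = ennreal ((\<sigma> / sqrt (2 * pi)) * (\<sigma> * sqrt (2 / pi)))"
    using \<sigma>(1) by (subst nn_integral_eq_integral) (auto simp: has_bochner_integral_iff)
  moreover have "(\<sigma> / sqrt (2 * pi)) * (\<sigma> * sqrt (2 / pi)) = 1 / (pi * (1 + t\<^sup>2))"
  proof -
    have "sqrt (2 / pi) / sqrt (2 * pi) = sqrt ((1 / pi)\<^sup>2)" 
      by (subst real_sqrt_divide[symmetric]) (simp add: power2_eq_square)
    then have q: "sqrt (2 / pi) / sqrt (2 * pi) = 1 / pi" by simp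
    have "(\<sigma> / sqrt (2 * pi)) * (\<sigma> * sqrt (2 / pi)) = \<sigma>\<^sup>2 * (sqrt (2 / pi) / sqrt (2 * pi))"
      by (simp add: power2_eq_square)
    then show ?thesis unfolding q \<sigma>(2) by simp
  qed
  ultimately show ?thesis unfolding eq by simp
qed

text \<open>The substitution \<open>w = - t u\<close> turns the event into \<open>t > a / b\<close>, where \<open>t\<close> has the Cauchy density.\<close>

lemma std_normal_pair_opposite_signs:
  fixes a b :: real
  assumes b: "0 < b"
  shows "emeasure (std_normal_distribution \<Otimes>\<^sub>M std_normal_distribution)
      {p. fst p * (a * fst p + b * snd p) < 0} = ennreal (1 / 2 - arctan (a / b) / pi)"
proof -
  let ?A = "{p::real \<times> real. fst p * (a * fst p + b * snd p) < 0}"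
  have "{p \<in> space (borel \<Otimes>\<^sub>M borel). fst p * (a * fst p + b * snd p) < 0} \<in> sets (borel \<Otimes>\<^sub>M borel)"
    by measurable
  then have [measurable]: "?A \<in> sets (borel \<Otimes>\<^sub>M borel)" by (simp add: space_pair_measure)
  have "emeasure (std_normal_distribution \<Otimes>\<^sub>M std_normal_distribution) ?A =
    (\<integral>\<^sup>+u. \<integral>\<^sup>+t. ennreal (\<bar>u\<bar> * std_normal_density u * std_normal_density (t * u)) * indicator {a / b<..} t \<partial>lborel \<partial>lborel)"
    unfolding std_normal_pair_emeasure[OF \<open>?A \<in> _\<close>]
  proof (rule nn_integral_cong_AE)
    show "AE u in lborel. (\<integral>\<^sup>+w. ennreal (std_normal_density u * std_normal_density w) * indicator ?A (u, w) \<partial>lborel) =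
      (\<integral>\<^sup>+t. ennreal (\<bar>u\<bar> * std_normal_density u * std_normal_density (t * u)) * indicator {a / b<..} t \<partial>lborel)"
      using AE_lborel_singleton[of 0]
    proof eventually_elim
      fix u :: real assume u: "u \<noteq> 0"
      have ind: "indicator ?A (u, 0 + (- u) * t) = (indicator {a / b<..} t :: ennreal)" for t
      proof -
        have "u * (a * u + b * (0 + (- u) * t)) = (u * u) * (a - b * t)" by (simp add: algebra_simps)
        moreover have "0 < u * u" using u by (metis not_real_square_gt_zero)
        ultimately have "u * (a * u + b * (0 + (- u) * t)) < 0 \<longleftrightarrow> a - b * t < 0"
          by (simp only: mult_less_0_iff) auto
        then show ?thesis using b by (auto split: split_indicator simp: field_simps)
      qed
      have sym: "std_normal_density (0 + (-u) * t) = std_normal_density (t * u)" for t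
        by (simp add: std_normal_density_def power_mult_distrib mult.commute)
      have "(\<integral>\<^sup>+w. ennreal (std_normal_density u * std_normal_density w) * indicator ?A (u, w) \<partial>lborel) =
        ennreal \<bar>- u\<bar> * (\<integral>\<^sup>+t. ennreal (std_normal_density u * std_normal_density (0 + (-u) * t)) * indicator ?A (u, 0 + (- u) * t) \<partial>lborel)"
        by (rule nn_integral_real_affine) (use u in auto)
      also have "\<dots> = (\<integral>\<^sup>+t. ennreal \<bar>- u\<bar> * (ennreal (std_normal_density u * std_normal_density (t * u)) * indicator {a / b<..} t) \<partial>lborel)"
        unfolding ind sym by (rule nn_integral_cmult[symmetric]) auto
      finally show "(\<integral>\<^sup>+w. ennreal (std_normal_density u * std_normal_density w) * indicator ?A (u, w) \<partial>lborel) =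
        (\<integral>\<^sup>+t. ennreal (\<bar>u\<bar> * std_normal_density u * std_normal_density (t * u)) * indicator {a / b<..} t \<partial>lborel)"
        by (simp add: ennreal_mult mult.assoc)
    qed
  qed
  also have "\<dots> = (\<integral>\<^sup>+t. \<integral>\<^sup>+u. ennreal (\<bar>u\<bar> * std_normal_density u * std_normal_density (t * u)) * indicator {a / b<..} t \<partial>lborel \<partial>lborel)"
    by (rule lborel_pair.Fubini') measurable
  also have "\<dots> = (\<integral>\<^sup>+t. ennreal (1 / (pi * (1 + t\<^sup>2))) * indicator {a / b<..} t \<partial>lborel)"
    by (simp add: nn_integral_multc nn_integral_std_normal_ratio)
  finally show ?thesis unfolding nn_integral_Cauchy_tail .
qed

section \<open>Random Dirichlet series\<close>

lemma holomorphic_Re_has_real_derivative: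
  assumes "f holomorphic_on S" "open S" "complex_of_real x \<in> S"
  shows "((\<lambda>x. Re (f (of_real x))) has_real_derivative Re (deriv f (of_real x))) (at x)"
proof -
  have "((\<lambda>x. f (of_real x)) has_vector_derivative deriv f (of_real x)) (at x)"
    by (intro has_vector_derivative_real_field holomorphic_derivI[OF assms])
  then have "((\<lambda>x. Re (f (of_real x))) has_vector_derivative Re (deriv f (of_real x))) (at x)"
    by (rule bounded_linear.has_vector_derivative[OF bounded_linear_Re])
  then show ?thesis by (simp add: has_real_derivative_iff_has_vector_derivative)
qed

locale gaussian_sequence = prob_space M for M :: "'a measure" +
  fixes X :: "nat \<Rightarrow> 'a \<Rightarrow> real"
  assumes indep: "indep_vars (\<lambda>_. borel) X {1..}"
    and gauss: "n \<ge> 1 \<Longrightarrow> distributed M lborel (X n) std_normal_density"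
begin

lemma measurable_X [measurable]: "X (Suc k) \<in> borel_measurable M"
  using distributed_measurable[OF gauss[of "Suc k"]] by simp

definition psum :: "nat \<Rightarrow> 'a \<Rightarrow> real" where
  "psum n \<omega> = (\<Sum>k<n. X (Suc k) \<omega>)"

lemma measurable_psum [measurable]: "psum n \<in> borel_measurable M"
  unfolding psum_def[abs_def] by measurable

lemma psum_distributed:
  assumes "0 < n"
  shows "distributed M lborel (psum n) (normal_density 0 (sqrt n))"
proof -
  have "distributed M lborel (\<lambda>\<omega>. \<Sum>i\<in>{1..n}. X i \<omega>) (normal_density (\<Sum>i\<in>{1..n}. 0) (sqrt (\<Sum>i\<in>{1..n}. 1\<^sup>2)))"
    by (rule sum_indep_normal) (use assms indep_vars_subset[OF indep, of "{1..n}"] gauss in auto)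
  then show ?thesis by (simp add: psum_def[abs_def] sum.atLeast1_atMost_eq)
qed

lemma psum_even_moment:
  assumes "0 < n"
  shows "integrable M (\<lambda>\<omega>. psum n \<omega> ^ (2 * p))"
    "(LINT \<omega>|M. psum n \<omega> ^ (2 * p)) = fact (2 * p) / (2 ^ p * fact p) * real n ^ p"
proof -
  have sq: "0 < sqrt (real n)" using assms by simp
  have m: "has_bochner_integral lborel (\<lambda>x. normal_density 0 (sqrt n) x * (x - 0) ^ (2 * p)) (fact (2 * p) / ((2 / (sqrt n)\<^sup>2)^p * fact p))"
    using sq by (rule normal_moment_even)
  have D: "distributed M lborel (psum n) (\<lambda>x. ennreal (normal_density 0 (sqrt n) x))"
    using psum_distributed[OF assms] by simp
  show "integrable M (\<lambda>\<omega>. psum n \<omega> ^ (2 * p))"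
    using distributed_integrable[OF D, of "\<lambda>x. x ^ (2 * p)"] m by (auto simp: has_bochner_integral_iff)
  show "(LINT \<omega>|M. psum n \<omega> ^ (2 * p)) = fact (2 * p) / (2 ^ p * fact p) * real n ^ p"
    using distributed_integral[OF D, of "\<lambda>x. x ^ (2 * p)"] m by (auto simp: has_bochner_integral_iff power_divide)
qed

text \<open>\<open>psum n\<close> is normal with variance n, so its 2p-th moment is K n^p. Markov's
  inequality for a large power makes the exceptional probabilities summable, and Borel-Cantelli
  applies.\<close>

lemma AE_psum_bound:
  assumes \<kappa>: "1 / 2 < \<kappa>"
  shows "AE \<omega> in M. \<exists>C. \<forall>n. \<bar>psum n \<omega>\<bar> \<le> C * real n powr \<kappa>"
proof -
  \<comment> \<open>Large enough for the exponent p (2 \<kappa> - 1) in Markov's bound to reach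
    2.\<close>
  obtain p :: nat where "2 / (2 * \<kappa> - 1) \<le> real p" using real_arch_simple by blast
  then have p: "2 \<le> real p * (2 * \<kappa> - 1)" using \<kappa> by (simp add: field_simps)
  define K where "K = (fact (2 * p) / (2 ^ p * fact p) :: real)"
  define A where "A n = {\<omega> \<in> space M. real (Suc n) powr (\<kappa> * real (2 * p)) \<le> psum (Suc n) \<omega> ^ (2 * p)}" for n
  have A[measurable]: "A n \<in> sets M" for n unfolding A_def by measurable
  have mA: "measure M (A n) \<le> K * real (Suc n) powr (-2)" for n
  proof -
    let ?n = "real (Suc n)"
    have "measure M (A n) \<le> (LINT \<omega>|M. psum (Suc n) \<omega> ^ (2 * p)) / ?n powr (\<kappa> * real (2 * p))"
      unfolding A_def
      by (rule integral_Markov_inequality_measure[where A = "space M"])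
         (auto simp: psum_even_moment)
    also have "(LINT \<omega>|M. psum (Suc n) \<omega> ^ (2 * p)) = K * ?n powr real p"
      by (simp only: psum_even_moment(2)[OF zero_less_Suc]) (simp add: K_def powr_realpow del: of_nat_Suc)
    also have "K * ?n powr real p / ?n powr (\<kappa> * real (2 * p)) = K * (?n powr real p * ?n powr (- (\<kappa> * real (2 * p))))"
      by (simp add: powr_minus divide_inverse del: of_nat_Suc)
    also have "?n powr real p * ?n powr (- (\<kappa> * real (2 * p))) = ?n powr (- (real p * (2 * \<kappa> - 1)))"
      by (simp only: powr_add[symmetric]) (simp add: algebra_simps)
    also have "K * ?n powr (- (real p * (2 * \<kappa> - 1))) \<le> K * ?n powr (-2)"
      using p by (intro mult_left_mono powr_mono) (auto simp: K_def)
    finally show ?thesis .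
  qed
  have "AE \<omega> in M. \<forall>\<^sub>F n in sequentially. \<omega> \<in> space M - A n"
  proof (rule borel_cantelli_AE1[OF A])
    show "summable (\<lambda>n. measure M (A n))"
      by (rule summable_comparison_test'[where g = "\<lambda>n. K * real (Suc n) powr (-2)"])
         (use mA in \<open>auto intro!: summable_mult summable_Suc_powr_minus simp del: of_nat_Suc\<close>)
  qed (simp add: less_top[symmetric])
  then show ?thesis
  proof eventually_elim
    case (elim \<omega>)
    then obtain N where N: "\<And>n. N \<le> n \<Longrightarrow> \<omega> \<in> space M - A n"
      unfolding eventually_sequentially by blast
    \<comment> \<open>The sum absorbs the finitely many n \<le> N; the summand 1 serves all later
      n.\<close>
    define C where "C = 1 + (\<Sum>n\<le>N. \<bar>psum n \<omega>\<bar>)"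
    have C: "1 \<le> C" unfolding C_def by (simp add: sum_nonneg)
    show ?case
    proof (intro exI[of _ C] allI)
      fix n
      show "\<bar>psum n \<omega>\<bar> \<le> C * real n powr \<kappa>"
      proof (cases n)
        case 0 then show ?thesis by (simp add: psum_def)
      next
        case (Suc m)
        have ge1: "1 \<le> real n powr \<kappa>" using Suc \<kappa> by (intro ge_one_powr_ge_zero) auto
        show ?thesis
        proof (cases "n \<le> N")
          case True
          then have "\<bar>psum n \<omega>\<bar> \<le> (\<Sum>n\<le>N. \<bar>psum n \<omega>\<bar>)" by (intro member_le_sum) auto
          also have "\<dots> \<le> C * 1" by (simp add: C_def)
          also have "\<dots> \<le> C * real n powr \<kappa>" using ge1 C by (intro mult_left_mono) auto
          finally show ?thesis .
        next
          case False
          then have "\<omega> \<in> space M - A m" using Suc by (intro N) auto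
          then have "\<bar>psum n \<omega>\<bar> ^ (2 * p) < real n powr (\<kappa> * real (2 * p))"
            unfolding A_def using Suc by (simp add: power_even_abs not_le)
          also have "\<dots> = (real n powr \<kappa>) ^ (2 * p)"
            using Suc by (simp add: powr_powr[symmetric] powr_realpow del: of_nat_mult)
          finally have "\<bar>psum n \<omega>\<bar> \<le> 1 * real n powr \<kappa>"
            using power_less_imp_less_base[of "\<bar>psum n \<omega>\<bar>" "2 * p" "real n powr \<kappa>"] by simp
          also have "\<dots> \<le> C * real n powr \<kappa>" using C by (intro mult_right_mono) auto
          finally show ?thesis .
        qed
      qed
    qed
  qed
qed

text \<open>By summation by parts, this growth condition on the partial sums gives convergence and
  analyticity at all \<open>\<sigma> > 1/2\<close> at once.\<close>

definition good :: "'a \<Rightarrow> bool" where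
  "good \<omega> \<longleftrightarrow> (\<forall>\<kappa>>1/2. \<exists>C. \<forall>n. \<bar>psum n \<omega>\<bar> \<le> C * real n powr \<kappa>)"

lemma AE_good: "AE \<omega> in M. good \<omega>"
proof -
  \<comment> \<open>Countably many exponents decreasing to 1/2 suffice, as the bound weakens when
    \<kappa> grows.\<close>
  have "AE \<omega> in M. \<forall>m. \<exists>C. \<forall>n. \<bar>psum n \<omega>\<bar> \<le> C * real n powr (1 / 2 + 1 / real (Suc m))"
    unfolding AE_all_countable by (intro allI AE_psum_bound) simp
  then show ?thesis
  proof eventually_elim
    case (elim \<omega>)
    show "good \<omega>" unfolding good_def
    proof (intro allI impI)
      fix \<kappa> :: real assume \<kappa>: "1 / 2 < \<kappa>"
      obtain m where m: "1 / real (Suc m) < \<kappa> - 1 / 2"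
        using \<kappa> reals_Archimedean[of "\<kappa> - 1 / 2"] by (auto simp: inverse_eq_divide)
      obtain C where C: "\<And>n. \<bar>psum n \<omega>\<bar> \<le> C * real n powr (1 / 2 + 1 / real (Suc m))" using elim by blast
      have C0: "0 \<le> C" using order_trans[OF abs_ge_zero C[of 1]] by simp
      have "\<bar>psum n \<omega>\<bar> \<le> C * real n powr \<kappa>" for n
      proof (cases "n = 0")
        case False
        have "C * real n powr (1 / 2 + 1 / real (Suc m)) \<le> C * real n powr \<kappa>"
          using m C0 False by (intro mult_left_mono powr_mono) auto
        then show ?thesis using C[of n] by linarith
      qed (simp add: psum_def)
      then show "\<exists>C. \<forall>n. \<bar>psum n \<omega>\<bar> \<le> C * real n powr \<kappa>" by blast
    qed
  qed
qed

lemma powr_minus_of_real: "complex_of_real (real (Suc k)) powr (- complex_of_real \<sigma>) = complex_of_real (real (Suc k) powr (- \<sigma>))"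
  using powr_of_real[of "real (Suc k)" "-\<sigma>"] by (simp del: of_nat_Suc)

lemma good_norm_bound:
  assumes "good \<omega>" "1 / 2 < \<kappa>"
  obtains C where "\<And>n. norm (\<Sum>k<n. complex_of_real (X (Suc k) \<omega>)) \<le> C * real n powr \<kappa>"
  using assms unfolding good_def psum_def of_real_sum[symmetric] norm_of_real by blast

lemma good_summable:
  assumes g: "good \<omega>" and \<sigma>: "1 / 2 < \<sigma>"
  shows "summable (\<lambda>k. X (Suc k) \<omega> * real (Suc k) powr (-\<sigma>))"
proof -
  obtain \<kappa> where \<kappa>: "1 / 2 < \<kappa>" "\<kappa> < \<sigma>" using dense[OF \<sigma>] by blast
  obtain C where C: "\<And>n. norm (\<Sum>k<n. complex_of_real (X (Suc k) \<omega>)) \<le> C * real n powr \<kappa>"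
    using good_norm_bound[OF g \<kappa>(1)] by blast
  have "summable (\<lambda>k. complex_of_real (X (Suc k) \<omega>) * of_real (real (Suc k)) powr (- complex_of_real \<sigma>))"
    using dirichlet_series_by_parts[OF C, of "complex_of_real \<sigma>"] \<kappa> by (simp add: sums_iff)
  then show ?thesis
    unfolding powr_minus_of_real of_real_mult[symmetric] summable_complex_of_real .
qed

text \<open>\<open>F\<close> is the restriction of a function holomorphic on Re s > 1/2. Continuity
  of the second derivative is what later bounds it on compact intervals.\<close>

lemma good_derivatives:
  assumes g: "good \<omega>"
  shows "\<exists>f' f''. (\<forall>\<sigma>>1/2. (dirichlet_F X \<omega> has_real_derivative f' \<sigma>) (at \<sigma>)) \<and>
    (\<forall>\<sigma>>1/2. (f' has_real_derivative f'' \<sigma>) (at \<sigma>)) \<and> continuous_on {1/2<..} f''"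
proof -
  define S where "S = {s. 1 / 2 < Re s}"
  have oS: "open S" unfolding S_def by (rule open_halfspace_Re_gt)
  define f where "f s = (\<Sum>k. complex_of_real (X (Suc k) \<omega>) * of_real (real (Suc k)) powr (-s))" for s
  have hf: "f holomorphic_on S"
  proof -
    have "f field_differentiable at s" if sS: "s \<in> S" for s
    proof -
      \<comment> \<open>The constant in the growth bound depends on \<kappa>, so differentiability
        is shown at each \<open>s\<close> with its own \<kappa> strictly between 1/2 and Re
        s.\<close>
      obtain \<kappa> where \<kappa>: "1 / 2 < \<kappa>" "\<kappa> < Re s" using dense[of "1 / 2" "Re s"] sS unfolding S_def by blast
      obtain C where C: "\<And>n. norm (\<Sum>k<n. complex_of_real (X (Suc k) \<omega>)) \<le> C * real n powr \<kappa>"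
        using good_norm_bound[OF g \<kappa>(1)] by blast
      have "f holomorphic_on {s. \<kappa> < Re s}"
        using dirichlet_series_holomorphic[OF C] \<kappa> unfolding f_def by simp
      then show ?thesis
        using \<kappa> by (intro holomorphic_on_imp_differentiable_at) (auto simp: open_halfspace_Re_gt)
    qed
    then show ?thesis by (simp add: holomorphic_on_open[OF oS] field_differentiable_def)
  qed
  have eq: "dirichlet_F X \<omega> \<sigma> = Re (f (of_real \<sigma>))" if "1 / 2 < \<sigma>" for \<sigma>
    unfolding f_def dirichlet_F_def powr_minus_of_real of_real_mult[symmetric]
    by (subst suminf_of_real[OF good_summable[OF g that], symmetric]) (rule Re_complex_of_real[symmetric])
  have D1: "(dirichlet_F X \<omega> has_real_derivative Re (deriv f (of_real \<sigma>))) (at \<sigma>)" if "1 / 2 < \<sigma>" for \<sigma>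
    using holomorphic_Re_has_real_derivative[OF hf oS, of \<sigma>] that
    by (rule_tac has_field_derivative_transform_within_open[where S = "{1/2<..}"]) (auto simp: eq S_def)
  have h1: "deriv f holomorphic_on S" and h2: "deriv (deriv f) holomorphic_on S"
    by (intro holomorphic_deriv hf oS)+
  have D2: "((\<lambda>\<sigma>. Re (deriv f (of_real \<sigma>))) has_real_derivative Re (deriv (deriv f) (of_real \<sigma>))) (at \<sigma>)" if "1 / 2 < \<sigma>" for \<sigma>
    using holomorphic_Re_has_real_derivative[OF h1 oS, of \<sigma>] that by (simp add: S_def)
  have D3: "continuous_on {1 / 2<..} (\<lambda>\<sigma>. Re (deriv (deriv f) (of_real \<sigma>)))"
    using holomorphic_Re_has_real_derivative[OF h2 oS]
    by (intro continuous_at_imp_continuous_on ballI DERIV_isCont) (auto simp: S_def)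
  show ?thesis
    by (intro exI[of _ "\<lambda>\<sigma>. Re (deriv f (of_real \<sigma>))"] exI[of _ "\<lambda>\<sigma>. Re (deriv (deriv f) (of_real \<sigma>))"])
      (use D1 D2 D3 in auto)
qed

lemma measurable_dirichlet_F [measurable]: "(\<lambda>\<omega>. dirichlet_F X \<omega> \<sigma>) \<in> borel_measurable M"
  unfolding dirichlet_F_def[abs_def] by measurable

text \<open>For partial sums independence gives a product of Gaussian characteristic functions. The
  integrands have modulus 1, so dominated convergence passes to the infinite sum.\<close>

lemma char_gaussian_series:
  fixes u :: "nat \<Rightarrow> real"
  assumes [measurable]: "V \<in> borel_measurable M"
    and V: "AE \<omega> in M. (\<lambda>k. u k * X (Suc k) \<omega>) sums V \<omega>"
    and u: "(\<lambda>k. (u k)\<^sup>2) sums v"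
  shows "(CLINT \<omega>|M. iexp (V \<omega>)) = of_real (exp (- v / 2))"
proof (rule LIMSEQ_unique)
  show "(\<lambda>n. CLINT \<omega>|M. iexp (\<Sum>k<n. u k * X (Suc k) \<omega>)) \<longlonglongrightarrow> (CLINT \<omega>|M. iexp (V \<omega>))"
  proof (rule integral_dominated_convergence[where w = "\<lambda>_. 1"])
    show "AE \<omega> in M. (\<lambda>n. iexp (\<Sum>k<n. u k * X (Suc k) \<omega>)) \<longlonglongrightarrow> iexp (V \<omega>)"
      using V unfolding sums_def by eventually_elim (intro tendsto_intros)
  qed auto
  have "(CLINT \<omega>|M. iexp (\<Sum>k<n. u k * X (Suc k) \<omega>)) = of_real (exp (- (\<Sum>k<n. (u k)\<^sup>2) / 2))" for n
  proof -
    \<comment> \<open>The variables are numbered from 1 but the coefficients from 0, hence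
      \<open>i - 1\<close>.\<close>
    define Y where "Y i \<omega> = u (i - 1) * X i \<omega>" for i \<omega>
    have rvX: "X i \<in> borel_measurable M" if "1 \<le> i" for i using measurable_X[of "i - 1"] that by simp
    have chX: "char (distr M borel (X i)) t = of_real (exp (- t\<^sup>2 / 2))" if "1 \<le> i" for i t
    proof -
      have "distr M borel (X i) = std_normal_distribution"
        using distributed_distr_eq_density[OF gauss[OF that]] by (simp cong: distr_cong)
      then show ?thesis by (simp add: char_std_normal_distribution)
    qed
    have chY: "char (distr M borel (Y i)) 1 = of_real (exp (- (u (i - 1))\<^sup>2 / 2))" if "1 \<le> i" for i
    proof -
      have "char (distr M borel (Y i)) 1 = char (distr M borel (X i)) (u (i - 1))"
        using rvX[OF that] unfolding char_def Y_def by (subst (1 2) integral_distr) auto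
      then show ?thesis using chX[OF that] by simp
    qed
    have "indep_vars (\<lambda>_. borel) Y {1..n}"
      unfolding Y_def
      by (rule indep_vars_compose2[OF indep_vars_subset[OF indep]]) auto
    then have "char (distr M borel (\<lambda>\<omega>. \<Sum>i\<in>{1..n}. Y i \<omega>)) 1 = (\<Prod>i\<in>{1..n}. char (distr M borel (Y i)) 1)"
      by (rule char_distr_sum)
    also have "\<dots> = (\<Prod>i\<in>{1..n}. of_real (exp (- (u (i - 1))\<^sup>2 / 2)))"
      by (intro prod.cong chY) auto
    also have "\<dots> = of_real (exp (\<Sum>i\<in>{1..n}. - (u (i - 1))\<^sup>2 / 2))"
      by (simp add: exp_sum)
    also have "(\<Sum>i\<in>{1..n}. - (u (i - 1))\<^sup>2 / 2) = - (\<Sum>k<n. (u k)\<^sup>2) / 2"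
      by (simp add: sum.atLeast1_atMost_eq sum_negf sum_divide_distrib)
    also have "(\<lambda>\<omega>. \<Sum>i\<in>{1..n}. Y i \<omega>) = (\<lambda>\<omega>. \<Sum>k<n. u k * X (Suc k) \<omega>)"
      by (simp add: Y_def sum.atLeast1_atMost_eq)
    also have "char (distr M borel (\<lambda>\<omega>. \<Sum>k<n. u k * X (Suc k) \<omega>)) 1 = (CLINT \<omega>|M. iexp (\<Sum>k<n. u k * X (Suc k) \<omega>))"
      unfolding char_def by (subst integral_distr) auto
    finally show ?thesis .
  qed
  moreover have "(\<lambda>n. complex_of_real (exp (- (\<Sum>k<n. (u k)\<^sup>2) / 2))) \<longlonglongrightarrow> of_real (exp (- v / 2))"
    using u unfolding sums_def by (intro tendsto_intros) auto
  ultimately show "(\<lambda>n. CLINT \<omega>|M. iexp (\<Sum>k<n. u k * X (Suc k) \<omega>)) \<longlonglongrightarrow> of_real (exp (- v / 2))"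
    by simp
qed

text \<open>Any combination s U + t W is again such a series, with coefficients s p + t q of square
  sum s^2 + t^2 because p and q are orthonormal. The joint characteristic function therefore
  factorises.\<close>

lemma gaussian_series_pair_distr:
  fixes p q :: "nat \<Rightarrow> real"
  assumes [measurable]: "U \<in> borel_measurable M" "W \<in> borel_measurable M"
    and UW: "AE \<omega> in M. (\<lambda>k. p k * X (Suc k) \<omega>) sums U \<omega>" "AE \<omega> in M. (\<lambda>k. q k * X (Suc k) \<omega>) sums W \<omega>"
    and pq: "(\<lambda>k. (p k)\<^sup>2) sums 1" "(\<lambda>k. (q k)\<^sup>2) sums 1" "(\<lambda>k. p k * q k) sums 0"
  shows "distr M (borel \<Otimes>\<^sub>M borel) (\<lambda>\<omega>. (U \<omega>, W \<omega>)) = std_normal_distribution \<Otimes>\<^sub>M std_normal_distribution"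
proof -
  have joint: "(CLINT \<omega>|M. iexp (s * U \<omega> + t * W \<omega>)) = of_real (exp (- s\<^sup>2 / 2)) * of_real (exp (- t\<^sup>2 / 2))" for s t
  proof -
    have "(CLINT \<omega>|M. iexp (s * U \<omega> + t * W \<omega>)) = of_real (exp (- (s\<^sup>2 + t\<^sup>2) / 2))"
    proof (rule char_gaussian_series[where u = "\<lambda>k. s * p k + t * q k"])
      show "AE \<omega> in M. (\<lambda>k. (s * p k + t * q k) * X (Suc k) \<omega>) sums (s * U \<omega> + t * W \<omega>)"
        using UW
      proof eventually_elim
        case (elim \<omega>)
        from sums_add[OF sums_mult[OF elim(1), of s] sums_mult[OF elim(2), of t]]
        show ?case by (simp add: algebra_simps)
      qed
      from sums_add[OF sums_add[OF sums_mult[OF pq(1), of "s\<^sup>2"] sums_mult[OF pq(2), of "t\<^sup>2"]] sums_mult[OF pq(3), of "2 * s * t"]]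
      show "(\<lambda>k. (s * p k + t * q k)\<^sup>2) sums (s\<^sup>2 + t\<^sup>2)" by (simp add: power2_eq_square algebra_simps)
    qed measurable
    then show ?thesis by (simp add: exp_add[symmetric] add_divide_distrib flip: of_real_mult)
  qed
  have chU: "char (distr M borel U) = char std_normal_distribution"
  proof
    fix s show "char (distr M borel U) s = char std_normal_distribution s"
      using joint[of s 0] unfolding char_def[of "distr M borel U"] char_std_normal_distribution
      by (subst integral_distr) auto
  qed
  have chW: "char (distr M borel W) = char std_normal_distribution"
  proof
    fix t show "char (distr M borel W) t = char std_normal_distribution t"
      using joint[of 0 t] unfolding char_def[of "distr M borel W"] char_std_normal_distribution
      by (subst integral_distr) auto
  qed
  have dU: "distr M borel U = std_normal_distribution" and dW: "distr M borel W = std_normal_distribution"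
    by (rule Levy_uniqueness[OF _ real_dist_normal_dist chU] Levy_uniqueness[OF _ real_dist_normal_dist chW]; simp)+
  have "indep_var borel U borel W"
    by (rule indep_var_char) (use joint in \<open>simp_all add: chU chW char_std_normal_distribution\<close>)
  then show ?thesis unfolding indep_var_distribution_eq dU dW by simp
qed

end

section \<open>Correlation and orthonormalisation of two values of \<open>F\<close>\<close>

definition corr :: "real \<Rightarrow> real \<Rightarrow> real" where
  "corr a b = zeta_log 0 (a + b) / sqrt (zeta_log 0 (2 * a) * zeta_log 0 (2 * b))"

text \<open>The arguments 2 a, a + b, 2 b are equally spaced with step b - a, so - ln (r^2) is
  exactly the second difference of ln zeta. The tag is half the intermediate point.\<close>

lemma corr_square:
  assumes "1 / 2 < a" "a < b"
  shows "\<exists>\<eta>. a < \<eta> \<and> \<eta> < b \<and> (corr a b)\<^sup>2 = exp (- ((b - a)\<^sup>2 * ln_zeta_deriv2 (2 * \<eta>)))"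
proof -
  obtain \<xi> where \<xi>: "2 * a < \<xi>" "\<xi> < 2 * a + 2 * (b - a)"
    "ln (zeta_log 0 (2 * a)) + ln (zeta_log 0 (2 * a + 2 * (b - a))) - 2 * ln (zeta_log 0 (2 * a + (b - a))) = (b - a)\<^sup>2 * ln_zeta_deriv2 \<xi>"
    using ln_zeta_second_difference[of "2 * a" "b - a"] assms by auto
  have e: "2 * a + 2 * (b - a) = 2 * b" "2 * a + (b - a) = a + b" by simp_all
  have pos: "0 < zeta_log 0 (2 * a)" "0 < zeta_log 0 (2 * b)" "0 < zeta_log 0 (a + b)"
    using zeta_log_0_ge_1[of "2 * a"] zeta_log_0_ge_1[of "2 * b"] zeta_log_0_ge_1[of "a + b"] assms by auto
  have "(corr a b)\<^sup>2 = (zeta_log 0 (a + b))\<^sup>2 / (zeta_log 0 (2 * a) * zeta_log 0 (2 * b))"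
    using pos by (simp add: corr_def power_divide)
  also have "\<dots> = exp (2 * ln (zeta_log 0 (a + b)) - (ln (zeta_log 0 (2 * a)) + ln (zeta_log 0 (2 * b))))"
  proof -
    have "exp (2 * ln (zeta_log 0 (a + b))) = (zeta_log 0 (a + b))\<^sup>2"
      using pos by (simp add: exp_double)
    then show ?thesis using pos by (simp add: exp_diff exp_add)
  qed
  also have "2 * ln (zeta_log 0 (a + b)) - (ln (zeta_log 0 (2 * a)) + ln (zeta_log 0 (2 * b))) = - ((b - a)\<^sup>2 * ln_zeta_deriv2 \<xi>)"
    using \<xi>(3) unfolding e by linarith
  finally show ?thesis using \<xi>(1,2) by (intro exI[of _ "\<xi> / 2"]) auto
qed

lemma corr_bounds:
  assumes "1 / 2 < a" "a < b"
  shows "0 < corr a b" "(corr a b)\<^sup>2 < 1"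
proof -
  have pos: "0 < zeta_log 0 (2 * a)" "0 < zeta_log 0 (2 * b)" "0 < zeta_log 0 (a + b)"
    using zeta_log_0_ge_1[of "2 * a"] zeta_log_0_ge_1[of "2 * b"] zeta_log_0_ge_1[of "a + b"] assms by auto
  then show "0 < corr a b" by (simp add: corr_def)
  obtain \<eta> where \<eta>: "a < \<eta>" "\<eta> < b" "(corr a b)\<^sup>2 = exp (- ((b - a)\<^sup>2 * ln_zeta_deriv2 (2 * \<eta>)))"
    using corr_square[OF assms] by blast
  have "0 < (b - a)\<^sup>2 * ln_zeta_deriv2 (2 * \<eta>)"
    using assms \<eta> by (intro mult_pos_pos ln_zeta_deriv2_pos) auto
  then show "(corr a b)\<^sup>2 < 1" unfolding \<eta>(3) by simp
qed

lemma sums_zeta_powr_mult: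
  assumes "1 < a + b"
  shows "(\<lambda>k. real (Suc k) powr (-a) * real (Suc k) powr (-b)) sums zeta_log 0 (a + b)"
proof -
  have "(\<lambda>k. real (Suc k) powr (- (a + b))) sums zeta_log 0 (a + b)"
    using summable_sums[OF summable_zeta_log[OF assms, of 0]] by (simp add: zeta_log_def)
  then show ?thesis by (simp add: powr_add[symmetric])
qed

context gaussian_sequence
begin

lemma AE_dirichlet_F_sums:
  assumes "1 / 2 < \<sigma>"
  shows "AE \<omega> in M. (\<lambda>k. real (Suc k) powr (-\<sigma>) * X (Suc k) \<omega>) sums dirichlet_F X \<omega> \<sigma>"
  using AE_good
proof eventually_elim
  case (elim \<omega>)
  then show ?case
    using summable_sums[OF good_summable[OF elim assms]] by (simp add: dirichlet_F_def mult.commute)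
qed

definition normalized_F :: "real \<Rightarrow> 'a \<Rightarrow> real" where
  "normalized_F a \<omega> = dirichlet_F X \<omega> a / sqrt (zeta_log 0 (2 * a))"

text \<open>The Gram-Schmidt step: the part of \<open>normalized_F b\<close> orthogonal to
  \<open>normalized_F a\<close>, rescaled to variance 1.\<close>

definition residual_F :: "real \<Rightarrow> real \<Rightarrow> 'a \<Rightarrow> real" where
  "residual_F a b \<omega> = (normalized_F b \<omega> - corr a b * normalized_F a \<omega>) / sqrt (1 - (corr a b)\<^sup>2)"

lemma measurable_normalized_F [measurable]: "normalized_F a \<in> borel_measurable M"
  and measurable_residual_F [measurable]: "residual_F a b \<in> borel_measurable M"
  unfolding residual_F_def[abs_def] normalized_F_def[abs_def] by measurable

lemma normalized_residual_distr:
  assumes ab: "1 / 2 < a" "a < b"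
  shows "distr M (borel \<Otimes>\<^sub>M borel) (\<lambda>\<omega>. (normalized_F a \<omega>, residual_F a b \<omega>)) =
    std_normal_distribution \<Otimes>\<^sub>M std_normal_distribution"
proof -
  define r where "r = corr a b"
  define t where "t = sqrt (1 - r\<^sup>2)"
  have t: "0 < t" "t\<^sup>2 = 1 - r\<^sup>2" using corr_bounds[OF ab] by (auto simp: t_def r_def)
  define p where "p c k = real (Suc k) powr (-c) / sqrt (zeta_log 0 (2 * c))" for c k
  \<comment> \<open>\<open>p a\<close> and \<open>q\<close> are orthonormal in the space of square
    summable sequences; this is the hypothesis of the law of a Gaussian pair.\<close>
  define q where "q k = (p b k - r * p a k) / t" for k
  have pos: "0 < zeta_log 0 (2 * c)" if "1 / 2 < c" for c
    using zeta_log_0_ge_1[of "2 * c"] that by simp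
  have pp: "(\<lambda>k. p c k * p d k) sums corr c d" if "1 / 2 < c" "1 / 2 < d" for c d
    using sums_divide[OF sums_zeta_powr_mult[of c d], of "sqrt (zeta_log 0 (2 * c)) * sqrt (zeta_log 0 (2 * d))"] that
    by (simp add: p_def corr_def real_sqrt_mult)
  have corr_self: "corr c c = 1" if "1 / 2 < c" for c
    using pos[OF that] by (simp add: corr_def mult_2[symmetric])
  have corr_sym: "corr b a = r" by (simp add: r_def corr_def add.commute mult.commute)
  have paa: "(\<lambda>k. p a k * p a k) sums 1" and pbb: "(\<lambda>k. p b k * p b k) sums 1" and pab: "(\<lambda>k. p a k * p b k) sums r"
    using pp[of a a] pp[of b b] pp[of a b] corr_self[of a] corr_self[of b] ab by (simp_all add: r_def)
  have sumsF: "AE \<omega> in M. (\<lambda>k. p c k * X (Suc k) \<omega>) sums normalized_F c \<omega>" if "1 / 2 < c" for c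
    using AE_dirichlet_F_sums[OF that]
  proof eventually_elim
    case (elim \<omega>)
    from sums_divide[OF elim, of "sqrt (zeta_log 0 (2 * c))"] show ?case by (simp add: p_def normalized_F_def)
  qed
  show ?thesis
  proof (rule gaussian_series_pair_distr[where p = "p a" and q = q])
    show "AE \<omega> in M. (\<lambda>k. p a k * X (Suc k) \<omega>) sums normalized_F a \<omega>" by (rule sumsF[OF ab(1)])
    have "AE \<omega> in M. (\<lambda>k. p b k * X (Suc k) \<omega>) sums normalized_F b \<omega>" using sumsF[of b] ab by simp
    with sumsF[OF ab(1)] show "AE \<omega> in M. (\<lambda>k. q k * X (Suc k) \<omega>) sums residual_F a b \<omega>"
    proof eventually_elim
      case (elim \<omega>)
      from sums_divide[OF sums_diff[OF elim(2) sums_mult[OF elim(1), of r]], of t]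
      show ?case by (simp add: q_def residual_F_def r_def[symmetric] t_def[symmetric] diff_divide_distrib algebra_simps)
    qed
    show "(\<lambda>k. (p a k)\<^sup>2) sums 1" using paa by (simp add: power2_eq_square)
    have "(\<lambda>k. (p b k * p b k - 2 * r * (p a k * p b k) + r\<^sup>2 * (p a k * p a k)) / t\<^sup>2) sums ((1 - 2 * r * r + r\<^sup>2 * 1) / t\<^sup>2)"
      by (intro sums_divide sums_add sums_diff sums_mult paa pbb pab)
    moreover have "1 - 2 * r * r + r\<^sup>2 * 1 = t\<^sup>2" using t(2) by (simp add: power2_eq_square)
    moreover have "(p b k * p b k - 2 * r * (p a k * p b k) + r\<^sup>2 * (p a k * p a k)) / t\<^sup>2 = (q k)\<^sup>2" for k
      by (simp add: q_def power_divide power2_eq_square algebra_simps)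
    ultimately show "(\<lambda>k. (q k)\<^sup>2) sums 1" using t(1) by simp
    have "(\<lambda>k. (p a k * p b k - r * (p a k * p a k)) / t) sums ((r - r * 1) / t)"
      by (intro sums_divide sums_diff sums_mult paa pab)
    then show "(\<lambda>k. p a k * q k) sums 0" by (simp add: q_def algebra_simps)
  qed measurable
qed

lemma normalized_F_decomp:
  assumes ab: "1 / 2 < a" "a < b"
  shows "normalized_F b \<omega> = corr a b * normalized_F a \<omega> + sqrt (1 - (corr a b)\<^sup>2) * residual_F a b \<omega>"
  using corr_bounds[OF ab] by (simp add: residual_F_def)

lemma dirichlet_F_eq_normalized:
  assumes "1 / 2 < a"
  shows "dirichlet_F X \<omega> a = sqrt (zeta_log 0 (2 * a)) * normalized_F a \<omega>" "1 \<le> sqrt (zeta_log 0 (2 * a))"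
  using zeta_log_0_ge_1[of "2 * a"] assms by (simp_all add: normalized_F_def)

text \<open>The bound for small pairs with d = 0 gives probability 0 for each bound \<open>n\<close>
  on the residual, and the residual is always below some \<open>n\<close>. The second point
  \<open>a + 1\<close> is arbitrary; it only serves to form a pair.\<close>

lemma AE_dirichlet_F_nonzero:
  assumes a: "1 / 2 < a"
  shows "AE \<omega> in M. dirichlet_F X \<omega> a \<noteq> 0"
proof -
  have "AE \<omega> in M. \<forall>n::nat. \<not> (\<bar>normalized_F a \<omega>\<bar> \<le> 0 \<and> \<bar>0 * normalized_F a \<omega> + 1 * residual_F a (a + 1) \<omega>\<bar> \<le> of_nat n)"
    unfolding AE_all_countable
  proof
    fix n :: nat
    define A where "A = {p :: real \<times> real. \<bar>fst p\<bar> \<le> 0 \<and> \<bar>0 * fst p + 1 * snd p\<bar> \<le> of_nat n}"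
    have "A = {0} \<times> {- of_nat n..of_nat n}"
      by (auto simp: A_def abs_le_iff)
    also have "\<dots> \<in> sets (borel \<Otimes>\<^sub>M borel)" by (rule pair_measureI) auto
    finally have [measurable]: "A \<in> sets (borel \<Otimes>\<^sub>M borel)" .
    have "emeasure M {\<omega> \<in> space M. (normalized_F a \<omega>, residual_F a (a + 1) \<omega>) \<in> A} =
        emeasure (distr M (borel \<Otimes>\<^sub>M borel) (\<lambda>\<omega>. (normalized_F a \<omega>, residual_F a (a + 1) \<omega>))) A"
      by (subst emeasure_distr) (auto intro!: arg_cong[where f = "emeasure M"])
    also have "\<dots> = 0"
      using std_normal_pair_small[of 1 "of_nat n" 0 0] a by (simp add: normalized_residual_distr A_def)
    finally show "AE \<omega> in M. \<not> (\<bar>normalized_F a \<omega>\<bar> \<le> 0 \<and> \<bar>0 * normalized_F a \<omega> + 1 * residual_F a (a + 1) \<omega>\<bar> \<le> of_nat n)"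
      by (intro AE_I'[of "{\<omega> \<in> space M. (normalized_F a \<omega>, residual_F a (a + 1) \<omega>) \<in> A}"]) (auto simp: A_def intro!: null_setsI)
  qed
  then show ?thesis
  proof eventually_elim
    case (elim \<omega>)
    obtain n :: nat where "\<bar>residual_F a (a + 1) \<omega>\<bar> \<le> of_nat n" using real_arch_simple by blast
    with elim have "normalized_F a \<omega> \<noteq> 0" by auto
    then show ?case using dirichlet_F_eq_normalized(1)[OF a, of \<omega>] dirichlet_F_eq_normalized(2)[OF a] by simp
  qed
qed

text \<open>The variance zeta (2 c) is at least 1, so smallness of \<open>F\<close> passes to its
  normalisation, and the pair of normalised values is a linear image of a standard normal
  pair.\<close>

lemma emeasure_both_small:
  assumes ab: "1 / 2 < a" "a < b" and e: "0 \<le> e"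
  shows "emeasure M {\<omega> \<in> space M. \<bar>dirichlet_F X \<omega> a\<bar> \<le> e \<and> \<bar>dirichlet_F X \<omega> b\<bar> \<le> e}
    \<le> ennreal (4 * e * e / sqrt (1 - (corr a b)\<^sup>2))"
proof -
  let ?t = "sqrt (1 - (corr a b)\<^sup>2)"
  let ?A = "{p. \<bar>fst p\<bar> \<le> e \<and> \<bar>corr a b * fst p + ?t * snd p\<bar> \<le> e}"
  have "{p \<in> space (borel \<Otimes>\<^sub>M borel). \<bar>fst p\<bar> \<le> e \<and> \<bar>corr a b * fst p + ?t * snd p\<bar> \<le> e} \<in> sets (borel \<Otimes>\<^sub>M borel)"
    by measurable
  then have [measurable]: "?A \<in> sets (borel \<Otimes>\<^sub>M borel)" by (simp add: space_pair_measure)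
  have small: "\<bar>normalized_F c \<omega>\<bar> \<le> e" if c: "1 / 2 < c" "\<bar>dirichlet_F X \<omega> c\<bar> \<le> e" for c \<omega>
  proof -
    have "\<bar>normalized_F c \<omega>\<bar> * 1 \<le> \<bar>normalized_F c \<omega>\<bar> * sqrt (zeta_log 0 (2 * c))"
      using dirichlet_F_eq_normalized(2)[OF c(1)] by (intro mult_left_mono) auto
    also have "\<dots> = \<bar>dirichlet_F X \<omega> c\<bar>"
      using dirichlet_F_eq_normalized(1)[OF c(1), of \<omega>] dirichlet_F_eq_normalized(2)[OF c(1)] by (simp add: abs_mult)
    finally show ?thesis using c(2) by simp
  qed
  have "emeasure M {\<omega> \<in> space M. \<bar>dirichlet_F X \<omega> a\<bar> \<le> e \<and> \<bar>dirichlet_F X \<omega> b\<bar> \<le> e}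
      \<le> emeasure M ((\<lambda>\<omega>. (normalized_F a \<omega>, residual_F a b \<omega>)) -` ?A \<inter> space M)"
    using small[of a] small[of b] ab by (intro emeasure_mono) (auto simp: normalized_F_decomp[OF ab])
  also have "\<dots> = emeasure (distr M (borel \<Otimes>\<^sub>M borel) (\<lambda>\<omega>. (normalized_F a \<omega>, residual_F a b \<omega>))) ?A"
    by (subst emeasure_distr) auto
  also have "\<dots> \<le> ennreal (4 * e * e / ?t)"
    unfolding normalized_residual_distr[OF ab]
    by (rule std_normal_pair_small) (use e corr_bounds[OF ab] in auto)
  finally show ?thesis .
qed

text \<open>The angle with cosine \<open>?r\<close> has squared tangent (1 - ?r^2) / ?r^2, which by
  the formula for the squared correlation is an exponential minus 1. The two arctangents are
  complementary because \<open>?r\<close> is positive.\<close>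

lemma emeasure_opposite_signs:
  assumes ab: "1 / 2 < a" "a < b"
  shows "\<exists>\<eta>. a < \<eta> \<and> \<eta> < b \<and>
    emeasure M {\<omega> \<in> space M. dirichlet_F X \<omega> a * dirichlet_F X \<omega> b < 0}
      = ennreal (arctan (sqrt (exp ((b - a)\<^sup>2 * ln_zeta_deriv2 (2 * \<eta>)) - 1)) / pi)"
proof -
  let ?r = "corr a b"
  let ?t = "sqrt (1 - ?r\<^sup>2)"
  note r = corr_bounds[OF ab]
  have t: "0 < ?t" using r by simp
  let ?A = "{p. fst p * (?r * fst p + ?t * snd p) < 0}"
  have "{p \<in> space (borel \<Otimes>\<^sub>M borel). fst p * (?r * fst p + ?t * snd p) < 0} \<in> sets (borel \<Otimes>\<^sub>M borel)"
    by measurable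
  then have [measurable]: "?A \<in> sets (borel \<Otimes>\<^sub>M borel)" by (simp add: space_pair_measure)
  have "dirichlet_F X \<omega> a * dirichlet_F X \<omega> b < 0 \<longleftrightarrow> normalized_F a \<omega> * normalized_F b \<omega> < 0" for \<omega>
  proof -
    have "1 / 2 < b" using ab by simp
    note Fa = dirichlet_F_eq_normalized[OF ab(1)] and Fb = dirichlet_F_eq_normalized[OF this]
    have "dirichlet_F X \<omega> a * dirichlet_F X \<omega> b = (sqrt (zeta_log 0 (2 * a)) * sqrt (zeta_log 0 (2 * b))) * (normalized_F a \<omega> * normalized_F b \<omega>)"
      by (simp add: Fa(1) Fb(1))
    moreover have "0 < sqrt (zeta_log 0 (2 * a)) * sqrt (zeta_log 0 (2 * b))"
      by (rule mult_pos_pos) (use Fa(2) Fb(2) in linarith)+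
    moreover have "K * m < 0 \<longleftrightarrow> m < 0" if "0 < K" for K m :: real
      using that by (auto simp: mult_less_0_iff)
    ultimately show ?thesis by simp
  qed
  then have "emeasure M {\<omega> \<in> space M. dirichlet_F X \<omega> a * dirichlet_F X \<omega> b < 0}
      = emeasure M ((\<lambda>\<omega>. (normalized_F a \<omega>, residual_F a b \<omega>)) -` ?A \<inter> space M)"
    by (intro arg_cong[where f = "emeasure M"]) (auto simp: normalized_F_decomp[OF ab])
  also have "\<dots> = emeasure (distr M (borel \<Otimes>\<^sub>M borel) (\<lambda>\<omega>. (normalized_F a \<omega>, residual_F a b \<omega>))) ?A"
    by (subst emeasure_distr) auto
  also have "\<dots> = ennreal (1 / 2 - arctan (?r / ?t) / pi)"
    unfolding normalized_residual_distr[OF ab] by (rule std_normal_pair_opposite_signs[OF t])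
  also have "1 / 2 - arctan (?r / ?t) / pi = arctan (?t / ?r) / pi"
  proof -
    have "arctan (?r / ?t) = pi / 2 - arctan (?t / ?r)"
      using arctan_inverse[of "?t / ?r"] t r(1) by simp
    then show ?thesis by (simp only:) (simp add: diff_divide_distrib)
  qed
  finally have E: "emeasure M {\<omega> \<in> space M. dirichlet_F X \<omega> a * dirichlet_F X \<omega> b < 0} = ennreal (arctan (?t / ?r) / pi)" .
  obtain \<eta> where \<eta>: "a < \<eta>" "\<eta> < b" "?r\<^sup>2 = exp (- ((b - a)\<^sup>2 * ln_zeta_deriv2 (2 * \<eta>)))"
    using corr_square[OF ab] by blast
  have "?t / ?r = sqrt ((1 - ?r\<^sup>2) / ?r\<^sup>2)"
    using r(1) by (simp add: real_sqrt_divide)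
  also have "(1 - ?r\<^sup>2) / ?r\<^sup>2 = exp ((b - a)\<^sup>2 * ln_zeta_deriv2 (2 * \<eta>)) - 1"
    unfolding \<eta>(3) by (simp add: exp_minus field_simps)
  finally show ?thesis using E \<eta>(1,2) by (intro exI[of _ \<eta>]) simp
qed

end

section \<open>The Kac-Rice formula\<close>

text \<open>The mean value inequality on the segment from \<open>z\<close>, once for f' and once for
  f; Taylor's factor 1/2 is given up.\<close>

lemma double_zero_bound:
  fixes f f' f'' :: "real \<Rightarrow> real"
  assumes d1: "\<And>x. x \<in> {a..b} \<Longrightarrow> (f has_real_derivative f' x) (at x)"
    and d2: "\<And>x. x \<in> {a..b} \<Longrightarrow> (f' has_real_derivative f'' x) (at x)"
    and L: "\<And>x. x \<in> {a..b} \<Longrightarrow> \<bar>f'' x\<bar> \<le> L"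
    and z: "z \<in> {a..b}" "f z = 0" "f' z = 0" and y: "y \<in> {a..b}"
  shows "\<bar>f y\<bar> \<le> L * (y - z)\<^sup>2"
proof -
  have L0: "0 \<le> L" using L[OF z(1)] by linarith
  let ?I = "closed_segment z y"
  have sub: "?I \<subseteq> {a..b}" using z(1) y by (auto simp: closed_segment_eq_real_ivl split: if_splits)
  have b1: "\<bar>f' x\<bar> \<le> L * \<bar>y - z\<bar>" if x: "x \<in> ?I" for x
  proof -
    have "norm (f' x - f' z) \<le> L * norm (x - z)"
    proof (rule field_differentiable_bound[of ?I f' f''])
      fix w assume "w \<in> ?I"
      then have w: "w \<in> {a..b}" using sub by blast
      show "(f' has_field_derivative f'' w) (at w within ?I)"
        by (rule has_field_derivative_at_within[OF d2[OF w]])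
      show "norm (f'' w) \<le> L" using L[OF w] by simp
    qed (use x in auto)
    also have "\<dots> \<le> L * \<bar>y - z\<bar>"
      using x L0 by (intro mult_left_mono) (auto simp: closed_segment_eq_real_ivl split: if_splits)
    finally show ?thesis using z(3) by simp
  qed
  have "norm (f y - f z) \<le> (L * \<bar>y - z\<bar>) * norm (y - z)"
  proof (rule field_differentiable_bound[of ?I f f'])
    fix w assume w: "w \<in> ?I"
    then have "w \<in> {a..b}" using sub by blast
    then show "(f has_field_derivative f' w) (at w within ?I)"
      by (rule has_field_derivative_at_within[OF d1])
    show "norm (f' w) \<le> L * \<bar>y - z\<bar>" using b1[OF w] by simp
  qed auto
  then show ?thesis using z(2) by (simp add: power2_eq_square abs_mult_self_eq mult.assoc)
qed

text \<open>The first intensity of the zeros of a centred Gaussian process: 1 / pi times the root of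
  the mixed derivative of ln K on the diagonal, for the covariance K (a, b) = zeta (a + b).\<close>

definition kac_rice_density :: "real \<Rightarrow> real" where
  "kac_rice_density x = sqrt (ln_zeta_deriv2 (2 * x)) / pi"

lemma continuous_on_kac_rice_density: "continuous_on {1 / 2<..} kac_rice_density"
  unfolding kac_rice_density_def[abs_def]
  by (intro continuous_intros continuous_on_compose2[OF continuous_on_ln_zeta_deriv2]) auto

lemma borel_measurable_kac_rice_density [measurable]: "kac_rice_density \<in> borel_measurable borel"
  unfolding kac_rice_density_def[abs_def] ln_zeta_deriv2_def zeta_log_def by measurable

lemma kac_rice_density_nonneg: "1 / 2 < x \<Longrightarrow> 0 \<le> kac_rice_density x"
  using ln_zeta_deriv2_pos[of "2 * x"] by (simp add: kac_rice_density_def)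

lemma ln_zeta_deriv2_bounds:
  assumes "1 / 2 < a"
  obtains q Q where "0 < q" "\<And>x. x \<in> {a..b} \<Longrightarrow> q \<le> ln_zeta_deriv2 (2 * x) \<and> ln_zeta_deriv2 (2 * x) \<le> Q"
proof (cases "a \<le> b")
  case True
  have c: "continuous_on {a..b} (\<lambda>x. ln_zeta_deriv2 (2 * x))"
    using assms by (intro continuous_on_compose2[OF continuous_on_ln_zeta_deriv2] continuous_intros) auto
  obtain x0 where x0: "x0 \<in> {a..b}" "\<And>x. x \<in> {a..b} \<Longrightarrow> ln_zeta_deriv2 (2 * x0) \<le> ln_zeta_deriv2 (2 * x)"
    using continuous_attains_inf[OF _ _ c] True by auto
  obtain x1 where x1: "x1 \<in> {a..b}" "\<And>x. x \<in> {a..b} \<Longrightarrow> ln_zeta_deriv2 (2 * x) \<le> ln_zeta_deriv2 (2 * x1)"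
    using continuous_attains_sup[OF _ _ c] True by auto
  have "0 < ln_zeta_deriv2 (2 * x0)" using x0(1) assms by (intro ln_zeta_deriv2_pos) auto
  with x0 x1 show ?thesis by (intro that[of "ln_zeta_deriv2 (2 * x0)" "ln_zeta_deriv2 (2 * x1)"]) auto
next
  case False
  then show ?thesis by (intro that[of 1 1]) auto
qed

text \<open>With u = (y - x)^2 q \<le> 1 one has 1 - exp (- u) \<ge> u / 2. The independent part of
  the second value is thus at least linear in the distance, uniformly on the interval.\<close>

lemma sqrt_one_minus_corr_ge:
  assumes a: "1 / 2 < a" and q: "0 < q" "\<And>x. x \<in> {a..b} \<Longrightarrow> q \<le> ln_zeta_deriv2 (2 * x)"
    and xy: "a \<le> x" "x < y" "y \<le> b" "(y - x)\<^sup>2 * q \<le> 1"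
  shows "(y - x) * sqrt (q / 2) \<le> sqrt (1 - (corr x y)\<^sup>2)"
proof -
  obtain \<eta> where \<eta>: "x < \<eta>" "\<eta> < y" "(corr x y)\<^sup>2 = exp (- ((y - x)\<^sup>2 * ln_zeta_deriv2 (2 * \<eta>)))"
    using corr_square[of x y] a xy by auto
  let ?u = "(y - x)\<^sup>2 * q"
  have u: "0 \<le> ?u" using q by simp
  have "?u \<le> (y - x)\<^sup>2 * ln_zeta_deriv2 (2 * \<eta>)"
    using q(2)[of \<eta>] \<eta> xy by (intro mult_left_mono) auto
  then have "(corr x y)\<^sup>2 \<le> exp (- ?u)" unfolding \<eta>(3) by simp
  also have "exp (- ?u) \<le> 1 / (1 + ?u)"
    using exp_ge_add_one_self[of ?u] u by (simp add: exp_minus field_simps)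
  also have "\<dots> \<le> 1 - ?u / 2"
  proof -
    have "1 * 2 \<le> (2 - ?u) * (1 + ?u)"
      using mult_nonneg_nonneg[OF u, of "1 - ?u"] xy(4) by (simp add: algebra_simps)
    then show ?thesis using u by (simp add: field_simps)
  qed
  finally have "(y - x)\<^sup>2 * (q / 2) \<le> 1 - (corr x y)\<^sup>2" by simp
  then have "sqrt ((y - x)\<^sup>2 * (q / 2)) \<le> sqrt (1 - (corr x y)\<^sup>2)" by (rule real_sqrt_le_mono)
  moreover have "sqrt ((y - x)\<^sup>2 * (q / 2)) = (y - x) * sqrt (q / 2)"
    using xy by (subst real_sqrt_mult) simp
  ultimately show ?thesis by (simp only:)
qed

context gaussian_sequence
begin

text \<open>With thresholds L h^2 and independent part at least h s, one cell contributes at most 4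
  L^2 h^3 / s; summing over n = (b - a) / h cells gives the constant \<open>K\<close>.\<close>

lemma emeasure_near_double_zero:
  assumes a: "1 / 2 < a" "a < b" and L: "0 \<le> L"
  shows "\<exists>K. \<forall>\<^sub>F n in sequentially. emeasure M {\<omega> \<in> space M.
      \<exists>k<n. \<bar>dirichlet_F X \<omega> (grid a b n k)\<bar> \<le> L * ((b - a) / n)\<^sup>2 \<and>
        \<bar>dirichlet_F X \<omega> (grid a b n (Suc k))\<bar> \<le> L * ((b - a) / n)\<^sup>2} \<le> ennreal (K / (real n)\<^sup>2)"
proof -
  obtain q Q where q: "0 < q" "\<And>x. x \<in> {a..b} \<Longrightarrow> q \<le> ln_zeta_deriv2 (2 * x) \<and> ln_zeta_deriv2 (2 * x) \<le> Q"
    using ln_zeta_deriv2_bounds[OF a(1)] by blast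
  define s where "s = sqrt (q / 2)"
  have s: "0 < s" using q(1) by (simp add: s_def)
  have "(\<lambda>n. (b - a) / real n) \<longlonglongrightarrow> 0" by real_asymp
  then have lim: "(\<lambda>n. ((b - a) / real n)\<^sup>2 * q) \<longlonglongrightarrow> 0" by (auto intro!: tendsto_eq_intros)
  show ?thesis
  proof (rule exI[of _ "4 * (b - a) ^ 3 / s * L\<^sup>2"])
    show "\<forall>\<^sub>F n in sequentially. emeasure M {\<omega> \<in> space M.
      \<exists>k<n. \<bar>dirichlet_F X \<omega> (grid a b n k)\<bar> \<le> L * ((b - a) / n)\<^sup>2 \<and>
        \<bar>dirichlet_F X \<omega> (grid a b n (Suc k))\<bar> \<le> L * ((b - a) / n)\<^sup>2} \<le> ennreal (4 * (b - a) ^ 3 / s * L\<^sup>2 / (real n)\<^sup>2)"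
      using order_tendstoD(2)[OF lim, of 1, simplified] eventually_gt_at_top[of "0::nat"]
    proof eventually_elim
      case (elim n)
      define h where "h = (b - a) / real n"
      have h: "0 < h" "real n * h = b - a" "h\<^sup>2 * q \<le> 1" using elim a by (auto simp: h_def)
      define E where "E k = {\<omega> \<in> space M. \<bar>dirichlet_F X \<omega> (grid a b n k)\<bar> \<le> L * h\<^sup>2 \<and> \<bar>dirichlet_F X \<omega> (grid a b n (Suc k))\<bar> \<le> L * h\<^sup>2}" for k
      have [measurable]: "E k \<in> sets M" for k unfolding E_def by measurable
      have Ek: "emeasure M (E k) \<le> ennreal (4 * L\<^sup>2 * h ^ 3 / s)" if k: "k < n" for k
      proof -
        let ?x = "grid a b n k" and ?y = "grid a b n (Suc k)"
        have xy: "a \<le> ?x" "?y \<le> b" "?y - ?x = h"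
          using grid_bounds[of a b k n] grid_bounds[of a b "Suc k" n] k a by (auto simp: grid_Suc h_def)
        have ge: "h * s \<le> sqrt (1 - (corr ?x ?y)\<^sup>2)"
          using sqrt_one_minus_corr_ge[OF a(1) q(1), of b ?x ?y] q(2) xy h by (simp add: s_def)
        have "emeasure M (E k) \<le> ennreal (4 * (L * h\<^sup>2) * (L * h\<^sup>2) / sqrt (1 - (corr ?x ?y)\<^sup>2))"
          unfolding E_def by (rule emeasure_both_small) (use xy a h L in auto)
        also have "\<dots> \<le> ennreal (4 * (L * h\<^sup>2) * (L * h\<^sup>2) / (h * s))"
        proof (intro ennreal_leI divide_left_mono ge)
          have hs: "0 < h * s" using h(1) s by simp
          with ge have "0 < sqrt (1 - (corr ?x ?y)\<^sup>2)" by linarith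
          then show "0 < sqrt (1 - (corr ?x ?y)\<^sup>2) * (h * s)" using hs by (rule mult_pos_pos)
        qed (use L in auto)
        also have "4 * (L * h\<^sup>2) * (L * h\<^sup>2) / (h * s) = 4 * L\<^sup>2 * h ^ 3 / s"
          using h(1) by (simp add: power2_eq_square power3_eq_cube)
        finally show ?thesis .
      qed
      have "emeasure M (\<Union>k<n. E k) \<le> (\<Sum>k<n. emeasure M (E k))"
        by (rule emeasure_subadditive_finite) auto
      also have "\<dots> \<le> (\<Sum>k<n. ennreal (4 * L\<^sup>2 * h ^ 3 / s))" by (intro sum_mono Ek) auto
      also have "\<dots> = ennreal (real n * (4 * L\<^sup>2 * h ^ 3 / s))"
        using h s by (simp add: ennreal_of_nat_eq_real_of_nat ennreal_mult[symmetric])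
      also have "real n * (4 * L\<^sup>2 * h ^ 3 / s) = 4 * (b - a) ^ 3 / s * L\<^sup>2 / (real n)\<^sup>2"
        using elim by (simp add: h_def power2_eq_square power3_eq_cube mult_ac)
      also have "(\<Union>k<n. E k) = {\<omega> \<in> space M.
        \<exists>k<n. \<bar>dirichlet_F X \<omega> (grid a b n k)\<bar> \<le> L * ((b - a) / n)\<^sup>2 \<and>
        \<bar>dirichlet_F X \<omega> (grid a b n (Suc k))\<bar> \<le> L * ((b - a) / n)\<^sup>2}"
        by (auto simp: E_def h_def)
      finally show ?case .
    qed
  qed
qed

text \<open>For fixed \<open>L\<close> the bad events for all grids at once lie in each single one,
  whose probability tends to 0. Natural \<open>L\<close> keeps the union of exceptional sets
  countable.\<close>

lemma AE_not_near_double_zero: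
  assumes a: "1 / 2 < a" "a < b"
  shows "AE \<omega> in M. \<forall>L::nat. \<exists>n>0. \<forall>k<n. \<not> (\<bar>dirichlet_F X \<omega> (grid a b n k)\<bar> \<le> real L * ((b - a) / n)\<^sup>2 \<and>
        \<bar>dirichlet_F X \<omega> (grid a b n (Suc k))\<bar> \<le> real L * ((b - a) / n)\<^sup>2)"
  unfolding AE_all_countable
proof
  fix L :: nat
  define E where "E n = {\<omega> \<in> space M. \<exists>k<n. \<bar>dirichlet_F X \<omega> (grid a b n k)\<bar> \<le> real L * ((b - a) / n)\<^sup>2 \<and>
        \<bar>dirichlet_F X \<omega> (grid a b n (Suc k))\<bar> \<le> real L * ((b - a) / n)\<^sup>2}" for n
  have [measurable]: "E n \<in> sets M" for n unfolding E_def by measurable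
  obtain K where K: "\<forall>\<^sub>F n in sequentially. emeasure M (E n) \<le> ennreal (K / (real n)\<^sup>2)"
    unfolding E_def using emeasure_near_double_zero[OF a of_nat_0_le_iff] by blast
  have "(\<lambda>n. K / (real n)\<^sup>2) \<longlonglongrightarrow> 0" by real_asymp
  then have lim: "(\<lambda>n. ennreal (K / (real n)\<^sup>2)) \<longlonglongrightarrow> 0"
    using tendsto_ennrealI by fastforce
  have "emeasure M (\<Inter>n. E (Suc n)) \<le> 0"
  proof (rule tendsto_le[OF sequentially_bot lim tendsto_const])
    show "\<forall>\<^sub>F n in sequentially. emeasure M (\<Inter>n. E (Suc n)) \<le> ennreal (K / (real n)\<^sup>2)"
      using K eventually_gt_at_top[of "0::nat"]
    proof eventually_elim
      case (elim n)
      have "(\<Inter>n. E (Suc n)) \<subseteq> E n" using elim(2) by (metis INT_lower Suc_pred UNIV_I)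
      then have "emeasure M (\<Inter>n. E (Suc n)) \<le> emeasure M (E n)" by (intro emeasure_mono) auto
      then show ?case using elim(1) by (rule order_trans)
    qed
  qed
  then have "(\<Inter>n. E (Suc n)) \<in> null_sets M" by (auto intro!: null_setsI)
  then show "AE \<omega> in M. \<exists>n>0. \<forall>k<n. \<not> (\<bar>dirichlet_F X \<omega> (grid a b n k)\<bar> \<le> real L * ((b - a) / n)\<^sup>2 \<and>
        \<bar>dirichlet_F X \<omega> (grid a b n (Suc k))\<bar> \<le> real L * ((b - a) / n)\<^sup>2)"
  proof (rule AE_I', intro subsetI)
    fix \<omega> assume \<omega>: "\<omega> \<in> {\<omega> \<in> space M. \<not> (\<exists>n>0. \<forall>k<n. \<not> (\<bar>dirichlet_F X \<omega> (grid a b n k)\<bar> \<le> real L * ((b - a) / n)\<^sup>2 \<and>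
        \<bar>dirichlet_F X \<omega> (grid a b n (Suc k))\<bar> \<le> real L * ((b - a) / n)\<^sup>2))}"
    then have "\<omega> \<in> E n" if "0 < n" for n unfolding E_def using that by blast
    then show "\<omega> \<in> (\<Inter>n. E (Suc n))" by blast
  qed
qed

text \<open>Two neighbouring grid points around a double zero are both of size \<open>O(h\<^sup>2)\<close>,
  where \<open>h\<close> is the mesh; a union bound shows that this almost surely fails for some grid.\<close>

lemma AE_simple_zeros:
  assumes a: "1 / 2 < a" "a < b"
  shows "AE \<omega> in M. \<forall>z\<in>{a..b}. dirichlet_F X \<omega> z = 0 \<longrightarrow>
    (\<exists>D. (dirichlet_F X \<omega> has_real_derivative D) (at z) \<and> D \<noteq> 0)"
  using AE_not_near_double_zero[OF a] AE_good
proof eventually_elim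
  case (elim \<omega>)
  obtain f' f'' where f: "\<forall>\<sigma>>1/2. (dirichlet_F X \<omega> has_real_derivative f' \<sigma>) (at \<sigma>)"
    "\<forall>\<sigma>>1/2. (f' has_real_derivative f'' \<sigma>) (at \<sigma>)"
    "continuous_on {1/2<..} f''"
    using good_derivatives[OF elim(2)] by blast
  have "compact (f'' ` {a..b})"
    using f(3) a(1) by (intro compact_continuous_image) (auto elim!: continuous_on_subset)
  then obtain B where B: "\<And>x. x \<in> {a..b} \<Longrightarrow> \<bar>f'' x\<bar> \<le> B"
    using bounded_iff compact_imp_bounded by (metis imageI real_norm_def)
  \<comment> \<open>The bound on the second derivative depends on \<omega>, which is why the
    exceptional set above covers all \<open>L\<close> at once.\<close>
  obtain L :: nat where "B \<le> real L" using real_arch_simple by blast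
  then have L: "\<bar>f'' x\<bar> \<le> real L" if "x \<in> {a..b}" for x using B[OF that] by linarith
  obtain n where n: "0 < n" "\<And>k. k < n \<Longrightarrow> \<not> (\<bar>dirichlet_F X \<omega> (grid a b n k)\<bar> \<le> real L * ((b - a) / n)\<^sup>2 \<and>
        \<bar>dirichlet_F X \<omega> (grid a b n (Suc k))\<bar> \<le> real L * ((b - a) / n)\<^sup>2)"
    using elim(1) by blast
  show ?case
  proof (intro ballI impI)
    fix z assume z: "z \<in> {a..b}" "dirichlet_F X \<omega> z = 0"
    have "f' z \<noteq> 0"
    proof
      assume f'z: "f' z = 0"
      obtain k where k: "k < n" "grid a b n k \<le> z" "z \<le> grid a b n (Suc k)"
        using grid_covers[of a z b n n] z n(1) by auto
      have bd: "\<bar>dirichlet_F X \<omega> y\<bar> \<le> real L * ((b - a) / n)\<^sup>2"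
        if y: "y \<in> {a..b}" "\<bar>y - z\<bar> \<le> (b - a) / n" for y
      proof -
        have "\<bar>dirichlet_F X \<omega> y\<bar> \<le> real L * (y - z)\<^sup>2"
          by (rule double_zero_bound[where f' = f' and f'' = f'' and a = a and b = b])
             (use f(1,2) L z y f'z a in auto)
        also have "\<dots> \<le> real L * ((b - a) / n)\<^sup>2"
          using y(2) a by (intro mult_left_mono) (auto simp flip: abs_le_square_iff)
        finally show ?thesis .
      qed
      have "\<bar>grid a b n k - z\<bar> \<le> (b - a) / n" "\<bar>grid a b n (Suc k) - z\<bar> \<le> (b - a) / n"
        using k(2,3) by (auto simp: grid_Suc)
      moreover have "grid a b n k \<in> {a..b}" "grid a b n (Suc k) \<in> {a..b}"
        using grid_bounds[of a b k n] grid_bounds[of a b "Suc k" n] k(1) a by auto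
      ultimately show False using n(2)[OF k(1)] bd by blast
    qed
    then show "\<exists>D. (dirichlet_F X \<omega> has_real_derivative D) (at z) \<and> D \<noteq> 0"
      using f(1) z a \<open>f' z \<noteq> 0\<close> by (intro exI[of _ "f' z"]) auto
  qed
qed

section \<open>Expected zero counts on compact intervals and half-lines\<close>

definition zero_count :: "real \<Rightarrow> real \<Rightarrow> 'a \<Rightarrow> ennreal" where
  "zero_count a b \<omega> = emeasure (count_space UNIV) {x. a \<le> x \<and> x \<le> b \<and> dirichlet_F X \<omega> x = 0}"

lemma good_continuous:
  assumes "good \<omega>" "1 / 2 < a"
  shows "continuous_on {a..b} (dirichlet_F X \<omega>)"
proof -
  obtain f' f'' where "\<forall>\<sigma>>1/2. (dirichlet_F X \<omega> has_real_derivative f' \<sigma>) (at \<sigma>)"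
    "\<forall>\<sigma>>1/2. (f' has_real_derivative f'' \<sigma>) (at \<sigma>)"
    "continuous_on {1/2<..} f''"
    using good_derivatives[OF assms(1)] by blast
  then have "isCont (dirichlet_F X \<omega>) x" if "1 / 2 < x" for x
    using that DERIV_isCont by blast
  then show ?thesis
    using assms(2) by (intro continuous_at_imp_continuous_on ballI) auto
qed

lemma AE_sign_changes_tendsto:
  assumes a: "1 / 2 < a" "a < b"
  shows "AE \<omega> in M. (\<lambda>n. of_nat (sign_changes (dirichlet_F X \<omega>) a b n)) \<longlonglongrightarrow> zero_count a b \<omega>"
proof -
  have grid: "AE \<omega> in M. \<forall>n k. k \<le> n \<longrightarrow> 0 < n \<longrightarrow> dirichlet_F X \<omega> (grid a b n k) \<noteq> 0"
    unfolding AE_all_countable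
  proof (intro allI)
    fix n k
    show "AE \<omega> in M. k \<le> n \<longrightarrow> 0 < n \<longrightarrow> dirichlet_F X \<omega> (grid a b n k) \<noteq> 0"
    proof (cases "k \<le> n \<and> 0 < n")
      case True
      then have "1 / 2 < grid a b n k" using grid_bounds[of a b k n] a by simp
      from AE_dirichlet_F_nonzero[OF this] show ?thesis by eventually_elim simp
    qed auto
  qed
  show ?thesis
    using grid AE_simple_zeros[OF a] AE_good
  proof eventually_elim
    case (elim \<omega>)
    show ?case unfolding zero_count_def
      by (rule sign_changes_tendsto_zeros) (use elim a good_continuous in auto)
  qed
qed

lemma measurable_sign_changes [measurable]:
  "(\<lambda>\<omega>. of_nat (sign_changes (dirichlet_F X \<omega>) a b n) :: ennreal) \<in> borel_measurable M"
  and nn_integral_sign_changes: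
  "(\<integral>\<^sup>+\<omega>. of_nat (sign_changes (dirichlet_F X \<omega>) a b n) \<partial>M) =
    (\<Sum>k<n. emeasure M {\<omega> \<in> space M. dirichlet_F X \<omega> (grid a b n k) * dirichlet_F X \<omega> (grid a b n (Suc k)) < 0})"
proof -
  let ?E = "\<lambda>k. {\<omega> \<in> space M. dirichlet_F X \<omega> (grid a b n k) * dirichlet_F X \<omega> (grid a b n (Suc k)) < 0}"
  have [measurable]: "?E k \<in> sets M" for k by measurable
  have eq: "(of_nat (sign_changes (dirichlet_F X \<omega>) a b n) :: ennreal) = (\<Sum>k<n. indicator (?E k) \<omega>)"
    if "\<omega> \<in> space M" for \<omega>
  proof -
    have "(\<Sum>k<n. indicator (?E k) \<omega>) = (\<Sum>k\<in>{..<n}. if \<omega> \<in> ?E k then 1 else (0::ennreal))"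
      by (intro sum.cong) (auto split: split_indicator)
    also have "\<dots> = of_nat (card {k \<in> {..<n}. \<omega> \<in> ?E k})"
      by (subst sum.If_cases) (auto simp: Int_def)
    also have "{k \<in> {..<n}. \<omega> \<in> ?E k} = {k. k < n \<and> dirichlet_F X \<omega> (grid a b n k) * dirichlet_F X \<omega> (grid a b n (Suc k)) < 0}"
      using that by auto
    finally show ?thesis by (simp add: sign_changes_def)
  qed
  show "(\<lambda>\<omega>. of_nat (sign_changes (dirichlet_F X \<omega>) a b n) :: ennreal) \<in> borel_measurable M"
    by (subst measurable_cong[OF eq]) auto
  show "(\<integral>\<^sup>+\<omega>. of_nat (sign_changes (dirichlet_F X \<omega>) a b n) \<partial>M) = (\<Sum>k<n. emeasure M (?E k))"
    by (subst nn_integral_cong[OF eq]) (auto simp: nn_integral_sum)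
qed

text \<open>A cell contributes arctan (sqrt (exp u - 1)) / pi with u = h^2 (ln zeta)'' at its tag.
  Replacing this by sqrt u / pi, which is mesh times density, turns the sum into a Riemann sum; the
  total error is at most of order n h^3 = O(h^2).\<close>

lemma nn_integral_sign_changes_tendsto:
  assumes a: "1 / 2 < a" "a < b"
  shows "(\<lambda>n. \<integral>\<^sup>+\<omega>. of_nat (sign_changes (dirichlet_F X \<omega>) a b n) \<partial>M) \<longlonglongrightarrow> ennreal (integral {a..b} kac_rice_density)"
proof -
  define P where "P n k \<eta> \<longleftrightarrow> grid a b n k < \<eta> \<and> \<eta> < grid a b n (Suc k) \<and>
    emeasure M {\<omega> \<in> space M. dirichlet_F X \<omega> (grid a b n k) * dirichlet_F X \<omega> (grid a b n (Suc k)) < 0}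
      = ennreal (arctan (sqrt (exp (((b - a) / n)\<^sup>2 * ln_zeta_deriv2 (2 * \<eta>)) - 1)) / pi)" for n k \<eta>
  have "\<exists>\<eta>. P n k \<eta>" if k: "k < n" for n k
    using emeasure_opposite_signs[of "grid a b n k" "grid a b n (Suc k)"] grid_bounds[of a b k n] a k
    by (auto simp: P_def grid_Suc)
  then have \<eta>: "P n k (SOME \<eta>. P n k \<eta>)" if "k < n" for n k
    using someI_ex that by fast
  define \<eta> where "\<eta> n k = (SOME \<eta>. P n k \<eta>)" for n k
  note \<eta> = \<eta>[folded \<eta>_def]
  define u where "u n k = ((b - a) / real n)\<^sup>2 * ln_zeta_deriv2 (2 * \<eta> n k)" for n k
  obtain q Q where q: "0 < q" "\<And>x. x \<in> {a..b} \<Longrightarrow> q \<le> ln_zeta_deriv2 (2 * x) \<and> ln_zeta_deriv2 (2 * x) \<le> Q"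
    using ln_zeta_deriv2_bounds[OF a(1)] by blast
  have Q0: "0 < Q" using q(1) q(2)[of a] a by auto
  have \<eta>_in: "\<eta> n k \<in> {a..b}" if "k < n" for n k
    using \<eta>[OF that] grid_bounds[of a b k n] grid_bounds[of a b "Suc k" n] that a by (auto simp: P_def)
  have u: "0 \<le> u n k" "u n k \<le> ((b - a) / real n)\<^sup>2 * Q" if "k < n" for n k
    using q(1) q(2)[OF \<eta>_in[OF that]] by (auto simp: u_def intro!: mult_left_mono)
  have E: "(\<integral>\<^sup>+\<omega>. of_nat (sign_changes (dirichlet_F X \<omega>) a b n) \<partial>M) = ennreal (\<Sum>k<n. arctan (sqrt (exp (u n k) - 1)) / pi)" for n
  proof -
    have "(\<integral>\<^sup>+\<omega>. of_nat (sign_changes (dirichlet_F X \<omega>) a b n) \<partial>M) = (\<Sum>k<n. ennreal (arctan (sqrt (exp (u n k) - 1)) / pi))"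
      unfolding nn_integral_sign_changes using \<eta> by (intro sum.cong) (auto simp: P_def u_def)
    also have "\<dots> = ennreal (\<Sum>k<n. arctan (sqrt (exp (u n k) - 1)) / pi)"
      using u(1) by (intro sum_ennreal) auto
    finally show ?thesis .
  qed
  have cont: "continuous_on {a..b} kac_rice_density"
    using a by (intro continuous_on_subset[OF continuous_on_kac_rice_density]) auto
  have R: "(\<lambda>n. \<Sum>k<n. (b - a) / real n * kac_rice_density (\<eta> n k)) \<longlonglongrightarrow> integral {a..b} kac_rice_density"
    by (rule Riemann_sum_tendsto[OF a(2) cont]) (use \<eta> in \<open>auto simp: P_def less_imp_le\<close>)
  have diff: "(\<lambda>n. (\<Sum>k<n. arctan (sqrt (exp (u n k) - 1)) / pi) - (\<Sum>k<n. (b - a) / real n * kac_rice_density (\<eta> n k))) \<longlonglongrightarrow> 0"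
  proof (rule Lim_null_comparison)
    let ?v = "\<lambda>n. ((b - a) / real n)\<^sup>2 * Q"
    have h0: "(\<lambda>n. (b - a) / real n) \<longlonglongrightarrow> 0" by real_asymp
    then have "?v \<longlonglongrightarrow> 0" by (auto intro!: tendsto_eq_intros)
    then have "\<forall>\<^sub>F n in sequentially. ?v n < 1" by (rule order_tendstoD(2)) simp
    then show "\<forall>\<^sub>F n in sequentially. norm ((\<Sum>k<n. arctan (sqrt (exp (u n k) - 1)) / pi) - (\<Sum>k<n. (b - a) / real n * kac_rice_density (\<eta> n k))) \<le> (b - a) * ((b - a) / real n * Q * ((b - a) / real n * sqrt Q))"
      using eventually_gt_at_top[of "0::nat"]
    proof eventually_elim
      case (elim n)
      have "\<bar>arctan (sqrt (exp (u n k) - 1)) / pi - (b - a) / real n * kac_rice_density (\<eta> n k)\<bar> \<le> ?v n * sqrt (?v n)" if k: "k < n" for k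
      proof -
        have e: "(b - a) / real n * kac_rice_density (\<eta> n k) = sqrt (u n k) / pi"
          using a by (simp add: u_def kac_rice_density_def real_sqrt_mult)
        have "\<bar>arctan (sqrt (exp (u n k) - 1)) / pi - sqrt (u n k) / pi\<bar> = \<bar>arctan (sqrt (exp (u n k) - 1)) - sqrt (u n k)\<bar> / pi"
          by (simp add: diff_divide_distrib[symmetric])
        also have "\<dots> \<le> \<bar>arctan (sqrt (exp (u n k) - 1)) - sqrt (u n k)\<bar> / 1"
          using pi_ge_two by (intro divide_left_mono) auto
        also have "\<dots> \<le> u n k * sqrt (u n k)"
          using arctan_sqrt_exp_bound[of "u n k"] u[OF k] elim(1) by simp
        also have "\<dots> \<le> ?v n * sqrt (?v n)"
          using u[OF k] by (intro mult_mono real_sqrt_le_mono) auto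
        finally show ?thesis unfolding e .
      qed
      then have "(\<Sum>k<n. \<bar>arctan (sqrt (exp (u n k) - 1)) / pi - (b - a) / real n * kac_rice_density (\<eta> n k)\<bar>) \<le> (\<Sum>k<n. ?v n * sqrt (?v n))"
        by (intro sum_mono) auto
      moreover have "(\<Sum>k<n. ?v n * sqrt (?v n)) = (b - a) * ((b - a) / real n * Q * ((b - a) / real n * sqrt Q))"
      proof -
        define h where "h = (b - a) / real n"
        have h: "0 \<le> h" "real n * h = b - a" using a elim(2) by (auto simp: h_def)
        have "sqrt (h\<^sup>2 * Q) = h * sqrt Q" using h(1) by (subst real_sqrt_mult) simp
        then have "(\<Sum>k<n. h\<^sup>2 * Q * sqrt (h\<^sup>2 * Q)) = (real n * h) * (h * Q * (h * sqrt Q))"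
          by (simp add: power2_eq_square)
        then show ?thesis unfolding h(2) unfolding h_def .
      qed
      ultimately show ?case
        unfolding sum_subtractf[symmetric] real_norm_def by (intro order_trans[OF sum_abs]) linarith
    qed
    have "(\<lambda>n. (b - a) * ((b - a) / real n * Q * ((b - a) / real n * sqrt Q))) \<longlonglongrightarrow> (b - a) * (0 * Q * (0 * sqrt Q))"
      by (intro tendsto_mult tendsto_const h0)
    then show "(\<lambda>n. (b - a) * ((b - a) / real n * Q * ((b - a) / real n * sqrt Q))) \<longlonglongrightarrow> 0"
      by (simp only: mult_zero_left mult_zero_right)
  qed
  from tendsto_add[OF diff R]
  have "(\<lambda>n. \<Sum>k<n. arctan (sqrt (exp (u n k) - 1)) / pi) \<longlonglongrightarrow> integral {a..b} kac_rice_density" by simp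
  then show ?thesis unfolding E by (rule tendsto_ennrealI)
qed

text \<open>The liminf of the sign changes is a version of the count that is measurable for
  \<open>M\<close> itself. Fatou's lemma bounds its expectation from above; each expected number of
  sign changes is at most that expectation, which bounds it from below.\<close>

lemma zero_count_measurable_nn_integral:
  assumes a: "1 / 2 < a" "a < b"
  shows "zero_count a b \<in> borel_measurable (completion M)"
    and "(\<integral>\<^sup>+\<omega>. zero_count a b \<omega> \<partial>completion M) = (\<integral>\<^sup>+x. ennreal (kac_rice_density x) * indicator {a..b} x \<partial>lborel)"
proof -
  let ?s = "\<lambda>n \<omega>. of_nat (sign_changes (dirichlet_F X \<omega>) a b n) :: ennreal"
  have eq: "AE \<omega> in M. zero_count a b \<omega> = liminf (\<lambda>n. ?s n \<omega>)"
    using AE_sign_changes_tendsto[OF a] by eventually_elim (simp add: lim_imp_Liminf)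
  show "zero_count a b \<in> borel_measurable (completion M)"
    by (rule borel_measurable_completion_AE[OF _ eq]) measurable
  have "(\<integral>\<^sup>+\<omega>. zero_count a b \<omega> \<partial>completion M) = (\<integral>\<^sup>+\<omega>. liminf (\<lambda>n. ?s n \<omega>) \<partial>M)"
    unfolding nn_integral_completion by (rule nn_integral_cong_AE[OF eq])
  also have "\<dots> = ennreal (integral {a..b} kac_rice_density)"
  proof (rule antisym)
    have "(\<integral>\<^sup>+\<omega>. liminf (\<lambda>n. ?s n \<omega>) \<partial>M) \<le> liminf (\<lambda>n. \<integral>\<^sup>+\<omega>. ?s n \<omega> \<partial>M)"
      by (rule nn_integral_liminf) measurable
    also have "\<dots> = ennreal (integral {a..b} kac_rice_density)"
      by (rule lim_imp_Liminf[OF sequentially_bot nn_integral_sign_changes_tendsto[OF a]])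
    finally show "(\<integral>\<^sup>+\<omega>. liminf (\<lambda>n. ?s n \<omega>) \<partial>M) \<le> ennreal (integral {a..b} kac_rice_density)" .
    show "ennreal (integral {a..b} kac_rice_density) \<le> (\<integral>\<^sup>+\<omega>. liminf (\<lambda>n. ?s n \<omega>) \<partial>M)"
    proof (rule tendsto_upperbound[OF nn_integral_sign_changes_tendsto[OF a]])
      have "(\<integral>\<^sup>+\<omega>. ?s n \<omega> \<partial>M) \<le> (\<integral>\<^sup>+\<omega>. liminf (\<lambda>n. ?s n \<omega>) \<partial>M)" for n
      proof (rule nn_integral_mono_AE)
        show "AE \<omega> in M. ?s n \<omega> \<le> liminf (\<lambda>n. ?s n \<omega>)"
          using eq AE_good
        proof eventually_elim
          case (elim \<omega>)
          then show ?case
            using sign_changes_le_zeros[OF a(2) good_continuous[OF elim(2) a(1)]] by (simp add: zero_count_def)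
        qed
      qed
      then show "\<forall>\<^sub>F n in sequentially. (\<integral>\<^sup>+\<omega>. ?s n \<omega> \<partial>M) \<le> (\<integral>\<^sup>+\<omega>. liminf (\<lambda>n. ?s n \<omega>) \<partial>M)"
        by simp
    qed simp
  qed
  also have "ennreal (integral {a..b} kac_rice_density) = (\<integral>\<^sup>+x. ennreal (kac_rice_density x) * indicator {a..b} x \<partial>lborel)"
    using a by (intro nn_integral_eq_integral_continuous[symmetric] continuous_on_subset[OF continuous_on_kac_rice_density])
      (auto intro: kac_rice_density_nonneg)
  finally show "(\<integral>\<^sup>+\<omega>. zero_count a b \<omega> \<partial>completion M) = (\<integral>\<^sup>+x. ennreal (kac_rice_density x) * indicator {a..b} x \<partial>lborel)" .
qed

text \<open>\<open>Suc m\<close> instead of \<open>m\<close> keeps the intervals nondegenerate, as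
  the formula on compact intervals demands.\<close>

lemma num_zeros_SUP: "num_zeros X T \<omega> = (SUP m. zero_count T (T + real (Suc m)) \<omega>)"
proof -
  let ?A = "\<lambda>m. {x. T \<le> x \<and> x \<le> T + real (Suc m) \<and> dirichlet_F X \<omega> x = 0}"
  have "(SUP m. emeasure (count_space UNIV) (?A m)) = emeasure (count_space UNIV) (\<Union>m. ?A m)"
    by (rule SUP_emeasure_incseq) (auto simp: incseq_def)
  also have "(\<Union>m. ?A m) = {x. T \<le> x \<and> dirichlet_F X \<omega> x = 0}"
  proof (intro set_eqI iffI)
    fix x assume x: "x \<in> {x. T \<le> x \<and> dirichlet_F X \<omega> x = 0}"
    obtain m :: nat where "x - T \<le> real m" using real_arch_simple by blast
    with x show "x \<in> (\<Union>m. ?A m)" by (auto intro!: exI[of _ m])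
  qed auto
  finally show ?thesis by (simp add: num_zeros_def zero_count_def)
qed

lemma num_zeros_measurable:
  assumes "1 / 2 < T"
  shows "num_zeros X T \<in> borel_measurable (completion M)"
  unfolding num_zeros_SUP[abs_def]
  using zero_count_measurable_nn_integral(1)[OF assms] by (intro borel_measurable_SUP) auto

theorem kac_rice:
  assumes T: "1 / 2 < T"
  shows "expected_zeros M X T = (\<integral>\<^sup>+x. ennreal (kac_rice_density x) * indicator {T..} x \<partial>lborel)"
proof -
  have inc: "incseq (\<lambda>m. zero_count T (T + real (Suc m)))"
    unfolding incseq_def le_fun_def zero_count_def by (auto intro!: emeasure_mono)
  have "expected_zeros M X T = (\<integral>\<^sup>+\<omega>. (SUP m. zero_count T (T + real (Suc m)) \<omega>) \<partial>completion M)"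
    by (simp add: expected_zeros_def num_zeros_SUP)
  also have "\<dots> = (SUP m. \<integral>\<^sup>+\<omega>. zero_count T (T + real (Suc m)) \<omega> \<partial>completion M)"
    using zero_count_measurable_nn_integral(1)[OF T] by (intro nn_integral_monotone_convergence_SUP inc) auto
  also have "\<dots> = (SUP m. \<integral>\<^sup>+x. ennreal (kac_rice_density x) * indicator {T..T + real (Suc m)} x \<partial>lborel)"
    using zero_count_measurable_nn_integral(2)[OF T] by simp
  also have "\<dots> = (\<integral>\<^sup>+x. (SUP m. ennreal (kac_rice_density x) * indicator {T..T + real (Suc m)} x) \<partial>lborel)"
    by (rule nn_integral_monotone_convergence_SUP[symmetric])
       (auto simp: incseq_def le_fun_def intro!: mult_left_mono split: split_indicator)
  also have "\<dots> = (\<integral>\<^sup>+x. ennreal (kac_rice_density x) * indicator {T..} x \<partial>lborel)"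
  proof (intro nn_integral_cong antisym)
    fix x
    show "(SUP m. ennreal (kac_rice_density x) * indicator {T..T + real (Suc m)} x) \<le> ennreal (kac_rice_density x) * indicator {T..} x"
      by (intro SUP_least mult_left_mono) (auto split: split_indicator)
    obtain m :: nat where "x - T \<le> real m" using real_arch_simple by blast
    then show "ennreal (kac_rice_density x) * indicator {T..} x \<le> (SUP m. ennreal (kac_rice_density x) * indicator {T..T + real (Suc m)} x)"
      by (intro SUP_upper2[of m]) (auto split: split_indicator)
  qed
  finally show ?thesis .
qed

end

section \<open>Integrating the density over the half-line\<close>

lemma kac_rice_tail_finite:
  assumes T: "1 / 2 < T"
  shows "(\<integral>\<^sup>+x. ennreal (kac_rice_density x) * indicator {T..} x \<partial>lborel) < \<infinity>"
proof -
  \<comment> \<open>The exponential bound on (ln zeta)'' at 2 x requires 2 x \<ge> 3. Its square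
    root gives C 2 powr (-x), and this explains the splitting point 3 / 2.\<close>
  define C where "C = sqrt (8 * zeta_log 2 3) / pi"
  have C: "0 \<le> C" using zeta_log_nonneg[of 3 2] by (simp add: C_def)
  have le: "kac_rice_density x \<le> C * 2 powr (-x)" if "3 / 2 \<le> x" for x
  proof -
    have "ln_zeta_deriv2 (2 * x) \<le> 8 * zeta_log 2 3 * 2 powr (- (2 * x))"
      using that by (intro ln_zeta_deriv2_le) simp
    also have "2 powr (- (2 * x)) = (2 powr (-x))\<^sup>2"
      by (simp add: power2_eq_square powr_add[symmetric])
    finally have "sqrt (ln_zeta_deriv2 (2 * x)) \<le> sqrt (8 * zeta_log 2 3 * (2 powr (-x))\<^sup>2)"
      by (rule real_sqrt_le_mono)
    also have "\<dots> = sqrt (8 * zeta_log 2 3) * 2 powr (-x)" by (simp add: real_sqrt_mult)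
    finally show ?thesis by (simp add: kac_rice_density_def C_def divide_right_mono)
  qed
  have "(\<integral>\<^sup>+x. ennreal (C * 2 powr (-x)) * indicator {3 / 2..} x \<partial>lborel) = ennreal (0 - (- C * 2 powr (- (3 / 2)) / ln 2))"
  proof (rule nn_integral_FTC_atLeast)
    fix x :: real
    show "((\<lambda>x. - C * 2 powr (-x) / ln 2) has_real_derivative C * 2 powr (-x)) (at x)"
      by (auto intro!: derivative_eq_intros)
  next
    have "((\<lambda>x::real. 2 powr (-x)) \<longlongrightarrow> 0) at_top" by real_asymp
    from tendsto_mult_right[OF this, of "- C / ln 2"]
    show "((\<lambda>x. - C * 2 powr (-x) / ln 2) \<longlongrightarrow> 0) at_top" by (simp add: mult.commute)
  qed (use C in auto)
  then have tail: "(\<integral>\<^sup>+x. ennreal (C * 2 powr (-x)) * indicator {3 / 2..} x \<partial>lborel) < \<infinity>" by simp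
  have head: "(\<integral>\<^sup>+x. ennreal (kac_rice_density x) * indicator {T..3 / 2} x \<partial>lborel) < \<infinity>"
    using T by (subst nn_integral_eq_integral_continuous)
      (auto intro!: continuous_on_subset[OF continuous_on_kac_rice_density] kac_rice_density_nonneg)
  have "(\<integral>\<^sup>+x. ennreal (kac_rice_density x) * indicator {T..} x \<partial>lborel)
      \<le> (\<integral>\<^sup>+x. ennreal (kac_rice_density x) * indicator {T..3 / 2} x + ennreal (C * 2 powr (-x)) * indicator {3 / 2..} x \<partial>lborel)"
    by (intro nn_integral_mono) (auto split: split_indicator intro!: ennreal_leI le add_increasing2)
  also have "\<dots> = (\<integral>\<^sup>+x. ennreal (kac_rice_density x) * indicator {T..3 / 2} x \<partial>lborel)
      + (\<integral>\<^sup>+x. ennreal (C * 2 powr (-x)) * indicator {3 / 2..} x \<partial>lborel)"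
    by (rule nn_integral_add) auto
  also have "\<dots> < \<infinity>" using head tail by (simp add: ennreal_add_less_top)
  finally show ?thesis .
qed

lemma kac_rice_integral_expansion:
  "\<exists>\<delta>>0. \<exists>c0 :: real. \<exists>c :: nat \<Rightarrow> real. \<forall>T\<in>{1/2<..<1/2 + \<delta>}.
     summable (\<lambda>k. c (k + 2) * (T - 1/2) ^ (k + 2)) \<and>
     enn2ereal (\<integral>\<^sup>+x. ennreal (kac_rice_density x) * indicator {T..} x \<partial>lborel)
       = ereal (1 / (2 * pi) * ln (1 / (T - 1/2)) + c0 + (\<Sum>k. c (k + 2) * (T - 1/2) ^ (k + 2)))"
proof -
  obtain \<rho> c where \<rho>: "0 < \<rho>"
    and summ: "\<forall>x. \<bar>x\<bar> < \<rho> \<longrightarrow> summable (\<lambda>k. c (k + 2) * x ^ (k + 2) :: real)"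
    and D: "\<forall>x. 0 < x \<longrightarrow> x < \<rho> \<longrightarrow> ((\<lambda>x. ln x / (2 * pi) - (\<Sum>k. c (k + 2) * x ^ (k + 2))) has_real_derivative
      sqrt (ln_zeta_deriv2 (1 + 2 * x)) / pi) (at x)"
    using sqrt_ln_zeta_deriv2_antiderivative by blast
  define P where "P x = ln x / (2 * pi) - (\<Sum>k. c (k + 2) * x ^ (k + 2))" for x
  \<comment> \<open>Half the radius, so that the antiderivative is still differentiable at the
    endpoint T0 = 1/2 + \<delta>.\<close>
  define \<delta> where "\<delta> = \<rho> / 2"
  have \<delta>: "0 < \<delta>" "\<delta> < \<rho>" using \<rho> by (auto simp: \<delta>_def)
  have DP: "((\<lambda>x. P (x - 1 / 2)) has_real_derivative kac_rice_density x) (at x)"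
    if "1 / 2 < x" "x - 1 / 2 < \<rho>" for x
  proof -
    have e: "1 + 2 * (x - 1 / 2) = 2 * x" by simp
    have "0 < x - 1 / 2" using that by simp
    from D[rule_format, OF this that(2)]
    have "(P has_real_derivative sqrt (ln_zeta_deriv2 (1 + 2 * (x - 1 / 2))) / pi) (at (x - 1 / 2))"
      unfolding P_def[abs_def] .
    then have "(P has_real_derivative kac_rice_density x) (at (x - 1 / 2))"
      unfolding e kac_rice_density_def .
    then show ?thesis by (rule DERIV_cong[OF DERIV_chain2]) (auto intro!: derivative_eq_intros)
  qed
  let ?I = "\<lambda>T. \<integral>\<^sup>+x. ennreal (kac_rice_density x) * indicator {T..} x \<partial>lborel"
  define T0 where "T0 = 1 / 2 + \<delta>"
  obtain K where K: "?I T0 = ennreal K" "0 \<le> K"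
    using kac_rice_tail_finite[of T0] \<delta> by (cases "?I T0") (auto simp: T0_def)
  have I: "?I T = ennreal (P \<delta> - P (T - 1 / 2) + K) \<and> 0 \<le> P \<delta> - P (T - 1 / 2) + K" if T: "T \<in> {1/2<..<1/2 + \<delta>}" for T
  proof -
    \<comment> \<open>The point \<open>T0\<close> lies in both intervals, hence equality only almost
      everywhere.\<close>
    have "?I T = (\<integral>\<^sup>+x. ennreal (kac_rice_density x) * indicator {T..T0} x + ennreal (kac_rice_density x) * indicator {T0..} x \<partial>lborel)"
    proof (rule nn_integral_cong_AE)
      show "AE x in lborel. ennreal (kac_rice_density x) * indicator {T..} x =
          ennreal (kac_rice_density x) * indicator {T..T0} x + ennreal (kac_rice_density x) * indicator {T0..} x"
        using AE_lborel_singleton[of T0]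
      proof eventually_elim
        case (elim x)
        then show ?case using T by (auto simp: T0_def split: split_indicator)
      qed
    qed
    also have "\<dots> = (\<integral>\<^sup>+x. ennreal (kac_rice_density x) * indicator {T..T0} x \<partial>lborel) + ?I T0"
      by (rule nn_integral_add) auto
    also have "(\<integral>\<^sup>+x. ennreal (kac_rice_density x) * indicator {T..T0} x \<partial>lborel) = ennreal (P (T0 - 1 / 2) - P (T - 1 / 2))"
    proof (rule nn_integral_FTC_Icc)
      fix x assume "x \<in> {T..T0}"
      then have x: "1 / 2 < x" "x - 1 / 2 < \<rho>" using T \<delta> by (auto simp: T0_def)
      show "((\<lambda>x. P (x - 1 / 2)) has_real_derivative kac_rice_density x) (at x)"
        by (rule DP[OF x])
      show "0 \<le> kac_rice_density x" by (rule kac_rice_density_nonneg[OF x(1)])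
    qed (use T in \<open>auto simp: T0_def\<close>)
    finally have A: "?I T = ennreal (P (T0 - 1 / 2) - P (T - 1 / 2)) + ennreal K" unfolding K(1) .
    have "P (T - 1 / 2) \<le> P (T0 - 1 / 2)"
    proof (rule DERIV_nonneg_imp_nondecreasing[where f = "\<lambda>x. P (x - 1 / 2)"])
      fix x assume "T \<le> x" "x \<le> T0"
      then have x: "1 / 2 < x" "x - 1 / 2 < \<rho>" using T \<delta> by (auto simp: T0_def)
      show "\<exists>y. ((\<lambda>x. P (x - 1 / 2)) has_real_derivative y) (at x) \<and> 0 \<le> y"
        using DP[OF x] kac_rice_density_nonneg[OF x(1)] by blast
    qed (use T in \<open>simp add: T0_def\<close>)
    then show ?thesis using A K(2) by (simp add: T0_def flip: ennreal_plus)
  qed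
  show ?thesis
  proof (intro exI conjI ballI)
    show "0 < \<delta>" by (rule \<delta>(1))
    fix T assume T: "T \<in> {1/2<..<1/2 + \<delta>}"
    then have x: "0 < T - 1 / 2" "\<bar>T - 1 / 2\<bar> < \<rho>" using \<delta> by auto
    show "summable (\<lambda>k. c (k + 2) * (T - 1/2) ^ (k + 2))" using summ x(2) by blast
    \<comment> \<open>The constant term P \<delta> + K combines the antiderivative at the upper end
      with the tail integral \<open>K\<close> beyond \<open>T0\<close>. The minus sign before P (T -
      1/2) inverts the logarithm and makes the series appear with a plus.\<close>
    have "P \<delta> - P (T - 1 / 2) + K = 1 / (2 * pi) * ln (1 / (T - 1/2)) + (P \<delta> + K) + (\<Sum>k. c (k + 2) * (T - 1/2) ^ (k + 2))"
      using x(1) by (simp add: P_def ln_div)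
    then show "enn2ereal (?I T) = ereal (1 / (2 * pi) * ln (1 / (T - 1/2)) + (P \<delta> + K) + (\<Sum>k. c (k + 2) * (T - 1/2) ^ (k + 2)))"
      using I[OF T] by (simp only: enn2ereal_ennreal)
  qed
qed

theorem theorem1p1:
  fixes M :: "'a measure" and X :: "nat \<Rightarrow> 'a \<Rightarrow> real"
  assumes "prob_space M"
    and "prob_space.indep_vars M (\<lambda>_. borel) X {1..}"
    and "\<And>n. n \<ge> 1 \<Longrightarrow> distributed M lborel (X n) std_normal_density"
  shows "(AE \<omega> in M. \<forall>\<sigma>>1/2. summable (\<lambda>k. X (Suc k) \<omega> * real (Suc k) powr (-\<sigma>)))
    \<and> (\<forall>T>1/2. num_zeros X T \<in> borel_measurable (completion M))
    \<and> (\<exists>\<delta>>0. \<exists>c0 :: real. \<exists>c :: nat \<Rightarrow> real. \<forall>T\<in>{1/2<..<1/2 + \<delta>}.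
          summable (\<lambda>k. c (k + 2) * (T - 1/2) ^ (k + 2))
        \<and> enn2ereal (expected_zeros M X T)
            = ereal (1 / (2 * pi) * ln (1 / (T - 1/2)) + c0
                + (\<Sum>k. c (k + 2) * (T - 1/2) ^ (k + 2))))"
proof -
  interpret prob_space M by fact
  interpret gaussian_sequence M X
    by unfold_locales (use assms(2,3) in auto)
  have "AE \<omega> in M. \<forall>\<sigma>>1/2. summable (\<lambda>k. X (Suc k) \<omega> * real (Suc k) powr (-\<sigma>))"
    using AE_good by eventually_elim (blast intro: good_summable)
  moreover have "\<forall>T>1/2. num_zeros X T \<in> borel_measurable (completion M)"
    using num_zeros_measurable by blast
  moreover obtain \<delta> c0 c where \<delta>: "0 < \<delta>" "\<forall>T\<in>{1/2<..<1/2 + \<delta>}.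
     summable (\<lambda>k. c (k + 2) * (T - 1/2) ^ (k + 2)) \<and>
     enn2ereal (\<integral>\<^sup>+x. ennreal (kac_rice_density x) * indicator {T..} x \<partial>lborel)
       = ereal (1 / (2 * pi) * ln (1 / (T - 1/2)) + c0 + (\<Sum>k. c (k + 2) * (T - 1/2) ^ (k + 2)))"
    using kac_rice_integral_expansion by blast
  moreover have "expected_zeros M X T = (\<integral>\<^sup>+x. ennreal (kac_rice_density x) * indicator {T..} x \<partial>lborel)"
    if "T \<in> {1/2<..<1/2 + \<delta>}" for T
    using that by (intro kac_rice) auto
  ultimately show ?thesis
    by (intro conjI exI[of _ \<delta>] exI[of _ c0] exI[of _ c]) auto
qed

end
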